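(* Let $X$ be a smooth and geometrically irreducible variety over a field $k$. If the elementary obstruction to the existence of a $0$-cycle of degree $1$ on $X$ vanishes, that is, if $\mathrm{ob}(X)=0$, then the exact sequence of profinite groups $$1 \to G^{\mathrm{ab}}_{\bar k(X)} \to G^{[\mathrm{ab}]}_{k(X)} \to G_k \to 1$$ splits.
   Context: Notation: $\bar k$ is a separable closure of $k$ and $G_k=\mathrm{Gal}(\bar k/k)$. $k(X)$ is the function field of $X$, $\bar k(X)=k(X)\otimes_k\bar k$ (a field), $\overline{k(X)}$ is a separable closure of $\bar k(X)$, and $\bar k(X)^{\mathrm{ab}}$ is the maximal abelian subextension of $\overline{k(X)}/\bar k(X)$. Set $G^{\mathrm{ab}}_{\bar k(X)}=\mathrm{Gal}(\bar k(X)^{\mathrm{ab}}/\bar k(X))$ and $G^{[\mathrm{ab}]}_{k(X)}=\mathrm{Gal}(\bar k(X)^{\mathrm{ab}}/k(X))$; the map $G^{[\mathrm{ab}]}_{k(X)}\to G_k$ is restriction to $\bar k$. The sequence "splits" if this map admits a continuous homomorphic section. $\mathrm{Ext}_{G_k}$ denotes Ext groups in the category of discrete $G_k$-modules. The elementary obstruction $\mathrm{ob}(X)\in \mathrm{Ext}^1_{G_k}(\bar k(X)^\star/\bar k^\star,\bar k^\star)$ is the class of the extension of discrete $G_k$-modules $0\to\bar k^\star\to\bar k(X)^\star\to\bar k(X)^\star/\bar k^\star\to 0$, where $F^\star$ is the multiplicative group of a field $F$ and $G_k$ acts on $\bar k(X)=k(X)\otimes_k\bar k$ through the second factor. *)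

theory Defs
  imports
    "HOL-Analysis.Function_Topology"
    "HOL-Algebra.Algebra"
    "HOL-Algebra.Algebraic_Closure_Type"
    "HOL-Combinatorics.Permutations"
begin

section \<open>Ringed spaces, affine schemes, schemes\<close>

text \<open>Rings of sections are HOL-Algebra rings; only the values of \<open>sections\<close> and \<open>restr\<close>
  at open sets matter. \<open>restr Z U V\<close> is the restriction from \<open>U\<close> to \<open>V\<close>.\<close>

record ('x, 's) ringed_space =
  space :: "'x topology"
  sections :: "'x set \<Rightarrow> 's ring"
  restr :: "'x set \<Rightarrow> 'x set \<Rightarrow> 's \<Rightarrow> 's"

abbreviation points :: "('x, 's) ringed_space \<Rightarrow> 'x set"
  where "points Z \<equiv> topspace (space Z)"

definition sheaf_of_rings :: "('x, 's) ringed_space \<Rightarrow> bool" where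
  "sheaf_of_rings Z \<longleftrightarrow>
    (\<forall>U. openin (space Z) U \<longrightarrow> cring (sections Z U)) \<and>
    (\<forall>U V. openin (space Z) U \<and> openin (space Z) V \<and> V \<subseteq> U \<longrightarrow>
       restr Z U V \<in> ring_hom (sections Z U) (sections Z V)) \<and>
    (\<forall>U. openin (space Z) U \<longrightarrow> (\<forall>s\<in>carrier (sections Z U). restr Z U U s = s)) \<and>
    (\<forall>U V W. openin (space Z) U \<and> openin (space Z) V \<and> openin (space Z) W \<and> W \<subseteq> V \<and> V \<subseteq> U \<longrightarrow>
       (\<forall>s\<in>carrier (sections Z U). restr Z V W (restr Z U V s) = restr Z U W s)) \<and>
    (\<forall>\<U>. (\<forall>U\<in>\<U>. openin (space Z) U) \<longrightarrow>
       (\<forall>s\<in>carrier (sections Z (\<Union>\<U>)). \<forall>t\<in>carrier (sections Z (\<Union>\<U>)).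
          (\<forall>U\<in>\<U>. restr Z (\<Union>\<U>) U s = restr Z (\<Union>\<U>) U t) \<longrightarrow> s = t) \<and>
       (\<forall>s. (\<forall>U\<in>\<U>. s U \<in> carrier (sections Z U)) \<and>
            (\<forall>U\<in>\<U>. \<forall>V\<in>\<U>. restr Z U (U \<inter> V) (s U) = restr Z V (U \<inter> V) (s V)) \<longrightarrow>
          (\<exists>t\<in>carrier (sections Z (\<Union>\<U>)). \<forall>U\<in>\<U>. restr Z (\<Union>\<U>) U t = s U)))"

definition open_subspace :: "('x, 's) ringed_space \<Rightarrow> 'x set \<Rightarrow> ('x, 's) ringed_space" where
  "open_subspace Z U =
    \<lparr>space = subtopology (space Z) U, sections = sections Z, restr = restr Z\<rparr>"

text \<open>The germ at \<open>x\<close> of a section \<open>s\<close> over \<open>U\<close>, as an equivalence class of pairs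
  (neighbourhood, section); the stalk is the ring of all germs.\<close>

definition germ :: "('x, 's) ringed_space \<Rightarrow> 'x \<Rightarrow> 'x set \<Rightarrow> 's \<Rightarrow> ('x set \<times> 's) set" where
  "germ Z x U s = {(V, t). openin (space Z) V \<and> x \<in> V \<and> t \<in> carrier (sections Z V) \<and>
     (\<exists>W. openin (space Z) W \<and> x \<in> W \<and> W \<subseteq> U \<inter> V \<and> restr Z U W s = restr Z V W t)}"

definition stalk :: "('x, 's) ringed_space \<Rightarrow> 'x \<Rightarrow> ('x set \<times> 's) set ring" where
  "stalk Z x =
    \<lparr>carrier = {germ Z x U s |U s. openin (space Z) U \<and> x \<in> U \<and> s \<in> carrier (sections Z U)},
     monoid.mult = (\<lambda>g h. \<Union>(U, s)\<in>g. \<Union>(V, t)\<in>h.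
       germ Z x (U \<inter> V) (restr Z U (U \<inter> V) s \<otimes>\<^bsub>sections Z (U \<inter> V)\<^esub> restr Z V (U \<inter> V) t)),
     one = germ Z x (points Z) \<one>\<^bsub>sections Z (points Z)\<^esub>,
     ring.zero = germ Z x (points Z) \<zero>\<^bsub>sections Z (points Z)\<^esub>,
     add = (\<lambda>g h. \<Union>(U, s)\<in>g. \<Union>(V, t)\<in>h.
       germ Z x (U \<inter> V) (restr Z U (U \<inter> V) s \<oplus>\<^bsub>sections Z (U \<inter> V)\<^esub> restr Z V (U \<inter> V) t))\<rparr>"

definition local_ring :: "('a, 'm) ring_scheme \<Rightarrow> bool" where
  "local_ring R \<longleftrightarrow> cring R \<and> (\<exists>!M. maximalideal M R)"

definition locally_ringed_space :: "('x, 's) ringed_space \<Rightarrow> bool" where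
  "locally_ringed_space Z \<longleftrightarrow> sheaf_of_rings Z \<and> (\<forall>x\<in>points Z. local_ring (stalk Z x))"

definition preimage :: "('y, 't) ringed_space \<Rightarrow> ('y \<Rightarrow> 'x) \<Rightarrow> 'x set \<Rightarrow> 'y set" where
  "preimage Y f V = {y \<in> points Y. f y \<in> V}"

text \<open>A morphism \<open>Y \<rightarrow> Z\<close> consists of a continuous map \<open>f\<close> and of compatible ring homomorphisms
  \<open>f\<^sup># V\<close> from the sections of \<open>Z\<close> over \<open>V\<close> to the sections of \<open>Y\<close> over the preimage of \<open>V\<close>.\<close>

definition ringed_space_morphism ::
    "('y, 't) ringed_space \<Rightarrow> ('x, 's) ringed_space \<Rightarrow> ('y \<Rightarrow> 'x) \<Rightarrow> ('x set \<Rightarrow> 's \<Rightarrow> 't) \<Rightarrow> bool" where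
  "ringed_space_morphism Y Z f fs \<longleftrightarrow>
    continuous_map (space Y) (space Z) f \<and>
    (\<forall>V. openin (space Z) V \<longrightarrow> fs V \<in> ring_hom (sections Z V) (sections Y (preimage Y f V))) \<and>
    (\<forall>V W. openin (space Z) V \<and> openin (space Z) W \<and> W \<subseteq> V \<longrightarrow>
       (\<forall>s\<in>carrier (sections Z V).
          fs W (restr Z V W s) = restr Y (preimage Y f V) (preimage Y f W) (fs V s)))"

definition ringed_space_iso ::
    "('y, 't) ringed_space \<Rightarrow> ('x, 's) ringed_space \<Rightarrow> ('y \<Rightarrow> 'x) \<Rightarrow> ('x set \<Rightarrow> 's \<Rightarrow> 't) \<Rightarrow> bool" where
  "ringed_space_iso Y Z f fs \<longleftrightarrow>
    ringed_space_morphism Y Z f fs \<and> homeomorphic_map (space Y) (space Z) f \<and>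
    (\<forall>V. openin (space Z) V \<longrightarrow> fs V \<in> ring_iso (sections Z V) (sections Y (preimage Y f V)))"

text \<open>A morphism of locally ringed spaces moreover induces local homomorphisms on stalks.\<close>

definition lrs_morphism ::
    "('y, 't) ringed_space \<Rightarrow> ('x, 's) ringed_space \<Rightarrow> ('y \<Rightarrow> 'x) \<Rightarrow> ('x set \<Rightarrow> 's \<Rightarrow> 't) \<Rightarrow> bool" where
  "lrs_morphism Y Z f fs \<longleftrightarrow>
    ringed_space_morphism Y Z f fs \<and>
    (\<forall>y\<in>points Y. \<forall>V. openin (space Z) V \<and> f y \<in> V \<longrightarrow>
      (\<forall>s\<in>carrier (sections Z V).
         germ Y y (preimage Y f V) (fs V s) \<in> Units (stalk Y y) \<longrightarrow>
         germ Z (f y) V s \<in> Units (stalk Z (f y))))"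

definition zariski :: "('a, 'm) ring_scheme \<Rightarrow> 'a set topology" where
  "zariski A = topology (\<lambda>S. \<exists>E\<subseteq>carrier A. S = {P. primeideal P A \<and> \<not> E \<subseteq> P})"

lemma istopology_zariski:
  "istopology (\<lambda>S. \<exists>E\<subseteq>carrier A. S = {P. primeideal P A \<and> \<not> E \<subseteq> P})"
  unfolding istopology_def
proof (intro conjI allI impI)
  fix S T
  assume "\<exists>E\<subseteq>carrier A. S = {P. primeideal P A \<and> \<not> E \<subseteq> P}"
    and "\<exists>E\<subseteq>carrier A. T = {P. primeideal P A \<and> \<not> E \<subseteq> P}"
  then obtain E F where E: "E \<subseteq> carrier A" "S = {P. primeideal P A \<and> \<not> E \<subseteq> P}"
    and F: "F \<subseteq> carrier A" "T = {P. primeideal P A \<and> \<not> F \<subseteq> P}"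
    by blast
  define H where "H = {h \<in> carrier A. \<exists>e\<in>E. \<exists>f\<in>F. h = e \<otimes>\<^bsub>A\<^esub> f}"
  have iff: "\<not> H \<subseteq> P \<longleftrightarrow> \<not> E \<subseteq> P \<and> \<not> F \<subseteq> P" if P: "primeideal P A" for P
  proof -
    interpret primeideal P A by (rule P)
    show ?thesis
    proof
      assume "\<not> H \<subseteq> P"
      then obtain e f where "e \<in> E" "f \<in> F" "e \<otimes>\<^bsub>A\<^esub> f \<notin> P"
        by (auto simp: H_def)
      then show "\<not> E \<subseteq> P \<and> \<not> F \<subseteq> P"
        using E(1) F(1) I_l_closed I_r_closed by blast
    next
      assume "\<not> E \<subseteq> P \<and> \<not> F \<subseteq> P"
      then obtain e f where ef: "e \<in> E" "e \<notin> P" "f \<in> F" "f \<notin> P"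
        by blast
      then have "e \<otimes>\<^bsub>A\<^esub> f \<notin> P"
        using I_prime E(1) F(1) by blast
      moreover have "e \<otimes>\<^bsub>A\<^esub> f \<in> H"
        using ef E(1) F(1) by (auto simp: H_def)
      ultimately show "\<not> H \<subseteq> P"
        by blast
    qed
  qed
  have "H \<subseteq> carrier A"
    by (auto simp: H_def)
  moreover have "S \<inter> T = {P. primeideal P A \<and> \<not> H \<subseteq> P}"
    using iff E(2) F(2) by auto
  ultimately show "\<exists>E\<subseteq>carrier A. S \<inter> T = {P. primeideal P A \<and> \<not> E \<subseteq> P}"
    by blast
next
  fix \<K>
  assume "\<forall>K\<in>\<K>. \<exists>E\<subseteq>carrier A. K = {P. primeideal P A \<and> \<not> E \<subseteq> P}"
  then obtain E where E: "\<And>K. K \<in> \<K> \<Longrightarrow> E K \<subseteq> carrier A"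
      "\<And>K. K \<in> \<K> \<Longrightarrow> K = {P. primeideal P A \<and> \<not> E K \<subseteq> P}"
    by metis
  have "(\<Union>K\<in>\<K>. E K) \<subseteq> carrier A"
    using E(1) by blast
  moreover have "\<Union>\<K> = {P. primeideal P A \<and> \<not> (\<Union>K\<in>\<K>. E K) \<subseteq> P}"
    using E(2) by blast
  ultimately show "\<exists>E\<subseteq>carrier A. \<Union>\<K> = {P. primeideal P A \<and> \<not> E \<subseteq> P}"
    by blast
qed

text \<open>\<open>fraction A S a f\<close> is the class of \<open>a/f\<close> in the localization of \<open>A\<close> at \<open>S\<close>.\<close>

definition fraction :: "('a, 'm) ring_scheme \<Rightarrow> 'a set \<Rightarrow> 'a \<Rightarrow> 'a \<Rightarrow> ('a \<times> 'a) set" where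
  "fraction A S a f = {(b, g). b \<in> carrier A \<and> g \<in> S \<and>
     (\<exists>h\<in>S. h \<otimes>\<^bsub>A\<^esub> (g \<otimes>\<^bsub>A\<^esub> a \<ominus>\<^bsub>A\<^esub> f \<otimes>\<^bsub>A\<^esub> b) = \<zero>\<^bsub>A\<^esub>)}"

definition localization :: "('a, 'm) ring_scheme \<Rightarrow> 'a set \<Rightarrow> ('a \<times> 'a) set ring" where
  "localization A S =
    \<lparr>carrier = {fraction A S a f |a f. a \<in> carrier A \<and> f \<in> S},
     monoid.mult = (\<lambda>x y. \<Union>(a, f)\<in>x. \<Union>(b, g)\<in>y. fraction A S (a \<otimes>\<^bsub>A\<^esub> b) (f \<otimes>\<^bsub>A\<^esub> g)),
     one = fraction A S \<one>\<^bsub>A\<^esub> \<one>\<^bsub>A\<^esub>,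
     ring.zero = fraction A S \<zero>\<^bsub>A\<^esub> \<one>\<^bsub>A\<^esub>,
     add = (\<lambda>x y. \<Union>(a, f)\<in>x. \<Union>(b, g)\<in>y.
       fraction A S (a \<otimes>\<^bsub>A\<^esub> g \<oplus>\<^bsub>A\<^esub> b \<otimes>\<^bsub>A\<^esub> f) (f \<otimes>\<^bsub>A\<^esub> g))\<rparr>"

abbreviation local_at :: "('a, 'm) ring_scheme \<Rightarrow> 'a set \<Rightarrow> ('a \<times> 'a) set ring" where
  "local_at A P \<equiv> localization A (carrier A - P)"

text \<open>Sections of the structure sheaf over \<open>U\<close> are families of elements of the local rings
  at the primes in \<open>U\<close> that are locally given by a single fraction.\<close>

definition Spec :: "('a, 'm) ring_scheme \<Rightarrow> ('a set, 'a set \<Rightarrow> ('a \<times> 'a) set) ringed_space" where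
  "Spec A =
    \<lparr>space = zariski A,
     sections = (\<lambda>U.
       \<lparr>carrier = {s \<in> (\<Pi>\<^sub>E P\<in>U. carrier (local_at A P)).
          \<forall>P\<in>U. \<exists>V a f. openin (zariski A) V \<and> P \<in> V \<and> V \<subseteq> U \<and> a \<in> carrier A \<and> f \<in> carrier A \<and>
            (\<forall>Q\<in>V. f \<notin> Q \<and> s Q = fraction A (carrier A - Q) a f)},
        monoid.mult = (\<lambda>s t. \<lambda>P\<in>U. s P \<otimes>\<^bsub>local_at A P\<^esub> t P),
        one = (\<lambda>P\<in>U. \<one>\<^bsub>local_at A P\<^esub>),
        ring.zero = (\<lambda>P\<in>U. \<zero>\<^bsub>local_at A P\<^esub>),
        add = (\<lambda>s t. \<lambda>P\<in>U. s P \<oplus>\<^bsub>local_at A P\<^esub> t P)\<rparr>),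
     restr = (\<lambda>U V s. restrict s V)\<rparr>"

text \<open>The ring \<open>A\<close> can be sought in the type of the sections, since necessarily \<open>A\<close> is
  isomorphic to the ring of sections over \<open>U\<close>.\<close>

definition affine_open :: "('x, 's) ringed_space \<Rightarrow> 'x set \<Rightarrow> bool" where
  "affine_open Z U \<longleftrightarrow> openin (space Z) U \<and>
    (\<exists>(A :: 's ring) f fs. cring A \<and> ringed_space_iso (open_subspace Z U) (Spec A) f fs)"

definition scheme :: "('x, 's) ringed_space \<Rightarrow> bool" where
  "scheme Z \<longleftrightarrow> locally_ringed_space Z \<and> (\<forall>x\<in>points Z. \<exists>U. x \<in> U \<and> affine_open Z U)"

definition irreducible_topology :: "'x topology \<Rightarrow> bool" where
  "irreducible_topology T \<longleftrightarrow> topspace T \<noteq> {} \<and>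
    (\<forall>C D. closedin T C \<and> closedin T D \<and> C \<union> D = topspace T \<longrightarrow> C = topspace T \<or> D = topspace T)"

definition generic_point :: "('x, 's) ringed_space \<Rightarrow> 'x" where
  "generic_point Z = (THE x. x \<in> points Z \<and> space Z closure_of {x} = points Z)"

section \<open>Schemes over a field\<close>

text \<open>A structure of scheme over the field \<open>k\<close>, that is, a morphism to \<open>Spec k\<close>, is given by a
  ring homomorphism \<open>c\<close> from \<open>k\<close> to the ring of global sections. The field \<open>k\<close> is a type; a
  subfield \<open>L\<close> of a field type is turned into a HOL-Algebra field by \<open>fld L\<close>.\<close>

definition fld :: "'o::field set \<Rightarrow> 'o ring" where
  "fld L = ring_of_type_algebra\<lparr>carrier := L\<rparr>"

definition scheme_over :: "'k::field set \<Rightarrow> ('k \<Rightarrow> 's) \<Rightarrow> ('x, 's) ringed_space \<Rightarrow> bool" where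
  "scheme_over k c Z \<longleftrightarrow> scheme Z \<and> c \<in> ring_hom (fld k) (sections Z (points Z))"

definition scalar :: "('x, 's) ringed_space \<Rightarrow> ('k \<Rightarrow> 's) \<Rightarrow> 'x set \<Rightarrow> 'k \<Rightarrow> 's" where
  "scalar Z c U = (\<lambda>a. restr Z (points Z) U (c a))"

definition finite_type :: "('k::field \<Rightarrow> 's) \<Rightarrow> ('x, 's) ringed_space \<Rightarrow> bool" where
  "finite_type c Z \<longleftrightarrow> (\<exists>\<U>. finite \<U> \<and> \<Union>\<U> = points Z \<and>
    (\<forall>U\<in>\<U>. affine_open Z U \<and>
      (\<exists>S. finite S \<and> S \<subseteq> carrier (sections Z U) \<and>
         carrier (sections Z U) = generate_ring (sections Z U) (range (scalar Z c U) \<union> S))))"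

text \<open>The diagonal of \<open>Z\<close> is a closed immersion: over the product of the affine opens \<open>U\<close> and \<open>V\<close>
  it restricts to a morphism from \<open>U \<inter> V\<close> to the spectrum of the tensor product of the rings of
  \<open>U\<close> and of \<open>V\<close>, which is a closed immersion if and only if \<open>U \<inter> V\<close> is affine and the map from
  the tensor product to the ring of \<open>U \<inter> V\<close> is surjective.\<close>

definition separated :: "('x, 's) ringed_space \<Rightarrow> bool" where
  "separated Z \<longleftrightarrow> (\<forall>U V. affine_open Z U \<and> affine_open Z V \<longrightarrow>
    affine_open Z (U \<inter> V) \<and>
    carrier (sections Z (U \<inter> V)) = generate_ring (sections Z (U \<inter> V))
      (restr Z U (U \<inter> V) ` carrier (sections Z U) \<union> restr Z V (U \<inter> V) ` carrier (sections Z V)))"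

definition variety :: "('k::field \<Rightarrow> 's) \<Rightarrow> ('x, 's) ringed_space \<Rightarrow> bool" where
  "variety c Z \<longleftrightarrow> scheme_over UNIV c Z \<and> finite_type c Z \<and> separated Z"

subsection \<open>Smoothness\<close>

text \<open>Polynomials in the variables \<open>x\<^sub>0, x\<^sub>1, \<dots>\<close>: exponent vectors are mapped to coefficients.\<close>

type_synonym 'k mpoly = "(nat \<Rightarrow>\<^sub>0 nat) \<Rightarrow>\<^sub>0 'k"

definition mpolys :: "nat \<Rightarrow> 'k::field mpoly set" where
  "mpolys n = {p. \<forall>m\<in>Poly_Mapping.keys p. Poly_Mapping.keys m \<subseteq> {..<n}}"

definition partial_deriv :: "nat \<Rightarrow> 'k::field mpoly \<Rightarrow> 'k mpoly" where
  "partial_deriv j p = (\<Sum>m\<in>Poly_Mapping.keys p.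
     Poly_Mapping.single (m - Poly_Mapping.single j 1)
       (of_nat (Poly_Mapping.lookup m j) * Poly_Mapping.lookup p m))"

definition jacobian_det :: "nat \<Rightarrow> (nat \<Rightarrow> 'k::field mpoly) \<Rightarrow> 'k mpoly" where
  "jacobian_det r f = (\<Sum>\<pi> | \<pi> permutes {..<r}.
     of_int (sign \<pi>) * (\<Prod>i<r. partial_deriv (\<pi> i) (f i)))"

definition mpoly_eval :: "('s, 'm) ring_scheme \<Rightarrow> ('k::field \<Rightarrow> 's) \<Rightarrow> (nat \<Rightarrow> 's) \<Rightarrow> 'k mpoly \<Rightarrow> 's" where
  "mpoly_eval R c x p = (\<Oplus>\<^bsub>R\<^esub>m\<in>Poly_Mapping.keys p.
     c (Poly_Mapping.lookup p m) \<otimes>\<^bsub>R\<^esub>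
     (\<Otimes>\<^bsub>R\<^esub>i\<in>Poly_Mapping.keys m. x i [^]\<^bsub>R\<^esub> Poly_Mapping.lookup m i))"

text \<open>The \<open>k\<close>-algebra \<open>R\<close> is standard smooth: it is isomorphic to
  \<open>k[x\<^sub>0,\<dots>,x\<^sub>n\<^sub>-\<^sub>1]/(f\<^sub>0,\<dots>,f\<^sub>r\<^sub>-\<^sub>1)\<close> with the Jacobian determinant of \<open>f\<^sub>0,\<dots>,f\<^sub>r\<^sub>-\<^sub>1\<close>
  with respect to the first \<open>r\<close> variables invertible.\<close>

definition standard_smooth :: "('k::field \<Rightarrow> 's) \<Rightarrow> ('s, 'm) ring_scheme \<Rightarrow> bool" where
  "standard_smooth c R \<longleftrightarrow> (\<exists>n r x f. r \<le> n \<and>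
     (\<forall>i<n. x i \<in> carrier R) \<and> (\<forall>i<r. f i \<in> mpolys n) \<and>
     mpoly_eval R c x ` mpolys n = carrier R \<and>
     (\<forall>p\<in>mpolys n. mpoly_eval R c x p = \<zero>\<^bsub>R\<^esub> \<longleftrightarrow>
        (\<exists>g. (\<forall>i<r. g i \<in> mpolys n) \<and> p = (\<Sum>i<r. g i * f i))) \<and>
     mpoly_eval R c x (jacobian_det r f) \<in> Units R)"

definition smooth :: "('k::field \<Rightarrow> 's) \<Rightarrow> ('x, 's) ringed_space \<Rightarrow> bool" where
  "smooth c Z \<longleftrightarrow> (\<forall>x\<in>points Z. \<exists>U. x \<in> U \<and> affine_open Z U \<and>
     standard_smooth (scalar Z c U) (sections Z U))"

subsection \<open>Tensor products and base change\<close>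

text \<open>\<open>A\<close> and \<open>B\<close> are algebras over the field \<open>k\<close> through \<open>cA\<close> and \<open>cB\<close>. The tensor product is
  the quotient of the free abelian group on pairs by the bilinearity relations.\<close>

definition tensor_relations ::
    "('k \<Rightarrow> 'a) \<Rightarrow> ('a, 'm) ring_scheme \<Rightarrow> ('k \<Rightarrow> 'b) \<Rightarrow> ('b, 'n) ring_scheme \<Rightarrow> ('a \<times> 'b \<Rightarrow>\<^sub>0 int) set" where
  "tensor_relations cA A cB B =
    {frag_of (a \<oplus>\<^bsub>A\<^esub> a', b) - frag_of (a, b) - frag_of (a', b) |a a' b.
       a \<in> carrier A \<and> a' \<in> carrier A \<and> b \<in> carrier B} \<union>
    {frag_of (a, b \<oplus>\<^bsub>B\<^esub> b') - frag_of (a, b) - frag_of (a, b') |a b b'.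
       a \<in> carrier A \<and> b \<in> carrier B \<and> b' \<in> carrier B} \<union>
    {frag_of (cA l \<otimes>\<^bsub>A\<^esub> a, b) - frag_of (a, cB l \<otimes>\<^bsub>B\<^esub> b) |l a b.
       a \<in> carrier A \<and> b \<in> carrier B}"

text \<open>The \<open>k\<close>-algebra homomorphisms \<open>u\<close> and \<open>v\<close> make \<open>T\<close> a tensor product of \<open>A\<close> and \<open>B\<close> over
  \<open>k\<close>: the map with \<open>a \<otimes> b \<mapsto> u(a)v(b)\<close> is an isomorphism from the tensor product to \<open>T\<close>.\<close>

definition tensor_product ::
    "('k::field \<Rightarrow> 'a) \<Rightarrow> ('a, 'm) ring_scheme \<Rightarrow> ('k \<Rightarrow> 'b) \<Rightarrow> ('b, 'n) ring_scheme \<Rightarrow>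
     ('t, 'l) ring_scheme \<Rightarrow> ('a \<Rightarrow> 't) \<Rightarrow> ('b \<Rightarrow> 't) \<Rightarrow> bool" where
  "tensor_product cA A cB B T u v \<longleftrightarrow>
    u \<in> ring_hom A T \<and> v \<in> ring_hom B T \<and> (\<forall>l. u (cA l) = v (cB l)) \<and>
    (let F = free_Abelian_group (carrier A \<times> carrier B);
         \<phi> = (\<lambda>z. \<Oplus>\<^bsub>T\<^esub>ab\<in>Poly_Mapping.keys z.
                add_pow T (Poly_Mapping.lookup z ab) (u (fst ab) \<otimes>\<^bsub>T\<^esub> v (snd ab)))
     in \<phi> ` carrier F = carrier T \<and>
        (\<forall>z\<in>carrier F. \<phi> z = \<zero>\<^bsub>T\<^esub> \<longleftrightarrow> z \<in> generate F (tensor_relations cA A cB B)))"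

text \<open>\<open>Z'\<close>, with its structure \<open>c'\<close> of scheme over the extension \<open>\<iota> : k \<rightarrow> L\<close> and with the
  projection \<open>(f, f\<^sup>#)\<close> to \<open>Z\<close>, is the fibre product of \<open>Z\<close> and \<open>Spec L\<close> over \<open>Spec k\<close>: it is
  glued from the spectra of the tensor products with \<open>L\<close> of the rings of affine opens of \<open>Z\<close>.
  It is unique up to unique isomorphism; \<open>Z\<close> is geometrically irreducible if \<open>Z'\<close> is irreducible
  when \<open>L\<close> is a separable closure of \<open>k\<close>. As the types of points and sections of \<open>Z'\<close> cannot
  be quantified over, \<open>Z'\<close> is passed around as a parameter.\<close>

definition base_change ::
    "('k::field \<Rightarrow> 's) \<Rightarrow> ('x, 's) ringed_space \<Rightarrow> ('k \<Rightarrow> 'o::field) \<Rightarrow> 'o set \<Rightarrow>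
     ('o \<Rightarrow> 't) \<Rightarrow> ('y, 't) ringed_space \<Rightarrow> ('y \<Rightarrow> 'x) \<Rightarrow> ('x set \<Rightarrow> 's \<Rightarrow> 't) \<Rightarrow> bool" where
  "base_change c Z \<iota> L c' Z' f fs \<longleftrightarrow>
    scheme_over L c' Z' \<and> lrs_morphism Z' Z f fs \<and>
    (\<forall>U. affine_open Z U \<longrightarrow> affine_open Z' (preimage Z' f U) \<and>
       tensor_product (scalar Z c U) (sections Z U) \<iota> (fld L)
         (sections Z' (preimage Z' f U)) (fs U) (scalar Z' c' (preimage Z' f U)))"

definition function_field :: "('x, 's) ringed_space \<Rightarrow> ('x set \<times> 's) set ring" where
  "function_field Z = stalk Z (generic_point Z)"

definition const_function :: "('k \<Rightarrow> 's) \<Rightarrow> ('x, 's) ringed_space \<Rightarrow> 'k \<Rightarrow> ('x set \<times> 's) set" where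
  "const_function c Z = (\<lambda>a. germ Z (generic_point Z) (points Z) (c a))"

section \<open>Galois groups\<close>

text \<open>Field extensions are subfields of an ambient field type \<open>'o\<close>.\<close>

definition separable_closure :: "'o::field set \<Rightarrow> 'o set \<Rightarrow> bool" where
  "separable_closure E L \<longleftrightarrow>
    subfield E ring_of_type_algebra \<and> subfield L ring_of_type_algebra \<and> E \<subseteq> L \<and>
    (\<forall>x\<in>L. \<exists>p. set (coeffs p) \<subseteq> E \<and> coprime p (pderiv p) \<and> poly p x = 0) \<and>
    (\<forall>p. set (coeffs p) \<subseteq> L \<and> coprime p (pderiv p) \<and> degree p > 0 \<longrightarrow> (\<exists>x\<in>L. poly p x = 0))"

text \<open>The automorphisms of \<open>L\<close> over \<open>E\<close>, as functions that are undefined outside \<open>L\<close>.\<close>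

definition Gal :: "'o::field set \<Rightarrow> 'o set \<Rightarrow> ('o \<Rightarrow> 'o) monoid" where
  "Gal L E = BijGroup L
    \<lparr>carrier := {\<sigma> \<in> Bij L. \<sigma> \<in> ring_hom (fld L) (fld L) \<and> (\<forall>x\<in>E. \<sigma> x = x)}\<rparr>"

text \<open>The Krull topology is the topology of pointwise convergence for the discrete topology on \<open>L\<close>:
  the automorphisms fixing a given finite subset of \<open>L\<close> form a basis of neighbourhoods of 1.\<close>

definition krull :: "'o::field set \<Rightarrow> 'o set \<Rightarrow> ('o \<Rightarrow> 'o) topology" where
  "krull L E = subtopology (product_topology (\<lambda>_. discrete_topology L) L) (carrier (Gal L E))"

definition galois_extension :: "'o::field set \<Rightarrow> 'o set \<Rightarrow> bool" where
  "galois_extension E L \<longleftrightarrow>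
    subfield E ring_of_type_algebra \<and> subfield L ring_of_type_algebra \<and> E \<subseteq> L \<and>
    (\<forall>x\<in>L. \<exists>p. p \<noteq> 0 \<and> set (coeffs p) \<subseteq> E \<and> poly p x = 0) \<and>
    {x \<in> L. \<forall>\<sigma>\<in>carrier (Gal L E). \<sigma> x = x} = E"

text \<open>The union of all abelian subextensions is itself one, so it is the largest one.\<close>

definition max_abelian :: "'o::field set \<Rightarrow> 'o set" where
  "max_abelian E = \<Union>{L. galois_extension E L \<and> comm_group (Gal L E)}"

text \<open>The homomorphism \<open>Gal L K \<rightarrow> Gal M k\<close> of restriction to \<open>M\<close> admits a continuous
  homomorphic section.\<close>

definition restriction_splits :: "'o::field set \<Rightarrow> 'o set \<Rightarrow> 'o set \<Rightarrow> 'o set \<Rightarrow> bool" where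
  "restriction_splits L K M k \<longleftrightarrow> (\<exists>s \<in> hom (Gal M k) (Gal L K).
     continuous_map (krull M k) (krull L K) s \<and>
     (\<forall>\<sigma>\<in>carrier (Gal M k). restrict (s \<sigma>) M = \<sigma>))"

section \<open>Extensions of discrete modules\<close>

text \<open>Modules are written multiplicatively.\<close>

record ('g, 'm) gmodule = "'m monoid" +
  act :: "'g \<Rightarrow> 'm \<Rightarrow> 'm"

definition with_action :: "('m, 'l) monoid_scheme \<Rightarrow> ('g \<Rightarrow> 'm \<Rightarrow> 'm) \<Rightarrow> ('g, 'm) gmodule" where
  "with_action M a =
    \<lparr>carrier = carrier M, monoid.mult = (\<otimes>\<^bsub>M\<^esub>), one = \<one>\<^bsub>M\<^esub>, act = a\<rparr>"

text \<open>\<open>G\<close> is a topological group with topology \<open>T\<close>.\<close>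

definition discrete_module :: "('g, 'r) monoid_scheme \<Rightarrow> 'g topology \<Rightarrow> ('g, 'm) gmodule \<Rightarrow> bool" where
  "discrete_module G T M \<longleftrightarrow> comm_group M \<and>
    (\<forall>g\<in>carrier G. act M g \<in> hom M M) \<and>
    (\<forall>m\<in>carrier M. act M \<one>\<^bsub>G\<^esub> m = m) \<and>
    (\<forall>g\<in>carrier G. \<forall>h\<in>carrier G. \<forall>m\<in>carrier M. act M (g \<otimes>\<^bsub>G\<^esub> h) m = act M g (act M h m)) \<and>
    (\<forall>m\<in>carrier M. openin T {g \<in> carrier G. act M g m = m})"

definition module_hom ::
    "('g, 'r) monoid_scheme \<Rightarrow> ('g, 'm) gmodule \<Rightarrow> ('g, 'n) gmodule \<Rightarrow> ('m \<Rightarrow> 'n) set" where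
  "module_hom G M N = {f \<in> hom M N. \<forall>g\<in>carrier G. \<forall>m\<in>carrier M. f (act M g m) = act N g (f m)}"

text \<open>An extension \<open>0 \<rightarrow> A \<rightarrow> B \<rightarrow> C \<rightarrow> 0\<close> is given by the middle term and the two maps.\<close>

type_synonym ('g, 'a, 'b, 'c) ext = "('a \<Rightarrow> 'b) \<times> ('g, 'b) gmodule \<times> ('b \<Rightarrow> 'c)"

definition is_extension ::
    "('g, 'r) monoid_scheme \<Rightarrow> 'g topology \<Rightarrow> ('g, 'c) gmodule \<Rightarrow> ('g, 'a) gmodule \<Rightarrow>
     ('g, 'a, 'b, 'c) ext \<Rightarrow> bool" where
  "is_extension G T C A = (\<lambda>(i, B, p).
    discrete_module G T A \<and> discrete_module G T B \<and> discrete_module G T C \<and>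
    i \<in> module_hom G A B \<and> p \<in> module_hom G B C \<and>
    inj_on i (carrier A) \<and> p ` carrier B = carrier C \<and>
    i ` carrier A = {b \<in> carrier B. p b = \<one>\<^bsub>C\<^esub>})"

definition ext_equivalent ::
    "('g, 'r) monoid_scheme \<Rightarrow> ('g, 'a) gmodule \<Rightarrow>
     ('g, 'a, 'b, 'c) ext \<Rightarrow> ('g, 'a, 'd, 'c) ext \<Rightarrow> bool" where
  "ext_equivalent G A = (\<lambda>(i, B, p) (i', B', p').
    (\<exists>\<phi> \<in> module_hom G B B'. bij_betw \<phi> (carrier B) (carrier B') \<and>
       (\<forall>a\<in>carrier A. \<phi> (i a) = i' a) \<and> (\<forall>b\<in>carrier B. p' (\<phi> b) = p b)))"

text \<open>The class of an extension. Every extension of \<open>C\<close> by \<open>A\<close> is equivalent to one whose middle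
  term lives in the type \<open>'a \<times> 'c\<close>, so it is enough to consider those in forming the class.\<close>

definition ext_class ::
    "('g, 'r) monoid_scheme \<Rightarrow> 'g topology \<Rightarrow> ('g, 'c) gmodule \<Rightarrow> ('g, 'a) gmodule \<Rightarrow>
     ('g, 'a, 'b, 'c) ext \<Rightarrow> ('g, 'a, 'a \<times> 'c, 'c) ext set" where
  "ext_class G T C A E = {E'. is_extension G T C A E' \<and> ext_equivalent G A E E'}"

definition split_extension ::
    "('g, 'c) gmodule \<Rightarrow> ('g, 'a) gmodule \<Rightarrow> ('g, 'a, 'a \<times> 'c, 'c) ext" where
  "split_extension C A =
    ((\<lambda>a. (a, \<one>\<^bsub>C\<^esub>)),
     with_action (A \<times>\<times> C) (\<lambda>g (a, c). (act A g a, act C g c)),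
     snd)"

text \<open>The Baer sum: the quotient of the fibre product of the middle terms over \<open>C\<close> by the
  antidiagonal copy \<open>N\<close> of \<open>A\<close>.\<close>

definition baer_sum ::
    "('g, 'a) gmodule \<Rightarrow> ('g, 'a, 'b, 'c) ext \<Rightarrow> ('g, 'a, 'd, 'c) ext \<Rightarrow>
     ('g, 'a, ('b \<times> 'd) set, 'c) ext" where
  "baer_sum A = (\<lambda>(i, B, p) (i', B', p').
    let P = (B \<times>\<times> B')\<lparr>carrier := {(b, b') \<in> carrier B \<times> carrier B'. p b = p' b'}\<rparr>;
        N = (\<lambda>a. (i a, inv\<^bsub>B'\<^esub> (i' a))) ` carrier A
    in ((\<lambda>a. N #>\<^bsub>P\<^esub> (i a, \<one>\<^bsub>B'\<^esub>)),
        with_action (P Mod N) (\<lambda>g S. (\<lambda>(b, b'). (act B g b, act B' g b')) ` S),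
        (\<lambda>S. THE c. \<forall>(b, b')\<in>S. p b = c)))"

text \<open>The group \<open>Ext\<^sup>1(C, A)\<close> in the category of discrete \<open>G\<close>-modules, following Yoneda. Its
  neutral element (zero) is the class of the split extension.\<close>

definition Ext1 ::
    "('g, 'r) monoid_scheme \<Rightarrow> 'g topology \<Rightarrow> ('g, 'c) gmodule \<Rightarrow> ('g, 'a) gmodule \<Rightarrow>
     ('g, 'a, 'a \<times> 'c, 'c) ext set monoid" where
  "Ext1 G T C A =
    \<lparr>carrier = ext_class G T C A ` {E :: ('g, 'a, 'a \<times> 'c, 'c) ext. is_extension G T C A E},
     monoid.mult = (\<lambda>x y. \<Union>E\<in>x. \<Union>E'\<in>y. ext_class G T C A (baer_sum A E E')),
     one = ext_class G T C A (split_extension C A)\<rparr>"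

section \<open>The elementary obstruction\<close>

text \<open>In this section \<open>k \<subseteq> kb \<subseteq> F\<close> and \<open>K \<subseteq> F\<close> are subfields of \<open>'o\<close>, with \<open>kb\<close> a separable
  closure of \<open>k\<close> and \<open>F\<close> the tensor product of \<open>K\<close> and \<open>kb\<close> over \<open>k\<close>.
  The automorphism \<open>1 \<otimes> \<sigma>\<close> of \<open>F\<close> is the only one that fixes \<open>K\<close> and induces \<open>\<sigma>\<close> on \<open>kb\<close>.\<close>

definition second_factor_action :: "'o::field set \<Rightarrow> 'o set \<Rightarrow> 'o set \<Rightarrow> ('o \<Rightarrow> 'o) \<Rightarrow> 'o \<Rightarrow> 'o" where
  "second_factor_action kb K F \<sigma> = (THE \<tau>. \<tau> \<in> carrier (Gal F K) \<and> (\<forall>x\<in>kb. \<tau> x = \<sigma> x))"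

definition constants_module :: "'o::field set \<Rightarrow> ('o \<Rightarrow> 'o, 'o) gmodule" where
  "constants_module kb = with_action (mult_of (fld kb)) (\<lambda>\<sigma> x. \<sigma> x)"

definition functions_module :: "'o::field set \<Rightarrow> 'o set \<Rightarrow> 'o set \<Rightarrow> ('o \<Rightarrow> 'o, 'o) gmodule" where
  "functions_module kb K F = with_action (mult_of (fld F)) (second_factor_action kb K F)"

definition quotient_module :: "'o::field set \<Rightarrow> 'o set \<Rightarrow> 'o set \<Rightarrow> ('o \<Rightarrow> 'o, 'o set) gmodule" where
  "quotient_module kb K F =
    with_action (mult_of (fld F) Mod (kb - {0})) (\<lambda>\<sigma> S. second_factor_action kb K F \<sigma> ` S)"

definition Ext1_units ::
    "'o::field set \<Rightarrow> 'o set \<Rightarrow> 'o set \<Rightarrow> 'o set \<Rightarrow>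
     ('o \<Rightarrow> 'o, 'o, 'o \<times> 'o set, 'o set) ext set monoid" where
  "Ext1_units k kb K F =
    Ext1 (Gal kb k) (krull kb k) (quotient_module kb K F) (constants_module kb)"

definition elementary_obstruction ::
    "'o::field set \<Rightarrow> 'o set \<Rightarrow> 'o set \<Rightarrow> 'o set \<Rightarrow>
     ('o \<Rightarrow> 'o, 'o, 'o \<times> 'o set, 'o set) ext set" where
  "elementary_obstruction k kb K F =
    ext_class (Gal kb k) (krull kb k) (quotient_module kb K F) (constants_module kb)
      ((\<lambda>x. x), functions_module kb K F, (\<lambda>x. (kb - {0}) #>\<^bsub>mult_of (fld F)\<^esub> x))"

end

theory Submission
  imports Defs
begin

text \<open>Write \<open>K\<close> for the function field of \<open>X\<close> and \<open>F = K \<otimes> kb\<close>, and regard all fields as subfields of the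
  ambient separable closure of \<open>F\<close>. A section of the restriction map from \<open>Gal(F\<^sup>a\<^sup>b/K)\<close> to
  \<open>Gal(kb/k)\<close> is obtained from a complement, that is, from a field \<open>M\<close> between \<open>K\<close> and the ambient
  field such that \<open>M \<inter> kb = k\<close> and \<open>F\<^sup>a\<^sup>b\<close> is contained in the compositum \<open>M kb\<close>. Indeed such an \<open>M\<close>
  is linearly disjoint from \<open>kb\<close> over \<open>k\<close>, hence every automorphism of \<open>kb/k\<close> extends in exactly one
  way to an automorphism of \<open>M kb\<close> over \<open>M\<close> (\<open>extend_constants\<close>); restricting it to \<open>F\<^sup>a\<^sup>b\<close> gives the
  section (\<open>splitting_of_complement\<close>). The complement is built in two steps.

  For the extensions of degree prime to the characteristic, one uses the hypothesis. If the
  elementary obstruction vanishes, then the inclusion of \<open>kb\<^sup>\<star>\<close> into \<open>F\<^sup>\<star>\<close> has a Galois equivariant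
  retraction \<open>r\<close> (\<open>retraction_of_vanishing_obstruction\<close>), and \<open>F\<^sup>\<star>\<close> is the product of \<open>kb\<^sup>\<star>\<close> and of the
  stable subgroup \<open>N = ker r\<close>. Let \<open>R\<close> be the group of all radicals of elements of \<open>F\<^sup>\<star>\<close> with exponents
  prime to the characteristic. As \<open>kb\<^sup>\<star>\<close> is divisible by such exponents, \<open>N\<close> extends to a complement
  \<open>D\<close> of \<open>kb\<^sup>\<star>\<close> in \<open>R\<close> (\<open>exists_complement\<close>). The roots of unity lie in \<open>kb\<close>, so \<open>D\<close> contains exactly one
  \<open>n\<close>-th root of each of its elements \<open>d\<^sup>n\<close>, and Kummer theory shows that every automorphism of \<open>F\<close>
  over \<open>K\<close> that is induced by one of \<open>kb/k\<close> has a lift which preserves \<open>D\<close>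
  (\<open>lift_preserving_complement\<close>). The field fixed by all automorphisms that preserve \<open>D\<close> is a
  complement whose compositum with \<open>kb\<close> contains \<open>R\<close> (\<open>kummer_complement\<close>).

  In characteristic \<open>p\<close> there is no further obstruction, for the reason that makes the
  \<open>p\<close>-cohomological dimension of \<open>k\<close> at most 1: additive separable polynomials are surjective on \<open>kb\<close>.
  By Zorn's lemma, enlarge the complement to a maximal \<open>M\<close> with \<open>M \<inter> kb = k\<close>. If \<open>M kb\<close> had a
  nontrivial Artin-Schreier extension, some additive separable polynomial over \<open>k\<close> would take a value
  in \<open>M\<close> at an element \<open>z\<close> outside \<open>M kb\<close> (\<open>artin_schreier_closed\<close>), and then \<open>M(z - b)\<close> would still meet
  \<open>kb\<close> in \<open>k\<close> for a suitable constant \<open>b\<close> (\<open>complement_step\<close>), against maximality.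

  Finally a field that contains \<open>F\<close> and all the radicals in \<open>R\<close> and has no Artin-Schreier extension
  contains \<open>F\<^sup>a\<^sup>b\<close> (\<open>abelian_part_subset\<close>).

  Throughout, Galois groups of intermediate extensions are replaced by the groups \<open>Aut A\<close> of
  automorphisms of the ambient field that fix a subfield \<open>A\<close>.\<close>

section \<open>Subfields and polynomials over them\<close>

definition subfld :: "'o::field set \<Rightarrow> bool" where
  "subfld A \<longleftrightarrow> 1 \<in> A \<and> (\<forall>x\<in>A. \<forall>y\<in>A. x - y \<in> A \<and> x * y \<in> A) \<and> (\<forall>x\<in>A. inverse x \<in> A)"

lemma subfldI:
  assumes "1 \<in> A" "\<And>x y. x \<in> A \<Longrightarrow> y \<in> A \<Longrightarrow> x - y \<in> A" "\<And>x y. x \<in> A \<Longrightarrow> y \<in> A \<Longrightarrow> x * y \<in> A"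
    "\<And>x. x \<in> A \<Longrightarrow> x \<noteq> 0 \<Longrightarrow> inverse x \<in> A"
  shows "subfld A"
  unfolding subfld_def using assms by (metis inverse_zero)

context
  fixes A :: "'o::field set"
  assumes A: "subfld A"
begin

lemma subfld_1: "1 \<in> A" and subfld_diff: "x \<in> A \<Longrightarrow> y \<in> A \<Longrightarrow> x - y \<in> A"
  and subfld_mult: "x \<in> A \<Longrightarrow> y \<in> A \<Longrightarrow> x * y \<in> A" and subfld_inverse: "x \<in> A \<Longrightarrow> inverse x \<in> A"
  using A by (auto simp: subfld_def)

lemma subfld_0: "0 \<in> A"
  using subfld_diff[OF subfld_1 subfld_1] by simp

lemma subfld_uminus: "x \<in> A \<Longrightarrow> - x \<in> A"
  using subfld_diff[OF subfld_0, of x] by simp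

lemma subfld_add: "x \<in> A \<Longrightarrow> y \<in> A \<Longrightarrow> x + y \<in> A"
  using subfld_diff[of x "- y"] subfld_uminus by simp

lemma subfld_divide: "x \<in> A \<Longrightarrow> y \<in> A \<Longrightarrow> x / y \<in> A"
  by (simp add: divide_inverse subfld_mult subfld_inverse)

lemma subfld_power: "x \<in> A \<Longrightarrow> x ^ n \<in> A"
  by (induction n) (auto intro: subfld_1 subfld_mult)

lemma subfld_sum: "(\<And>i. i \<in> I \<Longrightarrow> f i \<in> A) \<Longrightarrow> sum f I \<in> A"
  by (induction I rule: infinite_finite_induct) (auto intro: subfld_0 subfld_add)

lemma subfld_prod: "(\<And>i. i \<in> I \<Longrightarrow> f i \<in> A) \<Longrightarrow> prod f I \<in> A"
  by (induction I rule: infinite_finite_induct) (auto intro: subfld_1 subfld_mult)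

lemma subfld_of_nat: "of_nat n \<in> A"
  by (induction n) (auto intro: subfld_0 subfld_1 subfld_add)

lemmas subfld_closed = subfld_0 subfld_1 subfld_diff subfld_uminus subfld_add subfld_mult
  subfld_inverse subfld_divide subfld_power subfld_sum subfld_prod subfld_of_nat

end

lemma subfld_UNIV: "subfld UNIV"
  by (auto simp: subfld_def)

lemma subfld_iff_subfield: "subfld A \<longleftrightarrow> subfield A ring_of_type_algebra"
proof -
  interpret R: field "ring_of_type_algebra :: 'a ring"
    by (rule field_from_type_algebra)
  have [simp]: "\<ominus>\<^bsub>ring_of_type_algebra\<^esub> x = - x" for x :: 'a
    by (rule R.sum_zero_eq_neg[symmetric]) (auto simp: ring_of_type_algebra_def)
  have inv: "inv\<^bsub>ring_of_type_algebra\<^esub> x = inverse x" if "x \<noteq> 0" for x :: 'a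
    by (rule R.comm_inv_char) (use that in \<open>auto simp: ring_of_type_algebra_def\<close>)
  have c: "carrier (ring_of_type_algebra :: 'a ring) = UNIV" "\<one>\<^bsub>ring_of_type_algebra\<^esub> = (1 :: 'a)"
    "\<zero>\<^bsub>ring_of_type_algebra\<^esub> = (0 :: 'a)" "\<And>x y :: 'a. x \<otimes>\<^bsub>ring_of_type_algebra\<^esub> y = x * y"
    "\<And>x y :: 'a. x \<oplus>\<^bsub>ring_of_type_algebra\<^esub> y = x + y"
    by (auto simp: ring_of_type_algebra_def)
  show ?thesis
  proof
    assume A: "subfld A"
    show "subfield A ring_of_type_algebra"
    proof (rule R.subfieldI')
      show "subring A ring_of_type_algebra"
        by (rule R.subringI) (auto simp: c intro: subfld_closed[OF A])
      show "inv\<^bsub>ring_of_type_algebra\<^esub> x \<in> A" if "x \<in> A - {\<zero>\<^bsub>ring_of_type_algebra\<^esub>}" for x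
        using that inv[of x] by (auto simp: c intro: subfld_closed[OF A])
    qed
  next
    assume A: "subfield A ring_of_type_algebra"
    note S = subringE[OF subfieldE(1)[OF A]]
    show "subfld A"
    proof (rule subfldI)
      show "1 \<in> A" using S(3) by (simp add: c)
      show "x - y \<in> A" if "x \<in> A" "y \<in> A" for x y
        using S(7)[OF that(1) S(5)[OF that(2)]] by (simp add: c)
      show "x * y \<in> A" if "x \<in> A" "y \<in> A" for x y
        using S(6)[OF that] by (simp add: c)
      show "inverse x \<in> A" if "x \<in> A" "x \<noteq> 0" for x
        using R.subfield_m_inv(1)[OF A, of x] that inv[of x] by (simp add: c)
    qed
  qed
qed

definition poly_in :: "'o::field set \<Rightarrow> 'o poly \<Rightarrow> bool" where
  "poly_in A p \<longleftrightarrow> (\<forall>i. poly.coeff p i \<in> A)"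

lemma poly_in_iff_coeffs: "subfld A \<Longrightarrow> poly_in A p \<longleftrightarrow> set (coeffs p) \<subseteq> A"
proof -
  assume A: "subfld A"
  have "poly_in A p \<longleftrightarrow> range (poly.coeff p) \<subseteq> A" by (auto simp: poly_in_def)
  then show ?thesis using subfld_0[OF A] by (simp add: range_coeff)
qed

context
  fixes A :: "'o::field set"
  assumes A: "subfld A"
begin

lemma poly_in_0: "poly_in A 0" and poly_in_1: "poly_in A 1" and poly_in_const: "c \<in> A \<Longrightarrow> poly_in A [:c:]"
  using subfld_closed[OF A] by (auto simp: poly_in_def coeff_pCons split: nat.splits)

lemma poly_in_monom: "c \<in> A \<Longrightarrow> poly_in A (Polynomial.monom c n)"
  using subfld_closed[OF A] by (auto simp: poly_in_def)

lemma poly_in_pCons: "c \<in> A \<Longrightarrow> poly_in A p \<Longrightarrow> poly_in A (pCons c p)"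
  by (auto simp: poly_in_def coeff_pCons split: nat.splits)

lemma poly_in_add: "poly_in A p \<Longrightarrow> poly_in A q \<Longrightarrow> poly_in A (p + q)"
  and poly_in_diff: "poly_in A p \<Longrightarrow> poly_in A q \<Longrightarrow> poly_in A (p - q)"
  and poly_in_uminus: "poly_in A p \<Longrightarrow> poly_in A (- p)"
  and poly_in_smult: "c \<in> A \<Longrightarrow> poly_in A p \<Longrightarrow> poly_in A (Polynomial.smult c p)"
  using subfld_closed[OF A] by (auto simp: poly_in_def)

lemma poly_in_mult: "poly_in A p \<Longrightarrow> poly_in A q \<Longrightarrow> poly_in A (p * q)"
  by (auto simp: poly_in_def coeff_mult intro!: subfld_closed[OF A])

lemma poly_in_pderiv: "poly_in A p \<Longrightarrow> poly_in A (pderiv p)"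
  by (auto simp: poly_in_def coeff_pderiv intro!: subfld_closed[OF A] simp del: of_nat_Suc)

lemma poly_in_sum: "(\<And>i. i \<in> I \<Longrightarrow> poly_in A (f i)) \<Longrightarrow> poly_in A (sum f I)"
  by (induction I rule: infinite_finite_induct) (auto intro: poly_in_0 poly_in_add)

lemma poly_in_prod: "(\<And>i. i \<in> I \<Longrightarrow> poly_in A (f i)) \<Longrightarrow> poly_in A (prod f I)"
  by (induction I rule: infinite_finite_induct) (auto intro: poly_in_1 poly_in_mult)

lemma poly_in_poly: "poly_in A p \<Longrightarrow> x \<in> A \<Longrightarrow> poly p x \<in> A"
  by (auto simp: poly_altdef poly_in_def intro!: subfld_closed[OF A])

lemma poly_in_div_mod_ex:
  assumes "poly_in A p" "poly_in A q" "q \<noteq> 0"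
  shows "\<exists>s r. poly_in A s \<and> poly_in A r \<and> p = s * q + r \<and> (r = 0 \<or> degree r < degree q)"
  using assms(1)
proof (induction "degree p" arbitrary: p rule: less_induct)
  case less
  show ?case
  proof (cases "p = 0 \<or> degree p < degree q")
    case True
    then show ?thesis
      using less.prems poly_in_0 by (intro exI[of _ 0] exI[of _ p]) auto
  next
    case False
    define t where "t = Polynomial.monom (lead_coeff p / lead_coeff q) (degree p - degree q)"
    have t: "poly_in A t"
      unfolding t_def using less.prems assms(2)
      by (intro poly_in_monom subfld_divide[OF A]) (auto simp: poly_in_def)
    define p' where "p' = p - t * q"
    have p': "poly_in A p'"
      using less.prems t assms(2) by (auto simp: p'_def intro: poly_in_diff poly_in_mult)
    have deg: "degree (t * q) = degree p"
    proof -
      have nz: "lead_coeff p / lead_coeff q \<noteq> 0" using False assms(3) by auto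
      then have "t \<noteq> 0" by (simp add: t_def Polynomial.monom_eq_0_iff)
      then show ?thesis
        using False assms(3) degree_monom_eq[OF nz] by (simp add: t_def degree_mult_eq)
    qed
    have lc: "lead_coeff (t * q) = lead_coeff p"
      using assms(3) False by (cases "p = 0") (auto simp: t_def lead_coeff_mult lead_coeff_monom degree_monom_eq)
    show ?thesis
    proof (cases "p' = 0")
      case True
      then show ?thesis
        using t poly_in_0 by (intro exI[of _ t] exI[of _ 0]) (auto simp: p'_def)
    next
      case nz: False
      have "degree p' \<le> degree p"
        using deg degree_diff_le[of p "degree p" "t * q"] by (simp add: p'_def)
      moreover have "poly.coeff p' (degree p) = 0"
        using deg lc by (simp add: p'_def)
      ultimately have "degree p' < degree p"
        using nz by (metis leading_coeff_0_iff le_neq_implies_less)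
      from less.hyps[OF this p'] obtain s r where
        "poly_in A s" "poly_in A r" "p' = s * q + r" "r = 0 \<or> degree r < degree q" by blast
      then show ?thesis
        using t by (intro exI[of _ "s + t"] exI[of _ r]) (auto simp: p'_def algebra_simps intro: poly_in_add)
    qed
  qed
qed

text \<open>Quotient and remainder are unique over the ambient field, so a division carried out with
  coefficients in \<open>A\<close> computes them.\<close>

lemma poly_in_div_mod:
  assumes "poly_in A p" "poly_in A q"
  shows "poly_in A (p div q) \<and> poly_in A (p mod q)"
proof (cases "q = 0")
  case False
  from poly_in_div_mod_ex[OF assms False] obtain s r where
    "poly_in A s" "poly_in A r" "p = s * q + r" "r = 0 \<or> degree r < degree q" by blast
  then have "p div q = s" "p mod q = r"
    using False by (auto simp: div_poly_less mod_poly_less)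
  then show ?thesis
    using \<open>poly_in A s\<close> \<open>poly_in A r\<close> by simp
qed (use assms poly_in_0 in auto)

lemma poly_in_cofactor:
  assumes "poly_in A p" "poly_in A q" "q dvd p"
  obtains s where "poly_in A s" "p = q * s"
  using poly_in_div_mod[OF assms(1,2)] assms(3) dvd_mult_div_cancel[of q p] by (intro that[of "p div q"]) auto

text \<open>Coprimality refers to divisors with arbitrary coefficients in the ambient field. A
  homomorphism that is only defined on \<open>A\<close> cannot see those; it can transport a Bezout identity over
  \<open>A\<close>, and the Euclidean algorithm provides one.\<close>

lemma poly_in_bezout:
  assumes "poly_in A p" "poly_in A q"
  shows "\<exists>u v. poly_in A u \<and> poly_in A v \<and> u * p + v * q dvd p \<and> u * p + v * q dvd q"
  using assms
proof (induction "if q = 0 then 0 else Suc (degree q)" arbitrary: p q rule: less_induct)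
  case less
  show ?case
  proof (cases "q = 0")
    case True
    then show ?thesis
      by (intro exI[of _ 1] exI[of _ 0]) (auto intro: poly_in_0 poly_in_1)
  next
    case False
    define r where "r = p mod q"
    have r: "poly_in A r" "poly_in A (p div q)"
      using poly_in_div_mod[OF less.prems] by (auto simp: r_def)
    have "(if r = 0 then 0 else Suc (degree r)) < (if q = 0 then 0 else Suc (degree q))"
      using False degree_mod_less[OF False, of p] by (auto simp: r_def)
    from less.hyps[OF this less.prems(2) r(1)] obtain u v where
      uv: "poly_in A u" "poly_in A v" "u * q + v * r dvd q" "u * q + v * r dvd r" by blast
    have p: "p = (p div q) * q + r"
      by (simp add: r_def)
    have "u * q + v * r dvd p"
      by (subst p) (use uv in auto)
    moreover have "u * q + v * r = v * p + (u - v * (p div q)) * q"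
      using arg_cong[OF p, of "\<lambda>t. v * t"] by (simp add: algebra_simps)
    ultimately show ?thesis
      using uv r by (intro exI[of _ v] exI[of _ "u - v * (p div q)"]) (auto intro: poly_in_diff poly_in_mult)
  qed
qed

lemma poly_in_coprime_bezout:
  assumes "poly_in A p" "poly_in A q" "coprime p q"
  obtains u v where "poly_in A u" "poly_in A v" "u * p + v * q = 1"
proof -
  from poly_in_bezout[OF assms(1,2)] obtain u v where
    uv: "poly_in A u" "poly_in A v" "u * p + v * q dvd p" "u * p + v * q dvd q" by blast
  then have "is_unit (u * p + v * q)"
    using assms(3) by (meson coprime_common_divisor)
  then obtain c where c: "u * p + v * q = [:c:]" "c \<noteq> 0"
    by (auto simp: is_unit_poly_iff dvd_field_iff)
  have "poly_in A (u * p + v * q)"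
    using uv assms by (intro poly_in_add poly_in_mult)
  then have "c \<in> A"
    using c(1) by (auto simp: poly_in_def elim!: allE[of _ 0])
  have "Polynomial.smult (inverse c) (u * p + v * q) = 1"
    using c by (simp add: one_pCons)
  then show thesis
    using uv \<open>c \<in> A\<close>
    by (intro that[of "Polynomial.smult (inverse c) u" "Polynomial.smult (inverse c) v"])
       (auto simp: smult_add_right intro!: poly_in_smult subfld_inverse[OF A])
qed

end

lemma poly_in_mono: "poly_in A p \<Longrightarrow> A \<subseteq> B \<Longrightarrow> poly_in B p"
  by (auto simp: poly_in_def)

section \<open>Homomorphisms from subfields\<close>

definition hom_on :: "'o::field set \<Rightarrow> ('o \<Rightarrow> 'o) \<Rightarrow> bool" where
  "hom_on A \<phi> \<longleftrightarrow> \<phi> 1 = 1 \<and> (\<forall>x\<in>A. \<forall>y\<in>A. \<phi> (x + y) = \<phi> x + \<phi> y \<and> \<phi> (x * y) = \<phi> x * \<phi> y)"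

context
  fixes A :: "'o::field set" and \<phi>
  assumes A: "subfld A" and h: "hom_on A \<phi>"
begin

lemma hom_on_1: "\<phi> 1 = 1" and hom_on_add: "x \<in> A \<Longrightarrow> y \<in> A \<Longrightarrow> \<phi> (x + y) = \<phi> x + \<phi> y"
  and hom_on_mult: "x \<in> A \<Longrightarrow> y \<in> A \<Longrightarrow> \<phi> (x * y) = \<phi> x * \<phi> y"
  using h by (auto simp: hom_on_def)

lemma hom_on_0: "\<phi> 0 = 0"
  using hom_on_add[OF subfld_0[OF A] subfld_0[OF A]] by (metis add.right_neutral add_left_cancel)

lemma hom_on_uminus: "x \<in> A \<Longrightarrow> \<phi> (- x) = - \<phi> x"
  using hom_on_add[of x "- x"] subfld_uminus[OF A] hom_on_0 by (simp add: add_eq_0_iff2)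

lemma hom_on_diff: "x \<in> A \<Longrightarrow> y \<in> A \<Longrightarrow> \<phi> (x - y) = \<phi> x - \<phi> y"
  using hom_on_add[of x "- y"] subfld_uminus[OF A] hom_on_uminus by simp

lemma hom_on_inj: "x \<in> A \<Longrightarrow> \<phi> x = 0 \<Longrightarrow> x = 0"
  using hom_on_mult[of x "inverse x"] subfld_inverse[OF A, of x] hom_on_1
  by (cases "x = 0") auto

lemma hom_on_inverse: "x \<in> A \<Longrightarrow> \<phi> (inverse x) = inverse (\<phi> x)"
  using hom_on_mult[of x "inverse x"] subfld_inverse[OF A, of x] hom_on_1 hom_on_0
  by (cases "x = 0") (auto simp: inverse_unique)

lemma hom_on_sum: "(\<And>i. i \<in> I \<Longrightarrow> f i \<in> A) \<Longrightarrow> \<phi> (sum f I) = (\<Sum>i\<in>I. \<phi> (f i))"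
  by (induction I rule: infinite_finite_induct)
     (auto simp: hom_on_0 hom_on_add subfld_sum[OF A])

lemma hom_on_power: "x \<in> A \<Longrightarrow> \<phi> (x ^ n) = \<phi> x ^ n"
  by (induction n) (auto simp: hom_on_1 hom_on_mult subfld_power[OF A])

lemma hom_on_of_nat: "\<phi> (of_nat n) = of_nat n"
  by (induction n) (auto simp: hom_on_1 hom_on_0 hom_on_add subfld_of_nat[OF A] subfld_1[OF A])

lemma hom_on_image: "subfld (\<phi> ` A)"
proof (rule subfldI)
  show "1 \<in> \<phi> ` A" using hom_on_1 subfld_1[OF A] by force
  fix x y assume "x \<in> \<phi> ` A" "y \<in> \<phi> ` A"
  then obtain a b where ab: "a \<in> A" "b \<in> A" "x = \<phi> a" "y = \<phi> b" by auto
  show "x - y \<in> \<phi> ` A" "x * y \<in> \<phi> ` A"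
    using ab hom_on_diff[of a b] hom_on_mult[of a b] subfld_diff[OF A, of a b] subfld_mult[OF A, of a b]
    by force+
next
  fix x assume "x \<in> \<phi> ` A"
  then show "inverse x \<in> \<phi> ` A"
    using hom_on_inverse subfld_inverse[OF A] by force
qed

lemma coeff_map: "poly.coeff (map_poly \<phi> p) i = \<phi> (poly.coeff p i)"
  by (simp add: coeff_map_poly hom_on_0)

lemma map_add: "poly_in A p \<Longrightarrow> poly_in A q \<Longrightarrow> map_poly \<phi> (p + q) = map_poly \<phi> p + map_poly \<phi> q"
  by (rule poly_eqI) (auto simp: coeff_map poly_in_def hom_on_add)

lemma map_diff: "poly_in A p \<Longrightarrow> poly_in A q \<Longrightarrow> map_poly \<phi> (p - q) = map_poly \<phi> p - map_poly \<phi> q"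
  by (rule poly_eqI) (auto simp: coeff_map poly_in_def hom_on_diff)

lemma map_mult: "poly_in A p \<Longrightarrow> poly_in A q \<Longrightarrow> map_poly \<phi> (p * q) = map_poly \<phi> p * map_poly \<phi> q"
  by (rule poly_eqI)
     (auto simp: coeff_map poly_in_def coeff_mult hom_on_mult hom_on_sum subfld_mult[OF A])

lemma map_pderiv: "poly_in A p \<Longrightarrow> map_poly \<phi> (pderiv p) = pderiv (map_poly \<phi> p)"
  by (rule poly_eqI)
     (auto simp: coeff_map poly_in_def coeff_pderiv hom_on_mult hom_on_of_nat subfld_of_nat[OF A]
       simp del: of_nat_Suc)

lemma map_1: "map_poly \<phi> 1 = 1"
  using hom_on_1 by simp

lemma map_degree: "poly_in A p \<Longrightarrow> degree (map_poly \<phi> p) = degree p"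
  by (cases "p = 0") (auto intro!: map_poly_degree_eq simp: poly_in_def dest: hom_on_inj[rotated])

lemma map_poly_eval: "poly_in A p \<Longrightarrow> x \<in> A \<Longrightarrow> poly (map_poly \<phi> p) (\<phi> x) = \<phi> (poly p x)"
  by (auto simp: poly_altdef map_degree poly_in_def coeff_map hom_on_sum hom_on_mult hom_on_power
      subfld_mult[OF A] subfld_power[OF A])

lemma map_coprime:
  assumes "poly_in A p" "poly_in A q" "coprime p q"
  shows "coprime (map_poly \<phi> p) (map_poly \<phi> q)"
proof -
  obtain u v where uv: "poly_in A u" "poly_in A v" "u * p + v * q = 1"
    using poly_in_coprime_bezout[OF A assms] .
  have "map_poly \<phi> u * map_poly \<phi> p + map_poly \<phi> v * map_poly \<phi> q = 1"
    using arg_cong[OF uv(3), of "map_poly \<phi>"] map_1 uv(1,2) assms(1,2)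
    by (simp add: map_add map_mult poly_in_mult[OF A])
  then show ?thesis
    by (intro coprimeI) (metis dvd_add dvd_mult)
qed

lemma map_separable:
  assumes "poly_in A p" "coprime p (pderiv p)"
  shows "coprime (map_poly \<phi> p) (pderiv (map_poly \<phi> p))"
  using map_coprime[OF assms(1) poly_in_pderiv[OF A assms(1)] assms(2)] map_pderiv[OF assms(1)] by simp

end

lemma map_prod_linear:
  assumes A: "subfld A" and h: "hom_on A \<phi>" and "finite S" "S \<subseteq> A"
  shows "map_poly \<phi> (\<Prod>a\<in>S. [:- a, 1:]) = (\<Prod>a\<in>S. [:- \<phi> a, 1:])"
  using assms(3,4)
proof (induction S rule: finite_induct)
  case empty
  then show ?case using map_1[OF A h] by simp
next
  case (insert a S)
  have lin: "poly_in A [:- b, 1:]" if "b \<in> A" for b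
    using that by (intro poly_in_pCons[OF A] poly_in_0[OF A] subfld_uminus[OF A] subfld_1[OF A])
  have "poly_in A (\<Prod>a\<in>S. [:- a, 1:])" using insert.prems lin by (intro poly_in_prod[OF A]) auto
  moreover have "map_poly \<phi> [:- a, 1:] = [:- \<phi> a, 1:]"
    using insert.prems by (simp add: map_poly_pCons hom_on_0[OF A h] hom_on_1[OF A h] hom_on_uminus[OF A h])
  ultimately show ?case
    using insert lin map_mult[OF A h lin, of a "\<Prod>a\<in>S. [:- a, 1:]"] by simp
qed

section \<open>Minimal polynomials and simple extensions\<close>

definition algebraic_over :: "'o::field set \<Rightarrow> 'o \<Rightarrow> bool" where
  "algebraic_over A x \<longleftrightarrow> (\<exists>p. p \<noteq> 0 \<and> poly_in A p \<and> poly p x = 0)"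

definition sep_over :: "'o::field set \<Rightarrow> 'o \<Rightarrow> bool" where
  "sep_over A x \<longleftrightarrow> (\<exists>p. poly_in A p \<and> coprime p (pderiv p) \<and> poly p x = 0)"

lemma separable_nz: "coprime p (pderiv p) \<Longrightarrow> p \<noteq> (0 :: 'o::field poly)"
  by auto

lemma sep_imp_algebraic: "sep_over A x \<Longrightarrow> algebraic_over A x"
  unfolding sep_over_def algebraic_over_def using separable_nz by blast

lemma sep_over_mono: "sep_over A x \<Longrightarrow> A \<subseteq> B \<Longrightarrow> sep_over B x"
  unfolding sep_over_def using poly_in_mono by blast

definition min_poly_of :: "'o::field set \<Rightarrow> 'o \<Rightarrow> 'o poly \<Rightarrow> bool" where
  "min_poly_of A x \<mu> \<longleftrightarrow> poly_in A \<mu> \<and> lead_coeff \<mu> = 1 \<and> poly \<mu> x = 0 \<and>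
     (\<forall>p. poly_in A p \<and> poly p x = 0 \<longrightarrow> \<mu> dvd p)"

lemma min_poly_ex:
  assumes A: "subfld A" and "algebraic_over A x"
  obtains \<mu> where "min_poly_of A x \<mu>"
proof -
  define Q where "Q p \<longleftrightarrow> p \<noteq> 0 \<and> poly_in A p \<and> poly p x = 0" for p
  obtain p0 where "Q p0" using assms(2) by (auto simp: algebraic_over_def Q_def)
  then obtain m where m: "Q m" "\<And>p. Q p \<Longrightarrow> degree m \<le> degree p"
    by (metis ex_has_least_nat)
  define \<mu> where "\<mu> = Polynomial.smult (inverse (lead_coeff m)) m"
  have nz: "lead_coeff m \<noteq> 0" using m(1) by (auto simp: Q_def)
  have "poly_in A \<mu>" "lead_coeff \<mu> = 1" "poly \<mu> x = 0" "degree \<mu> = degree m"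
    using m(1) nz by (auto simp: \<mu>_def Q_def poly_in_def intro: subfld_closed[OF A])
  moreover have "\<mu> dvd p" if "poly_in A p" "poly p x = 0" for p
  proof -
    have "poly (p mod \<mu>) x = 0"
      using that \<open>poly \<mu> x = 0\<close> by (metis poly_mod)
    moreover have "poly_in A (p mod \<mu>)"
      using poly_in_div_mod[OF A that(1) \<open>poly_in A \<mu>\<close>] by blast
    moreover have "\<mu> \<noteq> 0" using \<open>lead_coeff \<mu> = 1\<close> by auto
    then have "p mod \<mu> = 0 \<or> degree (p mod \<mu>) < degree m"
      using degree_mod_less[of \<mu> p] \<open>degree \<mu> = degree m\<close> by auto
    ultimately have "p mod \<mu> = 0"
      using m(2)[of "p mod \<mu>"] unfolding Q_def by (meson not_le)
    then show ?thesis by (simp add: dvd_eq_mod_eq_0)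
  qed
  ultimately have "min_poly_of A x \<mu>" unfolding min_poly_of_def by blast
  then show thesis by (rule that)
qed

lemma separable_dvd:
  fixes p q :: "'o::field poly"
  assumes "coprime p (pderiv p)" "q dvd p"
  shows "coprime q (pderiv q)"
proof -
  obtain s where s: "p = q * s" using assms(2) by auto
  show ?thesis
  proof (rule coprimeI)
    fix d assume "d dvd q" "d dvd pderiv q"
    then have "d dvd p" "d dvd pderiv p" by (auto simp: s pderiv_mult)
    then show "is_unit d" using assms(1) by (meson coprime_common_divisor)
  qed
qed

lemma min_poly_separable:
  "min_poly_of A x \<mu> \<Longrightarrow> sep_over A x \<Longrightarrow> coprime \<mu> (pderiv \<mu>)"
  unfolding min_poly_of_def sep_over_def using separable_dvd by blast

lemma min_poly_degree:
  assumes "subfld A" "min_poly_of A x \<mu>"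
  shows "degree \<mu> > 0" "x \<notin> A \<Longrightarrow> degree \<mu> > 1"
proof -
  have m: "poly_in A \<mu>" "lead_coeff \<mu> = 1" "poly \<mu> x = 0"
    using assms(2) by (auto simp: min_poly_of_def)
  show d: "degree \<mu> > 0"
  proof (rule ccontr)
    assume "\<not> degree \<mu> > 0"
    then obtain c where "\<mu> = [:c:]" by (auto elim: degree_eq_zeroE)
    then show False using m by auto
  qed
  assume x: "x \<notin> A"
  show "degree \<mu> > 1"
  proof (rule ccontr)
    assume "\<not> degree \<mu> > 1"
    then have deg: "degree \<mu> = 1" using d by auto
    then have "poly \<mu> x = poly.coeff \<mu> 0 + x"
      using m(2) by (simp add: poly_altdef)
    then have "x = - poly.coeff \<mu> 0" using m(3) by (simp add: add_eq_0_iff)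
    then show False using x m(1) subfld_uminus[OF assms(1)] by (auto simp: poly_in_def)
  qed
qed

definition adjoin :: "'o::field set \<Rightarrow> 'o \<Rightarrow> 'o set" where
  "adjoin A x = {poly p x |p. poly_in A p}"

lemma adjoin_subset: "subfld A \<Longrightarrow> A \<subseteq> adjoin A x"
proof
  fix a assume "subfld A" "a \<in> A"
  then show "a \<in> adjoin A x"
    unfolding adjoin_def using poly_in_const[of A a] by (intro CollectI exI[of _ "[:a:]"]) simp
qed

lemma adjoin_gen: "subfld A \<Longrightarrow> x \<in> adjoin A x"
  unfolding adjoin_def using poly_in_pCons[of A 0 "[:1:]"] poly_in_const[of A 1] subfld_0[of A] subfld_1[of A]
  by (intro CollectI exI[of _ "[:0, 1:]"]) simp

text \<open>A common divisor over \<open>A\<close> of \<open>p\<close> and of the minimal polynomial \<open>\<mu>\<close> of \<open>x\<close> that does not vanish at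
  \<open>x\<close> is constant, because the complementary factor of \<open>\<mu>\<close> is divisible by \<open>\<mu>\<close>. The Bezout identity
  then inverts \<open>p(x)\<close>.\<close>

lemma adjoin_subfld:
  assumes A: "subfld A" and "algebraic_over A x"
  shows "subfld (adjoin A x)"
proof -
  obtain \<mu> where m: "min_poly_of A x \<mu>" using min_poly_ex[OF assms] .
  then have ov: "poly_in A \<mu>" and root: "poly \<mu> x = 0" and "\<mu> \<noteq> 0"
    by (auto simp: min_poly_of_def)
  show ?thesis
  proof (rule subfldI)
    show "1 \<in> adjoin A x" using adjoin_subset[OF A] subfld_1[OF A] by blast
    fix a b assume "a \<in> adjoin A x" "b \<in> adjoin A x"
    then obtain p q where "poly_in A p" "poly_in A q" "a = poly p x" "b = poly q x"
      by (auto simp: adjoin_def)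
    then show "a - b \<in> adjoin A x" "a * b \<in> adjoin A x"
      unfolding adjoin_def using poly_in_diff[OF A, of p q] poly_in_mult[OF A, of p q]
      by (metis (mono_tags, lifting) mem_Collect_eq poly_diff poly_mult)+
  next
    fix a assume "a \<in> adjoin A x" "a \<noteq> 0"
    then obtain p where p: "poly_in A p" "a = poly p x" "poly p x \<noteq> 0" by (auto simp: adjoin_def)
    from poly_in_bezout[OF A p(1) ov] obtain u v where
      uv: "poly_in A u" "poly_in A v" "u * p + v * \<mu> dvd p" "u * p + v * \<mu> dvd \<mu>" by blast
    define d where "d = u * p + v * \<mu>"
    have d: "poly_in A d" unfolding d_def using uv p ov by (intro poly_in_add poly_in_mult A)
    have "d dvd \<mu>" using uv(4) by (simp add: d_def)
    then obtain e where e: "poly_in A e" "\<mu> = d * e" using poly_in_cofactor[OF A ov d] by metis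
    have "poly d x \<noteq> 0"
      using uv(3) p(3) by (metis d_def dvdE mult_zero_left poly_mult)
    then have "poly e x = 0" using root e(2) by simp
    then have "\<mu> dvd e" using m e(1) by (auto simp: min_poly_of_def)
    then have "degree \<mu> \<le> degree e" using \<open>\<mu> \<noteq> 0\<close> e(2) by (intro dvd_imp_degree_le) auto
    then have "degree d = 0" using e(2) \<open>\<mu> \<noteq> 0\<close> by (auto simp: degree_mult_eq)
    then obtain c where c: "d = [:c:]" by (auto elim: degree_eq_zeroE)
    then have "c \<in> A" "c \<noteq> 0" using d \<open>poly d x \<noteq> 0\<close> by (auto simp: poly_in_def elim!: allE[of _ 0])
    have "poly u x * a = c"
      using c root by (auto simp: d_def p(2) dest!: arg_cong[of _ _ "\<lambda>p. poly p x"])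
    then have "inverse a = poly (Polynomial.smult (inverse c) u) x"
      using \<open>a \<noteq> 0\<close> \<open>c \<noteq> 0\<close> by (simp add: field_simps)
    then show "inverse a \<in> adjoin A x"
      using poly_in_smult[OF A subfld_inverse[OF A \<open>c \<in> A\<close>] uv(1)] unfolding adjoin_def by blast
  qed
qed

lemma adjoin_hom:
  assumes A: "subfld A" and h: "hom_on A \<phi>" and m: "min_poly_of A x \<mu>"
    and x': "poly (map_poly \<phi> \<mu>) x' = 0"
  obtains \<psi> where "hom_on (adjoin A x) \<psi>" "\<And>a. a \<in> A \<Longrightarrow> \<psi> a = \<phi> a" "\<psi> x = x'"
proof -
  have ov: "poly_in A \<mu>" and dv: "\<And>p. poly_in A p \<Longrightarrow> poly p x = 0 \<Longrightarrow> \<mu> dvd p"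
    using m by (auto simp: min_poly_of_def)
  have wd0: "poly (map_poly \<phi> p) x' = 0" if p: "poly_in A p" "poly p x = 0" for p
  proof -
    obtain s where s: "poly_in A s" "p = \<mu> * s" using poly_in_cofactor[OF A p(1) ov dv[OF p]] by blast
    then show "poly (map_poly \<phi> p) x' = 0" using x' by (simp add: map_mult[OF A h ov])
  qed
  have wd: "poly (map_poly \<phi> p) x' = poly (map_poly \<phi> q) x'"
    if "poly_in A p" "poly_in A q" "poly p x = poly q x" for p q
    using wd0[of "p - q"] that by (simp add: poly_in_diff[OF A] map_diff[OF A h])
  define \<psi> where "\<psi> y = poly (map_poly \<phi> (SOME p. poly_in A p \<and> poly p x = y)) x'" for y
  have \<psi>: "\<psi> (poly p x) = poly (map_poly \<phi> p) x'" if "poly_in A p" for p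
  proof -
    have "poly_in A (SOME q. poly_in A q \<and> poly q x = poly p x) \<and> poly (SOME q. poly_in A q \<and> poly q x = poly p x) x = poly p x"
      by (rule someI[of _ p]) (use that in auto)
    then show ?thesis unfolding \<psi>_def using wd that by blast
  qed
  have c: "\<psi> a = \<phi> a" if "a \<in> A" for a
    using \<psi>[OF poly_in_const[OF A that]] by (simp add: map_poly_pCons hom_on_0[OF A h])
  show thesis
  proof
    show "hom_on (adjoin A x) \<psi>"
      unfolding hom_on_def
    proof (intro conjI ballI)
      show "\<psi> 1 = 1" using c[OF subfld_1[OF A]] hom_on_1[OF A h] by simp
      fix a b assume "a \<in> adjoin A x" "b \<in> adjoin A x"
      then obtain p q where pq: "poly_in A p" "poly_in A q" "a = poly p x" "b = poly q x"
        by (auto simp: adjoin_def)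
      show "\<psi> (a + b) = \<psi> a + \<psi> b"
        using \<psi>[OF poly_in_add[OF A pq(1,2)]] pq by (simp add: \<psi> map_add[OF A h])
      show "\<psi> (a * b) = \<psi> a * \<psi> b"
        using \<psi>[OF poly_in_mult[OF A pq(1,2)]] pq by (simp add: \<psi> map_mult[OF A h])
    qed
    show "\<psi> x = x'"
      using \<psi>[OF poly_in_pCons[OF A subfld_0[OF A] poly_in_const[OF A subfld_1[OF A]]]]
      by (simp add: map_poly_pCons hom_on_0[OF A h] hom_on_1[OF A h])
  qed (use c in auto)
qed

section \<open>Linear spans and transfer of linear relations\<close>

definition lspan :: "'o::field set \<Rightarrow> 'o set \<Rightarrow> 'o set" where
  "lspan A W = {(\<Sum>x\<in>I. f x * x) |I f. finite I \<and> I \<subseteq> W \<and> (\<forall>x\<in>I. f x \<in> A)}"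

lemma lspan_0: "0 \<in> lspan A W"
  unfolding lspan_def by (auto intro!: exI[of _ "{}"])

lemma lspan_term: "a \<in> A \<Longrightarrow> x \<in> W \<Longrightarrow> a * x \<in> lspan A W"
  unfolding lspan_def by (rule CollectI) (rule exI[of _ "{x}"], auto)

lemma lspan_add:
  assumes A: "subfld A" and "u \<in> lspan A W" "v \<in> lspan A W"
  shows "u + v \<in> lspan A W"
proof -
  obtain I f where f: "finite I" "I \<subseteq> W" "\<forall>x\<in>I. f x \<in> A" "u = (\<Sum>x\<in>I. f x * x)"
    using assms(2) by (auto simp: lspan_def)
  obtain J g where g: "finite J" "J \<subseteq> W" "\<forall>x\<in>J. g x \<in> A" "v = (\<Sum>x\<in>J. g x * x)"
    using assms(3) by (auto simp: lspan_def)
  define f' where "f' x = (if x \<in> I then f x else 0)" for x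
  define g' where "g' x = (if x \<in> J then g x else 0)" for x
  have "u = (\<Sum>x\<in>I \<union> J. f' x * x)"
    unfolding f(4) by (rule sum.mono_neutral_cong_left) (use f g in \<open>auto simp: f'_def\<close>)
  moreover have "v = (\<Sum>x\<in>I \<union> J. g' x * x)"
    unfolding g(4) by (rule sum.mono_neutral_cong_left) (use f g in \<open>auto simp: g'_def\<close>)
  ultimately have "u + v = (\<Sum>x\<in>I \<union> J. (f' x + g' x) * x)"
    by (simp add: sum.distrib algebra_simps)
  moreover have "\<forall>x\<in>I \<union> J. f' x + g' x \<in> A"
    using f(3) g(3) by (auto simp: f'_def g'_def intro: subfld_closed[OF A])
  ultimately show ?thesis
    unfolding lspan_def using f(1,2) g(1,2)
    by (intro CollectI exI[of _ "I \<union> J"] exI[of _ "\<lambda>x. f' x + g' x"]) auto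
qed

lemma lspan_induct [consumes 1, case_names zero add]:
  assumes "u \<in> lspan A W" "P 0"
    and "\<And>a x u. a \<in> A \<Longrightarrow> x \<in> W \<Longrightarrow> u \<in> lspan A W \<Longrightarrow> P u \<Longrightarrow> P (a * x + u)"
  shows "P u"
proof -
  obtain I f where f: "finite I" "I \<subseteq> W" "\<forall>x\<in>I. f x \<in> A" "u = (\<Sum>x\<in>I. f x * x)"
    using assms(1) by (auto simp: lspan_def)
  have "P (\<Sum>x\<in>I. f x * x) \<and> (\<Sum>x\<in>I. f x * x) \<in> lspan A W"
    using f(1-3)
  proof (induction I rule: finite_induct)
    case empty
    then show ?case using assms(2) lspan_0 by simp
  next
    case (insert y I)
    then have "(\<Sum>x\<in>insert y I. f x * x) \<in> lspan A W"
      unfolding lspan_def by (intro CollectI exI[of _ "insert y I"] exI[of _ f]) auto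
    then show ?case using insert assms(3)[of "f y" y] by auto
  qed
  then show ?thesis using f(4) by simp
qed

lemma lspan_mult:
  assumes A: "subfld A" and W: "\<And>x y. x \<in> W \<Longrightarrow> y \<in> W \<Longrightarrow> x * y \<in> W"
    and "u \<in> lspan A W" "v \<in> lspan A W"
  shows "u * v \<in> lspan A W"
  using assms(3)
proof (induction rule: lspan_induct)
  case zero
  then show ?case by (simp add: lspan_0)
next
  case (add a x u)
  have "(a * x) * v \<in> lspan A W"
    using assms(4)
  proof (induction rule: lspan_induct)
    case zero
    then show ?case by (simp add: lspan_0)
  next
    case (add b y v)
    have "a * x * (b * y + v) = (a * b) * (x * y) + a * x * v" by (simp add: algebra_simps)
    then show ?case
      using add \<open>a \<in> A\<close> \<open>x \<in> W\<close> by (auto intro!: lspan_add[OF A] lspan_term W subfld_mult[OF A])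
  qed
  then show ?case using add by (simp add: distrib_right lspan_add[OF A])
qed

lemma lspan_uminus:
  assumes A: "subfld A" and "u \<in> lspan A W"
  shows "- u \<in> lspan A W"
  using assms(2)
proof (induction rule: lspan_induct)
  case zero
  then show ?case by (simp add: lspan_0)
next
  case (add a x u)
  have "- (a * x + u) = (- a) * x + (- u)" by simp
  then show ?case using add by (metis A lspan_add lspan_term subfld_uminus)
qed

lemma lspan_least:
  assumes "subfld B" "A \<subseteq> B" "W \<subseteq> B"
  shows "lspan A W \<subseteq> B"
  unfolding lspan_def using assms(2,3) by (auto intro!: subfld_closed[OF assms(1)])

text \<open>A ring \<open>R\<close> that contains \<open>B\<close> and a nonzero algebraic element \<open>x\<close> also contains the field \<open>B(x)\<close>.\<close>

lemma alg_subring_subfld: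
  assumes B: "subfld B" "B \<subseteq> R" and alg: "\<And>x. x \<in> R \<Longrightarrow> algebraic_over B x"
    and R: "\<And>x y. x \<in> R \<Longrightarrow> y \<in> R \<Longrightarrow> x - y \<in> R" "\<And>x y. x \<in> R \<Longrightarrow> y \<in> R \<Longrightarrow> x * y \<in> R"
  shows "subfld R"
proof (rule subfldI)
  show one: "1 \<in> R" using subfld_1[OF B(1)] B(2) by blast
  fix x assume x: "x \<in> R" "x \<noteq> 0"
  have zero: "0 \<in> R" using R(1)[OF one one] by simp
  have plus: "a + b \<in> R" if "a \<in> R" "b \<in> R" for a b
    using R(1)[OF that(1) R(1)[OF zero that(2)]] by simp
  have pow: "x ^ n \<in> R" for n by (induction n) (use x one R(2) in auto)
  have "adjoin B x \<subseteq> R"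
  proof
    fix y assume "y \<in> adjoin B x"
    then obtain p where p: "poly_in B p" "y = poly p x" by (auto simp: adjoin_def)
    have "sum (\<lambda>i. poly.coeff p i * x ^ i) I \<in> R" for I
    proof -
      have "poly.coeff p i \<in> R" for i using p(1) B(2) by (auto simp: poly_in_def)
      then show ?thesis
        by (induction I rule: infinite_finite_induct) (auto intro: plus R(2) pow zero)
    qed
    then show "y \<in> R" by (simp add: p(2) poly_altdef)
  qed
  then show "inverse x \<in> R"
    using adjoin_subfld[OF B(1) alg[OF x(1)]] adjoin_gen[OF B(1), of x] subfld_inverse by blast
qed (use R in auto)

text \<open>The principle behind Artin's lemma on the independence of characters, in a form that serves
  twice below. A relation \<open>\<Sum> f(x) x = 0\<close> over \<open>A\<close> is to imply \<open>\<Sum> \<tau>(f(x)) y(x) = 0\<close>. If a relation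
  with full support admits a second, nonzero one \<open>c\<close> that misses some index, then a multiple of \<open>c\<close> can
  be subtracted from it so as to lose another index; both are shorter, and the claim is additive.\<close>

lemma relation_transfer:
  fixes y :: "'o::field \<Rightarrow> 'o"
  assumes A: "subfld A" and h: "hom_on A \<tau>"
    and step: "\<And>I f. finite I \<Longrightarrow> I \<subseteq> W \<Longrightarrow> I \<noteq> {} \<Longrightarrow> \<forall>x\<in>I. f x \<in> A \<and> f x \<noteq> 0 \<Longrightarrow>
      (\<Sum>x\<in>I. f x * x) = 0 \<Longrightarrow> (\<Sum>x\<in>I. \<tau> (f x) * y x) = 0 \<or>
        (\<exists>c. (\<forall>x\<in>I. c x \<in> A) \<and> (\<Sum>x\<in>I. c x * x) = 0 \<and> (\<exists>i\<in>I. c i = 0) \<and> (\<exists>j\<in>I. c j \<noteq> 0))"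
    and "finite I" "I \<subseteq> W" "\<forall>x\<in>I. f x \<in> A" "(\<Sum>x\<in>I. f x * x) = 0"
  shows "(\<Sum>x\<in>I. \<tau> (f x) * y x) = 0"
  using assms(4-)
proof (induction "card I" arbitrary: I f rule: less_induct)
  case less
  note \<tau>0 = hom_on_0[OF A h]
  \<comment> \<open>The induction hypothesis, for relations with a vanishing coefficient.\<close>
  have shorter: "(\<Sum>x\<in>I. \<tau> (g x) * y x) = 0"
    if "i \<in> I" "g i = 0" "\<forall>x\<in>I. g x \<in> A" "(\<Sum>x\<in>I. g x * x) = 0" for g i
  proof -
    have "(\<Sum>x\<in>I - {i}. g x * x) = 0" "(\<Sum>x\<in>I. \<tau> (g x) * y x) = (\<Sum>x\<in>I - {i}. \<tau> (g x) * y x)"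
      using that less.prems(1) by (simp_all add: sum.remove \<tau>0)
    moreover have "card (I - {i}) < card I"
      using that(1) less.prems(1) by (meson card_Diff1_less)
    ultimately show ?thesis
      using less.hyps[of "I - {i}" g] less.prems(1,2) that by auto
  qed
  consider "I = {}" | "\<exists>i\<in>I. f i = 0" | "I \<noteq> {}" "\<forall>x\<in>I. f x \<in> A \<and> f x \<noteq> 0"
    using less.prems by blast
  then show ?case
  proof cases
    case 3
    from step[OF less.prems(1,2) this less.prems(4)] show ?thesis
    proof (elim disjE exE conjE bexE)
      fix c i j
      assume c: "\<forall>x\<in>I. c x \<in> A" "(\<Sum>x\<in>I. c x * x) = 0" "i \<in> I" "c i = 0" "j \<in> I" "c j \<noteq> 0"
      define t where "t = f j / c j"
      have t: "t \<in> A" using c less.prems(3) by (auto simp: t_def intro: subfld_divide[OF A])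
      define r where "r x = f x - t * c x" for x
      have r: "\<forall>x\<in>I. r x \<in> A" "r j = 0"
        using c less.prems(3) t by (auto simp: r_def t_def intro!: subfld_closed[OF A])
      have "(\<Sum>x\<in>I. r x * x) = (\<Sum>x\<in>I. f x * x) - t * (\<Sum>x\<in>I. c x * x)"
        by (simp add: r_def sum_subtractf sum_distrib_left algebra_simps)
      then have "(\<Sum>x\<in>I. r x * x) = 0" using c less.prems(4) by simp
      then have "(\<Sum>x\<in>I. \<tau> (r x) * y x) = 0" using shorter c(5) r by blast
      moreover have "(\<Sum>x\<in>I. \<tau> (c x) * y x) = 0" using shorter c by blast
      moreover have "\<tau> (f x) = \<tau> (r x) + \<tau> t * \<tau> (c x)" if "x \<in> I" for x
      proof -
        have "\<tau> (r x + t * c x) = \<tau> (r x) + \<tau> t * \<tau> (c x)"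
          using that r t c by (simp add: hom_on_add[OF A h] hom_on_mult[OF A h] subfld_mult[OF A])
        then show ?thesis by (simp add: r_def)
      qed
      then have "(\<Sum>x\<in>I. \<tau> (f x) * y x) = (\<Sum>x\<in>I. \<tau> (r x) * y x) + \<tau> t * (\<Sum>x\<in>I. \<tau> (c x) * y x)"
        by (simp add: sum_distrib_left sum.distrib[symmetric] algebra_simps cong: sum.cong)
      ultimately show ?thesis by simp
    qed
  qed (use shorter less.prems in auto)
qed

text \<open>If relations transfer, then \<open>a x \<mapsto> \<tau>(a) y(x)\<close> extends to a well-defined additive map on the
  span, which is multiplicative because it is so on generators.\<close>

lemma lspan_hom:
  fixes y :: "'o::field \<Rightarrow> 'o"
  assumes A: "subfld A" and h: "hom_on A \<tau>"
    and W: "1 \<in> W" "\<And>u v. u \<in> W \<Longrightarrow> v \<in> W \<Longrightarrow> u * v \<in> W"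
    and y: "y 1 = 1" "\<And>u v. u \<in> W \<Longrightarrow> v \<in> W \<Longrightarrow> y (u * v) = y u * y v"
    and tr: "\<And>I f. finite I \<Longrightarrow> I \<subseteq> W \<Longrightarrow> \<forall>x\<in>I. f x \<in> A \<Longrightarrow> (\<Sum>x\<in>I. f x * x) = 0 \<Longrightarrow>
      (\<Sum>x\<in>I. \<tau> (f x) * y x) = 0"
  obtains \<phi> where "hom_on (lspan A W) \<phi>" "\<And>a x. a \<in> A \<Longrightarrow> x \<in> W \<Longrightarrow> \<phi> (a * x) = \<tau> a * y x"
proof -
  note \<tau>0 = hom_on_0[OF A h]
  define rep where "rep u I f \<longleftrightarrow> finite I \<and> I \<subseteq> W \<and> (\<forall>x\<in>I. f x \<in> A) \<and> u = (\<Sum>x\<in>I. f x * x)" for u I f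
  define \<phi> where "\<phi> u = (SOME w. \<exists>I f. rep u I f \<and> w = (\<Sum>x\<in>I. \<tau> (f x) * y x))" for u
  \<comment> \<open>Any two representations can be written over a common index set.\<close>
  have ext: "rep u L (\<lambda>x. if x \<in> I then f x else 0) \<and>
      (\<Sum>x\<in>L. \<tau> (if x \<in> I then f x else 0) * y x) = (\<Sum>x\<in>I. \<tau> (f x) * y x)"
    if "rep u I f" "finite L" "I \<subseteq> L" "L \<subseteq> W" for u I f L
  proof -
    have "(\<Sum>x\<in>I. f x * x) = (\<Sum>x\<in>L. (if x \<in> I then f x else 0) * x)"
      by (rule sum.mono_neutral_cong_left) (use that in auto)
    moreover have "(\<Sum>x\<in>I. \<tau> (f x) * y x) = (\<Sum>x\<in>L. \<tau> (if x \<in> I then f x else 0) * y x)"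
      by (rule sum.mono_neutral_cong_left) (use that in \<open>auto simp: \<tau>0\<close>)
    ultimately show ?thesis
      using that subfld_0[OF A] by (auto simp: rep_def)
  qed
  have wd: "(\<Sum>x\<in>I. \<tau> (f x) * y x) = (\<Sum>x\<in>J. \<tau> (g x) * y x)" if "rep u I f" "rep u J g" for u I f J g
  proof -
    define f' where "f' x = (if x \<in> I then f x else 0)" for x
    define g' where "g' x = (if x \<in> J then g x else 0)" for x
    have fin: "finite (I \<union> J)" "I \<union> J \<subseteq> W" using that by (auto simp: rep_def)
    have f': "rep u (I \<union> J) f'" "(\<Sum>x\<in>I \<union> J. \<tau> (f' x) * y x) = (\<Sum>x\<in>I. \<tau> (f x) * y x)"
      using ext[OF that(1) fin(1) _ fin(2)] unfolding f'_def by auto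
    have g': "rep u (I \<union> J) g'" "(\<Sum>x\<in>I \<union> J. \<tau> (g' x) * y x) = (\<Sum>x\<in>J. \<tau> (g x) * y x)"
      using ext[OF that(2) fin(1) _ fin(2)] unfolding g'_def by auto
    have "(\<Sum>x\<in>I \<union> J. \<tau> (f' x - g' x) * y x) = 0"
      by (rule tr) (use f'(1) g'(1) fin in
        \<open>auto simp: rep_def left_diff_distrib sum_subtractf intro!: subfld_diff[OF A]\<close>)
    moreover have "\<tau> (f' x - g' x) = \<tau> (f' x) - \<tau> (g' x)" if "x \<in> I \<union> J" for x
      using hom_on_diff[OF A h] f'(1) g'(1) that by (auto simp: rep_def)
    then have "(\<Sum>x\<in>I \<union> J. \<tau> (f' x - g' x) * y x) = (\<Sum>x\<in>I \<union> J. \<tau> (f' x) * y x - \<tau> (g' x) * y x)"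
      by (intro sum.cong refl) (simp add: left_diff_distrib)
    ultimately have "(\<Sum>x\<in>I \<union> J. \<tau> (f' x) * y x) - (\<Sum>x\<in>I \<union> J. \<tau> (g' x) * y x) = 0"
      by (simp add: sum_subtractf)
    then show ?thesis using f'(2) g'(2) by simp
  qed
  have \<phi>: "\<phi> u = (\<Sum>x\<in>I. \<tau> (f x) * y x)" if "rep u I f" for u I f
    unfolding \<phi>_def by (rule some_equality) (use that wd in blast)+
  have single: "\<phi> (a * x) = \<tau> a * y x" if "a \<in> A" "x \<in> W" for a x
    using \<phi>[of "a * x" "{x}" "\<lambda>_. a"] that by (simp add: rep_def)
  have plus: "\<phi> (u + v) = \<phi> u + \<phi> v" if uv: "u \<in> lspan A W" "v \<in> lspan A W" for u v
  proof -
    obtain I f where f: "rep u I f" using uv(1) by (auto simp: lspan_def rep_def)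
    obtain J g where g: "rep v J g" using uv(2) by (auto simp: lspan_def rep_def)
    define f' where "f' x = (if x \<in> I then f x else 0)" for x
    define g' where "g' x = (if x \<in> J then g x else 0)" for x
    have fin: "finite (I \<union> J)" "I \<union> J \<subseteq> W" using f g by (auto simp: rep_def)
    have f': "rep u (I \<union> J) f'"
      using ext[OF f fin(1) _ fin(2)] unfolding f'_def by auto
    have g': "rep v (I \<union> J) g'"
      using ext[OF g fin(1) _ fin(2)] unfolding g'_def by auto
    have "rep (u + v) (I \<union> J) (\<lambda>x. f' x + g' x)"
      using f' g' by (auto simp: rep_def distrib_right sum.distrib intro: subfld_add[OF A])
    moreover have "(\<Sum>x\<in>I \<union> J. \<tau> (f' x + g' x) * y x) = (\<Sum>x\<in>I \<union> J. (\<tau> (f' x) + \<tau> (g' x)) * y x)"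
      using f' g' by (intro sum.cong refl) (simp add: rep_def hom_on_add[OF A h])
    ultimately have "\<phi> (u + v) = (\<Sum>x\<in>I \<union> J. (\<tau> (f' x) + \<tau> (g' x)) * y x)"
      by (metis \<phi>)
    then show ?thesis
      using \<phi>[OF f'] \<phi>[OF g'] by (simp add: distrib_right sum.distrib)
  qed
  have zero: "\<phi> 0 = 0" using plus[OF lspan_0 lspan_0] by (metis add.right_neutral add_left_cancel)
  have term_mult: "\<phi> ((a * x) * v) = \<tau> a * y x * \<phi> v" if "a \<in> A" "x \<in> W" "v \<in> lspan A W" for a x v
    using that(3)
  proof (induction rule: lspan_induct)
    case zero
    then show ?case by (simp add: \<open>\<phi> 0 = 0\<close>)
  next
    case (add b z v)
    have "a * x * (b * z + v) = (a * b) * (x * z) + a * x * v" by (simp add: algebra_simps)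
    also have "\<phi> \<dots> = \<phi> ((a * b) * (x * z)) + \<phi> (a * x * v)"
      using that add by (intro plus lspan_term lspan_mult[OF A W(2)] subfld_mult[OF A] W(2)) auto
    also have "\<phi> ((a * b) * (x * z)) = \<tau> a * y x * (\<tau> b * y z)"
      using that add by (simp add: single W(2) y(2) subfld_mult[OF A] hom_on_mult[OF A h])
    finally show ?case
      using add that by (simp add: plus single lspan_term algebra_simps)
  qed
  have "\<phi> (u * v) = \<phi> u * \<phi> v" if "u \<in> lspan A W" "v \<in> lspan A W" for u v
    using that(1)
  proof (induction rule: lspan_induct)
    case zero
    then show ?case by (simp add: \<open>\<phi> 0 = 0\<close>)
  next
    case (add a x u)
    have "\<phi> ((a * x + u) * v) = \<phi> ((a * x) * v) + \<phi> (u * v)"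
      unfolding distrib_right using add that(2)
      by (intro plus lspan_mult[OF A W(2)] lspan_term) auto
    then show ?case using add that(2) by (simp add: term_mult plus lspan_term single distrib_right)
  qed
  moreover have "\<phi> 1 = 1"
    using single[OF subfld_1[OF A] W(1)] hom_on_1[OF A h] y(1) by simp
  ultimately have "hom_on (lspan A W) \<phi>" using plus by (auto simp: hom_on_def)
  then show thesis using single by (rule that)
qed

section \<open>Separably closed fields and extension of homomorphisms\<close>

definition sep_closed :: "'o::field set \<Rightarrow> bool" where
  "sep_closed L \<longleftrightarrow> (\<forall>p. poly_in L p \<and> coprime p (pderiv p) \<and> degree p > 0 \<longrightarrow> (\<exists>x\<in>L. poly p x = 0))"

lemma separable_splits:
  fixes p :: "'o::field poly"
  assumes L: "subfld L" "sep_closed L" and p: "poly_in L p" "coprime p (pderiv p)"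
  shows "\<exists>S. finite S \<and> S \<subseteq> L \<and> p = Polynomial.smult (lead_coeff p) (\<Prod>a\<in>S. [:- a, 1:]) \<and> card S = degree p"
  using p
proof (induction "degree p" arbitrary: p)
  case 0
  then have "p = [:lead_coeff p:]" by (metis degree_0_id)
  moreover have "Polynomial.smult (lead_coeff p) 1 = [:lead_coeff p:]" by (simp add: one_pCons)
  ultimately show ?case using 0(1) by (intro exI[of _ "{}"]) simp
next
  case (Suc n)
  then obtain a where a: "a \<in> L" "poly p a = 0" using L(2) by (metis sep_closed_def zero_less_Suc)
  have ov: "poly_in L [:- a, 1:]"
    using a(1) L(1) by (intro poly_in_pCons poly_in_const subfld_closed) auto
  have "[:- a, 1:] dvd p" using a(2) by (simp add: poly_eq_0_iff_dvd)
  then obtain q where q: "poly_in L q" "p = [:- a, 1:] * q"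
    using poly_in_cofactor[OF L(1) Suc.prems(1) ov] by metis
  have "q \<noteq> 0" using Suc(2) q(2) by auto
  then have deg: "degree q = n" using Suc(2) q(2) by (simp add: degree_mult_eq del: mult_pCons_left)
  have sep: "coprime q (pderiv q)"
    using separable_dvd[OF Suc.prems(2), of q] q(2) by (metis dvd_triv_right)
  from Suc.hyps(1)[OF deg[symmetric] q(1) sep] obtain S where
    S: "finite S" "S \<subseteq> L" "q = Polynomial.smult (lead_coeff q) (\<Prod>a\<in>S. [:- a, 1:])" "card S = degree q" by blast
  have "a \<notin> S"
  proof
    assume "a \<in> S"
    then have "poly q a = 0" using S(1) by (subst S(3)) (auto simp: poly_prod)
    then have "[:- a, 1:] dvd pderiv p" "[:- a, 1:] dvd p"
      using a(2) by (auto simp: q(2) pderiv_mult poly_eq_0_iff_dvd[symmetric] simp del: mult_pCons_left)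
    then have "is_unit [:- a, 1:]" using Suc.prems(2) by (meson coprime_common_divisor)
    then show False by (simp add: is_unit_poly_iff)
  qed
  moreover have "lead_coeff p = lead_coeff q" by (simp add: q(2) lead_coeff_mult del: mult_pCons_left)
  ultimately show ?case
    using S a(1) deg Suc(2)
    by (intro exI[of _ "insert a S"]) (auto simp: q(2) mult_smult_right[symmetric] simp del: mult_pCons_left mult_smult_right)
qed

lemma separable_roots_in:
  fixes p :: "'o::field poly"
  assumes L: "subfld L" "sep_closed L" and p: "poly_in L p" "coprime p (pderiv p)" and "poly p x = 0"
  shows "x \<in> L"
proof -
  obtain S where S: "finite S" "S \<subseteq> L" "p = Polynomial.smult (lead_coeff p) (\<Prod>a\<in>S. [:- a, 1:])"
    using separable_splits[OF L p] by blast
  have "p \<noteq> 0" using separable_nz[OF p(2)] .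
  then have "poly (\<Prod>a\<in>S. [:- a, 1:]) x = 0"
    using assms(5) S(3) by (metis leading_coeff_0_iff mult_eq_0_iff poly_smult)
  then show ?thesis using S by (auto simp: poly_prod)
qed

lemma hom_on_mono: "hom_on B \<phi> \<Longrightarrow> A \<subseteq> B \<Longrightarrow> hom_on A \<phi>"
  unfolding hom_on_def by blast

text \<open>Zorn's lemma, applied to graphs. The hypothesis on generation replaces the separability of the
  ambient field over \<open>A\<close>: it is only needed that a proper intermediate field leaves out some element
  that is separable over it. In this way transitivity of separability never has to be proved.\<close>

lemma extend_hom:
  fixes A :: "'o::field set"
  assumes A: "subfld A" and h: "hom_on A \<phi>" and cl: "sep_closed (UNIV :: 'o set)"
    and gen: "\<And>B. subfld B \<Longrightarrow> A \<subseteq> B \<Longrightarrow> B \<noteq> UNIV \<Longrightarrow> \<exists>x. x \<notin> B \<and> sep_over B x"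
  obtains \<psi> where "hom_on UNIV \<psi>" "\<And>a. a \<in> A \<Longrightarrow> \<psi> a = \<phi> a"
proof -
  \<comment> \<open>Homomorphisms on intermediate fields are ordered by inclusion of their graphs.\<close>
  define good where "good G \<longleftrightarrow> (\<lambda>a. (a, \<phi> a)) ` A \<subseteq> G \<and>
    (\<forall>x y x' y'. (x, y) \<in> G \<and> (x', y') \<in> G \<longrightarrow> (x - x', y - y') \<in> G \<and> (x * x', y * y') \<in> G) \<and>
    (\<forall>x y. (x, y) \<in> G \<longrightarrow> (inverse x, inverse y) \<in> G) \<and> (\<forall>y. (0, y) \<in> G \<longrightarrow> y = 0)" for G
  have good_graph: "good ((\<lambda>b. (b, \<psi> b)) ` B)"
    if "subfld B" "hom_on B \<psi>" "A \<subseteq> B" "\<And>a. a \<in> A \<Longrightarrow> \<psi> a = \<phi> a" for B \<psi>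
    unfolding good_def using that(3,4)
    by (auto simp: image_iff subfld_closed[OF that(1)] hom_on_diff[OF that(1,2)] hom_on_mult[OF that(1,2)]
        hom_on_inverse[OF that(1,2)] hom_on_0[OF that(1,2)])
  have good_hom: "\<exists>B \<psi>. subfld B \<and> hom_on B \<psi> \<and> A \<subseteq> B \<and> (\<forall>a\<in>A. \<psi> a = \<phi> a) \<and> G = (\<lambda>b. (b, \<psi> b)) ` B"
    if G: "good G" for G
  proof -
    have g: "\<And>a. a \<in> A \<Longrightarrow> (a, \<phi> a) \<in> G"
      "\<And>x y x' y'. (x, y) \<in> G \<Longrightarrow> (x', y') \<in> G \<Longrightarrow> (x - x', y - y') \<in> G"
      "\<And>x y x' y'. (x, y) \<in> G \<Longrightarrow> (x', y') \<in> G \<Longrightarrow> (x * x', y * y') \<in> G"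
      "\<And>x y. (x, y) \<in> G \<Longrightarrow> (inverse x, inverse y) \<in> G" "\<And>y. (0, y) \<in> G \<Longrightarrow> y = 0"
      using G unfolding good_def by blast+
    define \<psi> where "\<psi> x = (SOME y. (x, y) \<in> G)" for x
    have uniq: "y = y'" if "(x, y) \<in> G" "(x, y') \<in> G" for x y y'
      using g(5)[of "y - y'"] g(2)[OF that] by simp
    have \<psi>: "\<psi> x = y" if "(x, y) \<in> G" for x y
      unfolding \<psi>_def using someI[of "\<lambda>y. (x, y) \<in> G", OF that] uniq that by blast
    have graph: "G = (\<lambda>b. (b, \<psi> b)) ` fst ` G" using \<psi> by force
    have mem: "(x, \<psi> x) \<in> G" if "x \<in> fst ` G" for x using that \<psi> by force
    have A1: "A \<subseteq> fst ` G" "\<forall>a\<in>A. \<psi> a = \<phi> a" using g(1) \<psi> by force+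
    have sub: "subfld (fst ` G)"
    proof (rule subfldI)
      show "1 \<in> fst ` G" using A1(1) subfld_1[OF A] by blast
      fix x x' assume x: "x \<in> fst ` G" "x' \<in> fst ` G"
      show "x - x' \<in> fst ` G" using g(2)[OF mem[OF x(1)] mem[OF x(2)]] by (metis fst_conv imageI)
      show "x * x' \<in> fst ` G" using g(3)[OF mem[OF x(1)] mem[OF x(2)]] by (metis fst_conv imageI)
    next
      fix x assume x: "x \<in> fst ` G"
      show "inverse x \<in> fst ` G" using g(4)[OF mem[OF x(1)]] by (metis fst_conv imageI)
    qed
    have zero: "(0, 0) \<in> G"
      using g(1)[OF subfld_0[OF A]] hom_on_0[OF A h] by simp
    have "hom_on (fst ` G) \<psi>"
      unfolding hom_on_def
    proof (intro conjI ballI)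
      show "\<psi> 1 = 1" using A1(2) subfld_1[OF A] hom_on_1[OF A h] by simp
      fix x x' assume x: "x \<in> fst ` G" "x' \<in> fst ` G"
      have "(x - (0 - x'), \<psi> x - (0 - \<psi> x')) \<in> G" using x zero by (intro g mem)
      then show "\<psi> (x + x') = \<psi> x + \<psi> x'" using \<psi> by simp
      show "\<psi> (x * x') = \<psi> x * \<psi> x'" using g(3)[OF mem mem] x \<psi> by blast
    qed
    then show ?thesis using sub A1 graph by blast
  qed
  have "\<exists>M\<in>Collect good. \<forall>W\<in>Collect good. M \<subseteq> W \<longrightarrow> W = M"
  proof (rule subset_Zorn_nonempty)
    show "Collect good \<noteq> {}" using good_graph[OF A h] by blast
    fix C assume C: "C \<noteq> {}" "subset.chain (Collect good) C"
    then have Cg: "\<And>G. G \<in> C \<Longrightarrow> good G" and tot: "\<And>G H. G \<in> C \<Longrightarrow> H \<in> C \<Longrightarrow> G \<subseteq> H \<or> H \<subseteq> G"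
      by (auto simp: subset_chain_def)
    have two: "\<exists>G\<in>C. u \<in> G \<and> v \<in> G" if "u \<in> \<Union>C" "v \<in> \<Union>C" for u v
    proof -
      obtain G H where GH: "G \<in> C" "H \<in> C" "u \<in> G" "v \<in> H" using \<open>u \<in> \<Union>C\<close> \<open>v \<in> \<Union>C\<close> by blast
      from tot[OF GH(1,2)] show ?thesis using GH by auto
    qed
    have "good (\<Union>C)"
      unfolding good_def
    proof (intro conjI allI impI)
      show "(\<lambda>a. (a, \<phi> a)) ` A \<subseteq> \<Union>C" using C(1) Cg unfolding good_def by blast
    next
      fix x y x' y' assume "(x, y) \<in> \<Union>C \<and> (x', y') \<in> \<Union>C"
      then obtain G where "G \<in> C" "(x, y) \<in> G" "(x', y') \<in> G" using two by blast
      then show "(x - x', y - y') \<in> \<Union>C" "(x * x', y * y') \<in> \<Union>C"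
        using Cg[of G] unfolding good_def by blast+
    next
      fix x y assume "(x, y) \<in> \<Union>C"
      then show "(inverse x, inverse y) \<in> \<Union>C" using Cg unfolding good_def by blast
    next
      fix y assume "(0, y) \<in> \<Union>C"
      then show "y = 0" using Cg unfolding good_def by blast
    qed
    then show "\<Union>C \<in> Collect good" by simp
  qed
  then obtain M where M: "good M" "\<And>W. good W \<Longrightarrow> M \<subseteq> W \<Longrightarrow> W = M" by blast
  obtain B \<psi> where B: "subfld B" "hom_on B \<psi>" "A \<subseteq> B" "\<forall>a\<in>A. \<psi> a = \<phi> a" "M = (\<lambda>b. (b, \<psi> b)) ` B"
    using good_hom[OF M(1)] by blast
  have "B = UNIV"
  proof (rule ccontr)
    assume "B \<noteq> UNIV"
    then obtain x where x: "x \<notin> B" "sep_over B x" using gen B by blast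
    obtain \<mu> where \<mu>: "min_poly_of B x \<mu>"
      using min_poly_ex[OF B(1) sep_imp_algebraic[OF x(2)]] .
    have ov: "poly_in B \<mu>" using \<mu> by (simp add: min_poly_of_def)
    have "coprime (map_poly \<psi> \<mu>) (pderiv (map_poly \<psi> \<mu>))"
      using map_separable[OF B(1,2) ov min_poly_separable[OF \<mu> x(2)]] .
    moreover have "degree (map_poly \<psi> \<mu>) > 0"
      using map_degree[OF B(1,2) ov] min_poly_degree(1)[OF B(1) \<mu>] by simp
    ultimately obtain x' where "poly (map_poly \<psi> \<mu>) x' = 0"
      using cl by (auto simp: sep_closed_def poly_in_def)
    then obtain \<psi>' where \<psi>': "hom_on (adjoin B x) \<psi>'" "\<And>a. a \<in> B \<Longrightarrow> \<psi>' a = \<psi> a"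
      using adjoin_hom[OF B(1,2) \<mu>] by metis
    have sub: "B \<subseteq> adjoin B x" using adjoin_subset[OF B(1)] .
    have "good ((\<lambda>b. (b, \<psi>' b)) ` adjoin B x)"
      using good_graph[OF adjoin_subfld[OF B(1) sep_imp_algebraic[OF x(2)]] \<psi>'(1)] sub B(3,4) \<psi>'(2)
      by (metis subset_eq)
    moreover have "M \<subseteq> (\<lambda>b. (b, \<psi>' b)) ` adjoin B x" using sub \<psi>'(2) by (auto simp: B(5) image_iff)
    ultimately have "(\<lambda>b. (b, \<psi>' b)) ` adjoin B x = M" using M(2) by blast
    then have "adjoin B x = B" unfolding B(5) by (force simp: set_eq_iff image_iff)
    then show False using x(1) adjoin_gen[OF B(1)] by blast
  qed
  then show thesis using that[of \<psi>] B by blast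
qed

text \<open>The image of an endomorphism of a separably closed field is separably closed, so no element
  outside of it is separable over it.\<close>

lemma extend_hom_surj:
  fixes \<psi> :: "'o::field \<Rightarrow> 'o"
  assumes h: "hom_on UNIV \<psi>" and cl: "sep_closed (UNIV :: 'o set)" and A: "A \<subseteq> range \<psi>"
    and gen: "\<And>B. subfld B \<Longrightarrow> A \<subseteq> B \<Longrightarrow> B \<noteq> UNIV \<Longrightarrow> \<exists>x. x \<notin> B \<and> sep_over B x"
  shows "bij \<psi>"
proof -
  note sR = hom_on_image[OF subfld_UNIV h]
  have inj: "inj \<psi>"
    using hom_on_diff[OF subfld_UNIV h] hom_on_inj[OF subfld_UNIV h] by (metis UNIV_I eq_iff_diff_eq_0 injI)
  have "range \<psi> = UNIV"
  proof (rule ccontr)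
    assume "range \<psi> \<noteq> UNIV"
    then obtain x p where x: "x \<notin> range \<psi>" and p: "poly_in (range \<psi>) p" "coprime p (pderiv p)" "poly p x = 0"
      using gen[OF sR A] by (auto simp: sep_over_def)
    define \<theta> where "\<theta> = inv_into UNIV \<psi>"
    have \<theta>: "\<theta> (\<psi> a) = a" for a using inj by (simp add: \<theta>_def)
    have \<theta>h: "hom_on (range \<psi>) \<theta>"
      unfolding hom_on_def using \<theta> hom_on_1[OF subfld_UNIV h] hom_on_add[OF subfld_UNIV h] hom_on_mult[OF subfld_UNIV h]
      by (auto) (metis UNIV_I)+
    note q = map_separable[OF sR \<theta>h p(1,2)]
    define q where "q = map_poly \<theta> p"
    obtain S where S: "finite S" "q = Polynomial.smult (lead_coeff q) (\<Prod>a\<in>S. [:- a, 1:])"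
      using separable_splits[OF subfld_UNIV cl _ q] by (auto simp: poly_in_def q_def)
    have pq: "p = map_poly \<psi> q"
    proof (rule poly_eqI)
      fix i
      have "poly.coeff p i \<in> range \<psi>" using p(1) by (simp add: poly_in_def)
      then have "\<psi> (\<theta> (poly.coeff p i)) = poly.coeff p i" by (simp add: \<theta>_def f_inv_into_f)
      then show "poly.coeff p i = poly.coeff (map_poly \<psi> q) i"
        by (simp add: q_def coeff_map[OF subfld_UNIV h] coeff_map[OF sR \<theta>h])
    qed
    have mp: "map_poly \<psi> (\<Prod>a\<in>S. [:- a, 1:]) = (\<Prod>a\<in>S. [:- \<psi> a, 1:])"
      by (rule map_prod_linear[OF subfld_UNIV h S(1)]) simp
    have "p = Polynomial.smult (\<psi> (lead_coeff q)) (\<Prod>a\<in>S. [:- \<psi> a, 1:])"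
      unfolding pq mp[symmetric] by (subst S(2)) (simp add: map_poly_smult hom_on_0[OF subfld_UNIV h] hom_on_mult[OF subfld_UNIV h])
    moreover have "p \<noteq> 0" using separable_nz[OF p(2)] .
    ultimately have "poly (\<Prod>a\<in>S. [:- \<psi> a, 1:]) x = 0"
      using p(3) by (metis mult_eq_0_iff poly_smult smult_0_left)
    then show False using x S(1) by (auto simp: poly_prod)
  qed
  then show ?thesis using inj by (simp add: bij_def)
qed

section \<open>Automorphisms of the ambient field\<close>

definition Aut :: "'o::field set \<Rightarrow> ('o \<Rightarrow> 'o) set" where
  "Aut A = {g. bij g \<and> hom_on UNIV g \<and> (\<forall>x\<in>A. g x = x)}"

definition fixed :: "('o::field \<Rightarrow> 'o) set \<Rightarrow> 'o set" where
  "fixed H = {x. \<forall>g\<in>H. g x = x}"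

lemma Aut_simps:
  assumes "g \<in> Aut A"
  shows "g 0 = 0" "g 1 = 1" "g (x + y) = g x + g y" "g (x * y) = g x * g y" "g (x - y) = g x - g y"
    "g (- x) = - g x" "g (inverse x) = inverse (g x)" "g (x / y) = g x / g y" "g (x ^ n) = g x ^ n"
    "g (sum f I) = (\<Sum>i\<in>I. g (f i))" "g (of_nat n) = of_nat n" "g x = g y \<longleftrightarrow> x = y"
proof -
  have h: "hom_on UNIV g" using assms by (simp add: Aut_def)
  note hs = hom_on_0[OF subfld_UNIV h] hom_on_1[OF subfld_UNIV h] hom_on_add[OF subfld_UNIV h]
    hom_on_mult[OF subfld_UNIV h] hom_on_diff[OF subfld_UNIV h] hom_on_uminus[OF subfld_UNIV h]
    hom_on_inverse[OF subfld_UNIV h] hom_on_power[OF subfld_UNIV h] hom_on_sum[OF subfld_UNIV h]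
    hom_on_of_nat[OF subfld_UNIV h]
  show "g 0 = 0" "g 1 = 1" "g (x + y) = g x + g y" "g (x * y) = g x * g y" "g (x - y) = g x - g y"
    "g (- x) = - g x" "g (inverse x) = inverse (g x)" "g (x / y) = g x / g y" "g (x ^ n) = g x ^ n"
    "g (sum f I) = (\<Sum>i\<in>I. g (f i))" "g (of_nat n) = of_nat n"
    by (simp_all add: hs divide_inverse)
  have "inj g" using assms by (simp add: Aut_def bij_def)
  then show "g x = g y \<longleftrightarrow> x = y" by (simp add: inj_eq)
qed

lemma Aut_fixes: "g \<in> Aut A \<Longrightarrow> x \<in> A \<Longrightarrow> g x = x"
  by (simp add: Aut_def)

lemma Aut_bij: "g \<in> Aut A \<Longrightarrow> bij g"
  by (simp add: Aut_def)

lemma Aut_hom: "g \<in> Aut A \<Longrightarrow> hom_on UNIV g"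
  by (simp add: Aut_def)

lemma Aut_mono: "A \<subseteq> B \<Longrightarrow> Aut B \<subseteq> Aut A"
  by (auto simp: Aut_def)

lemma Aut_id: "(\<lambda>x. x) \<in> Aut A"
  by (auto simp: Aut_def hom_on_def bij_def inj_on_def)

lemma Aut_comp: "g \<in> Aut A \<Longrightarrow> h \<in> Aut A \<Longrightarrow> (\<lambda>x. g (h x)) \<in> Aut A"
  using bij_comp[of h g] by (auto simp: Aut_def hom_on_def comp_def)

lemma Aut_inverse:
  assumes g: "g \<in> Aut A"
  obtains g' where "g' \<in> Aut A" "\<And>x. g' (g x) = x" "\<And>x. g (g' x) = x"
proof -
  define g' where "g' = inv_into UNIV g"
  have b: "bij g" using g by (rule Aut_bij)
  have gg: "g' (g x) = x" "g (g' x) = x" for x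
    using b by (auto simp: g'_def bij_def surj_f_inv_f)
  have "hom_on UNIV g'"
    unfolding hom_on_def
    by (intro conjI ballI; subst Aut_simps(12)[OF g, symmetric])
       (simp_all add: gg Aut_simps(2,3,4)[OF g])
  moreover have "bij g'" using b by (simp add: g'_def bij_imp_bij_inv)
  moreover have "g' x = x" if "x \<in> A" for x
    using gg(1)[of x] Aut_fixes[OF g that] by simp
  ultimately show thesis using gg by (intro that[of g']) (auto simp: Aut_def)
qed

lemma Aut_image_eq:
  assumes "g \<in> Aut A" "\<And>h x. h \<in> Aut A \<Longrightarrow> x \<in> B \<Longrightarrow> h x \<in> B"
  shows "g ` B = B"
proof
  obtain g' where g': "g' \<in> Aut A" "\<And>x. g (g' x) = x" using Aut_inverse[OF assms(1)] by metis
  then show "B \<subseteq> g ` B" using assms(2)[OF g'(1)] by (metis imageI subsetI)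
qed (use assms in auto)

lemma subfld_fixed:
  assumes "H \<subseteq> Aut A"
  shows "subfld (fixed H)"
  by (rule subfldI; use assms in \<open>auto simp: fixed_def Aut_simps(2,4,5,7)[OF subsetD[OF assms]]\<close>)

lemma Aut_poly: "g \<in> Aut A \<Longrightarrow> poly (map_poly g p) (g x) = g (poly p x)"
  using map_poly_eval[OF subfld_UNIV Aut_hom] by (auto simp: poly_in_def)

lemma Aut_map_id: "g \<in> Aut A \<Longrightarrow> poly_in A p \<Longrightarrow> map_poly g p = p"
  by (intro poly_eqI) (simp add: coeff_map[OF subfld_UNIV Aut_hom] poly_in_def Aut_fixes)

lemma Aut_root: "g \<in> Aut A \<Longrightarrow> poly_in A p \<Longrightarrow> poly p x = 0 \<Longrightarrow> poly p (g x) = 0"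
  using Aut_poly[of g A p x] Aut_map_id[of g A p] Aut_simps(1)[of g A] by simp

lemma finite_orbit:
  assumes "algebraic_over A x"
  shows "finite {g x |g. g \<in> Aut A}"
proof -
  obtain p where p: "p \<noteq> 0" "poly_in A p" "poly p x = 0" using assms by (auto simp: algebraic_over_def)
  have "{g x |g. g \<in> Aut A} \<subseteq> {y. poly p y = 0}" using Aut_root p by blast
  then show ?thesis using poly_roots_finite[OF p(1)] finite_subset by blast
qed

section \<open>Interpolation\<close>

lemma interpolation:
  fixes S :: "'o::field set"
  assumes "finite S" "S \<noteq> {}"
  shows "\<exists>q. degree q < card S \<and> (\<forall>s\<in>S. poly q s = v s) \<and>
    (\<forall>B. subfld B \<and> S \<subseteq> B \<and> v ` S \<subseteq> B \<longrightarrow> poly_in B q)"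
proof -
  define q where "q = (\<Sum>s\<in>S. Polynomial.smult (v s / (\<Prod>t\<in>S - {s}. s - t)) (\<Prod>t\<in>S - {s}. [:- t, 1:]))"
  have "poly q a = v a" if a: "a \<in> S" for a
  proof -
    have "poly q a = (\<Sum>s\<in>S. v s / (\<Prod>t\<in>S - {s}. s - t) * (\<Prod>t\<in>S - {s}. a - t))"
      by (simp add: q_def poly_sum poly_prod)
    also have "\<dots> = (\<Sum>s\<in>S. if s = a then v a else 0)"
    proof (rule sum.cong)
      fix s assume "s \<in> S"
      show "v s / (\<Prod>t\<in>S - {s}. s - t) * (\<Prod>t\<in>S - {s}. a - t) = (if s = a then v a else 0)"
      proof (cases "s = a")
        case True
        then show ?thesis using assms(1) by (simp add: prod_zero_iff)
      next
        case False
        then have "(\<Prod>t\<in>S - {s}. a - t) = 0" using a assms(1) by (intro prod_zero) auto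
        then show ?thesis using False by simp
      qed
    qed simp
    finally show ?thesis using a assms(1) by simp
  qed
  moreover have "degree q < card S"
  proof -
    have "degree (Polynomial.smult c (\<Prod>t\<in>S - {s}. [:- t, 1:])) \<le> card S - 1" if "s \<in> S" for s c
    proof -
      have "degree (\<Prod>t\<in>S - {s}. [:- t, 1:]) \<le> (\<Sum>t\<in>S - {s}. degree [:- t, 1:])"
        using assms(1) by (intro degree_prod_sum_le[OF finite_Diff, unfolded comp_def])
      also have "\<dots> = card S - 1" using that assms(1) by simp
      finally show ?thesis using degree_smult_le order_trans by blast
    qed
    then have "degree q \<le> card S - 1" unfolding q_def by (intro degree_sum_le assms(1))
    moreover have "card S > 0" using assms by (simp add: card_gt_0_iff)
    ultimately show ?thesis by linarith
  qed
  moreover have "poly_in B q" if B: "subfld B" "S \<subseteq> B" "v ` S \<subseteq> B" for B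
    unfolding q_def using B(2,3)
    by (intro poly_in_sum[OF B(1)] poly_in_smult[OF B(1)] poly_in_prod[OF B(1)] poly_in_pCons[OF B(1)] poly_in_const[OF B(1)]
        subfld_divide[OF B(1)] subfld_prod[OF B(1)] subfld_diff[OF B(1)] subfld_uminus[OF B(1)] subfld_1[OF B(1)]) auto
  ultimately show ?thesis by blast
qed

text \<open>A substitute for the primitive element theorem and for Galois descent: if the position of
  \<open>x\<close> in its orbit is determined by that of \<open>e\<close>, let \<open>q\<close> be the interpolation polynomial with
  \<open>q(g e) = g x\<close>. It is unique, hence invariant under \<open>G\<close>, and \<open>q(e) = x\<close>.\<close>

lemma fixed_interpolation:
  assumes G: "G \<subseteq> Aut {}" "(\<lambda>x. x) \<in> G" "\<And>g h. g \<in> G \<Longrightarrow> h \<in> G \<Longrightarrow> (\<lambda>x. g (h x)) \<in> G"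
    and fin: "finite {g e |g. g \<in> G}"
    and det: "\<And>g h. g \<in> G \<Longrightarrow> h \<in> G \<Longrightarrow> g e = h e \<Longrightarrow> g x = h x"
    and B: "subfld B" "\<And>g. g \<in> G \<Longrightarrow> g e \<in> B" "\<And>g. g \<in> G \<Longrightarrow> g x \<in> B"
  obtains q where "poly_in (fixed G \<inter> B) q" "poly q e = x"
proof -
  define S where "S = {g e |g. g \<in> G}"
  define v where "v s = (SOME g. g \<in> G \<and> g e = s) x" for s
  have v: "v (g e) = g x" if "g \<in> G" for g
  proof -
    have "(SOME h. h \<in> G \<and> h e = g e) \<in> G \<and> (SOME h. h \<in> G \<and> h e = g e) e = g e"
      by (rule someI[of _ g]) (use that in auto)
    then show ?thesis unfolding v_def using det that by blast
  qed
  have S: "finite S" "S \<noteq> {}" using fin G(2) by (auto simp: S_def)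
  obtain q where q: "degree q < card S" "\<forall>s\<in>S. poly q s = v s"
    "\<forall>B. subfld B \<and> S \<subseteq> B \<and> v ` S \<subseteq> B \<longrightarrow> poly_in B q" using interpolation[OF S] by blast
  have "poly_in B q" using q(3) B v by (force simp: S_def)
  moreover have "map_poly h q = q" if h: "h \<in> G" for h
  proof (rule poly_eqI_degree)
    have hA: "h \<in> Aut {}" using h G(1) by blast
    have "h ` S \<subseteq> S" using G(3)[OF h] by (force simp: S_def)
    then have hS: "h ` S = S"
      using S(1) Aut_simps(12)[OF hA] by (intro endo_inj_surj) (auto simp: inj_on_def)
    show "poly (map_poly h q) s = poly q s" if s: "s \<in> S" for s
    proof -
      obtain g where g: "g \<in> G" "s = h (g e)" using s hS by (auto simp: S_def)
      have "poly (map_poly h q) s = h (poly q (g e))" using g(2) Aut_poly[OF hA] by simp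
      also have "\<dots> = h (g x)" using q(2) g(1) v by (auto simp: S_def)
      also have "\<dots> = poly q s" using q(2) s v[OF G(3)[OF h g(1)]] g(2) by auto
      finally show ?thesis .
    qed
    show "card S > degree (map_poly h q)"
      using q(1) map_degree[OF subfld_UNIV Aut_hom[OF hA], of q] by (simp add: poly_in_def)
  qed (rule q(1))
  then have "h (poly.coeff q i) = poly.coeff q i" if "h \<in> G" for h i
    using coeff_map[OF subfld_UNIV Aut_hom, of h "{}" q i] G(1) that by (metis subsetD)
  ultimately have "poly_in (fixed G \<inter> B) q" by (auto simp: poly_in_def fixed_def)
  moreover have "poly q e = x" using q(2) v[OF G(2)] G(2) by (force simp: S_def)
  ultimately show thesis by (rule that)
qed

section \<open>The tower of fields\<close>

text \<open>The situation of the theorem: the ambient type is a separable closure of \<open>F\<close>, and \<open>F\<close> is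
  generated by \<open>K\<close> and \<open>kb\<close>, which meet in \<open>k\<close>.\<close>

locale sep_tower =
  fixes k kb K F :: "'o::field set"
  assumes k: "subfld k" and kb: "subfld kb" and K: "subfld K" and F: "subfld F"
    and k_kb: "k \<subseteq> kb" and k_K: "k \<subseteq> K" and K_kb: "K \<inter> kb \<subseteq> k"
    and F_eq: "F = lspan kb K"
    and kb_sep: "\<And>x. x \<in> kb \<Longrightarrow> sep_over k x" and kb_closed: "sep_closed kb"
    and F_sep: "\<And>x. sep_over F x" and closed: "sep_closed (UNIV :: 'o set)"
begin

lemma K_F: "K \<subseteq> F" and kb_F: "kb \<subseteq> F"
  unfolding F_eq using lspan_term[of 1 kb _ K] lspan_term[of _ kb 1 K] subfld_1[OF kb] subfld_1[OF K] by force+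

lemma F_least: "subfld B \<Longrightarrow> K \<subseteq> B \<Longrightarrow> kb \<subseteq> B \<Longrightarrow> F \<subseteq> B"
  unfolding F_eq by (rule lspan_least)

text \<open>An intermediate field either misses an element of \<open>kb\<close>, which is separable over \<open>k\<close>, or it
  contains \<open>F\<close>, over which everything is separable.\<close>

lemma sep_generation:
  assumes "subfld B" "K \<subseteq> B" "B \<noteq> UNIV"
  shows "\<exists>x. x \<notin> B \<and> sep_over B x"
proof (cases "kb \<subseteq> B")
  case True
  then show ?thesis using F_least[OF assms(1,2)] F_sep sep_over_mono assms(3) by (metis UNIV_eq_I)
next
  case False
  then show ?thesis using kb_sep sep_over_mono k_K assms(2) by (metis subset_iff)
qed

lemma extend_to_Aut:
  assumes A: "subfld A" "K \<subseteq> A" and h: "hom_on A \<phi>" and idK: "\<And>x. x \<in> K \<Longrightarrow> \<phi> x = x"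
  obtains g where "g \<in> Aut K" "\<And>a. a \<in> A \<Longrightarrow> g a = \<phi> a"
proof -
  obtain \<psi> where \<psi>: "hom_on UNIV \<psi>" "\<And>a. a \<in> A \<Longrightarrow> \<psi> a = \<phi> a"
    using extend_hom[OF A(1) h closed] sep_generation A(2) by (metis order_trans)
  have fixK: "\<psi> x = x" if "x \<in> K" for x using \<psi>(2) idK A(2) that by auto
  then have "K \<subseteq> range \<psi>" by (metis rangeI subsetI)
  then have "bij \<psi>" using extend_hom_surj[OF \<psi>(1) closed] sep_generation by blast
  then show thesis using \<psi> fixK by (intro that[of \<psi>]) (auto simp: Aut_def)
qed

lemma Aut_moves:
  assumes A: "subfld A" "K \<subseteq> A" and x: "x \<notin> A" "sep_over A x"
  obtains g where "g \<in> Aut A" "g x \<noteq> x"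
proof -
  obtain \<mu> where \<mu>: "min_poly_of A x \<mu>" using min_poly_ex[OF A(1) sep_imp_algebraic[OF x(2)]] .
  obtain S where S: "finite S" "\<mu> = Polynomial.smult (lead_coeff \<mu>) (\<Prod>a\<in>S. [:- a, 1:])" "card S = degree \<mu>"
    using separable_splits[OF subfld_UNIV closed _ min_poly_separable[OF \<mu> x(2)]] by (auto simp: poly_in_def)
  have "card S > 1" using min_poly_degree(2)[OF A(1) \<mu> x(1)] S(3) by simp
  then obtain x' where x': "x' \<in> S" "x' \<noteq> x"
    by (metis One_nat_def card.empty card_1_singleton_iff insertCI less_irrefl_nat not_less_zero subsetI subset_singletonD)
  then have root: "poly \<mu> x' = 0" using S(1) by (subst S(2)) (auto simp: poly_prod)
  have id: "hom_on A (\<lambda>x. x)" by (simp add: hom_on_def)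
  obtain \<psi> where \<psi>: "hom_on (adjoin A x) \<psi>" "\<And>a. a \<in> A \<Longrightarrow> \<psi> a = a" "\<psi> x = x'"
    using adjoin_hom[OF A(1) id \<mu>] root by auto
  obtain g where g: "g \<in> Aut K" "\<And>a. a \<in> adjoin A x \<Longrightarrow> g a = \<psi> a"
    using extend_to_Aut[OF adjoin_subfld[OF A(1) sep_imp_algebraic[OF x(2)]] _ \<psi>(1)]
      A(2) adjoin_subset[OF A(1)] \<psi>(2) by (metis subset_iff)
  show thesis
  proof (rule that)
    show "g \<in> Aut A" using g \<psi>(2) adjoin_subset[OF A(1)] by (fastforce simp: Aut_def)
    show "g x \<noteq> x" using g(2)[OF adjoin_gen[OF A(1)]] \<psi>(3) x'(2) by simp
  qed
qed

lemma Aut_kb_closed: "g \<in> Aut k \<Longrightarrow> x \<in> kb \<Longrightarrow> g x \<in> kb"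
  using kb_sep[of x] separable_roots_in[OF kb kb_closed] poly_in_mono[OF _ k_kb] Aut_root[of g k _ x]
  unfolding sep_over_def by metis

lemma Aut_K_k: "g \<in> Aut K \<Longrightarrow> g \<in> Aut k"
  using Aut_mono[OF k_K] by blast

lemma Aut_kb: "g \<in> Aut K \<Longrightarrow> g ` kb = kb"
  by (rule Aut_image_eq) (auto intro: Aut_kb_closed Aut_K_k)

lemma Aut_lspan:
  assumes "K \<subseteq> M" "g \<in> Aut M"
  shows "g ` lspan kb M = lspan kb M"
proof (rule Aut_image_eq[OF assms(2)])
  fix h x assume h: "h \<in> Aut M" and "x \<in> lspan kb M"
  from this(2) show "h x \<in> lspan kb M"
  proof (induction rule: lspan_induct)
    case zero
    then show ?case using Aut_simps(1)[OF h] lspan_0 by simp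
  next
    case (add a x u)
    have "h \<in> Aut k" using h Aut_mono[of k M] assms(1) k_K by blast
    then have "h a \<in> kb" using Aut_kb_closed add by blast
    then show ?case using add h
      by (simp add: Aut_simps(3,4)[OF h] Aut_fixes[OF h] lspan_add[OF kb] lspan_term)
  qed
qed

lemma Aut_F: "g \<in> Aut K \<Longrightarrow> g ` F = F"
  unfolding F_eq by (rule Aut_lspan) auto

lemma lspan_kb_subfld:
  assumes M: "subfld M" "K \<subseteq> M"
  shows "subfld (lspan kb M)" "M \<subseteq> lspan kb M" "kb \<subseteq> lspan kb M" "F \<subseteq> lspan kb M"
proof -
  show 1: "M \<subseteq> lspan kb M" "kb \<subseteq> lspan kb M"
    using lspan_term[of 1 kb _ M] lspan_term[of _ kb 1 M] subfld_1[OF kb] subfld_1[OF M(1)] by force+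
  show F': "F \<subseteq> lspan kb M"
    unfolding F_eq lspan_def using M(2) by blast
  show "subfld (lspan kb M)"
  proof (rule alg_subring_subfld[OF F F'])
    show "algebraic_over F x" for x by (rule sep_imp_algebraic[OF F_sep])
    show "x - y \<in> lspan kb M" if "x \<in> lspan kb M" "y \<in> lspan kb M" for x y
      using lspan_add[OF kb that(1) lspan_uminus[OF kb that(2)]] by simp
    show "x * y \<in> lspan kb M" if "x \<in> lspan kb M" "y \<in> lspan kb M" for x y
      using lspan_mult[OF kb _ that] subfld_mult[OF M(1)] by blast
  qed
qed

text \<open>Only elements of \<open>kb\<close> are considered, because these are known to be separable over \<open>M\<close>.\<close>

lemma kb_moves:
  assumes "subfld M" "K \<subseteq> M" "M \<inter> kb \<subseteq> k" "x \<in> kb" "\<And>g. g \<in> Aut M \<Longrightarrow> g x = x"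
  shows "x \<in> k"
proof (rule ccontr)
  assume "x \<notin> k"
  then have "x \<notin> M" using assms by blast
  moreover have "sep_over M x" using kb_sep[OF assms(4)] sep_over_mono k_K assms(2) by blast
  ultimately show False using Aut_moves[OF assms(1,2)] assms(5) by metis
qed

text \<open>\<open>M\<close> and \<open>kb\<close> are linearly disjoint over \<open>k\<close>. To see that \<open>\<Sum> f(m) m = 0\<close> implies
  \<open>\<Sum> \<sigma>(f(m)) m = 0\<close>, apply an automorphism over \<open>M\<close> to the first relation and eliminate the
  coefficient at \<open>i\<close>: the result is a shorter relation, unless it is trivial. If it is always
  trivial, then all the quotients \<open>f(m)/f(i)\<close> lie in \<open>k\<close> and the two relations are proportional.\<close>

lemma extend_constants:
  assumes M: "subfld M" "K \<subseteq> M" "M \<inter> kb \<subseteq> k"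
    and \<sigma>: "hom_on kb \<sigma>" "\<And>x. x \<in> k \<Longrightarrow> \<sigma> x = x"
  obtains g where "g \<in> Aut M" "\<And>x. x \<in> kb \<Longrightarrow> g x = \<sigma> x"
proof -
  have tr: "(\<Sum>x\<in>I. \<sigma> (f x) * x) = 0"
    if "finite I" "I \<subseteq> M" "\<forall>x\<in>I. f x \<in> kb" "(\<Sum>x\<in>I. f x * x) = 0" for I f
  proof (rule relation_transfer[OF kb \<sigma>(1) _ that])
    fix I f assume I: "finite I" "I \<subseteq> M" "I \<noteq> {}" and f: "\<forall>x\<in>I. f x \<in> kb \<and> f x \<noteq> 0"
      and rel: "(\<Sum>x\<in>I. f x * x) = 0"
    obtain i where i: "i \<in> I" using I by blast
    show "(\<Sum>x\<in>I. \<sigma> (f x) * x) = 0 \<or> (\<exists>c. (\<forall>x\<in>I. c x \<in> kb) \<and> (\<Sum>x\<in>I. c x * x) = 0 \<and>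
        (\<exists>i\<in>I. c i = 0) \<and> (\<exists>j\<in>I. c j \<noteq> 0))"
    proof (cases "\<forall>g\<in>Aut M. \<forall>x\<in>I. g (f x) * f i = f x * g (f i)")
      case True
      have q: "f x / f i \<in> k" if "x \<in> I" for x
      proof (rule kb_moves[OF M])
        show "f x / f i \<in> kb" using f i that subfld_divide[OF kb] by blast
        show "g (f x / f i) = f x / f i" if "g \<in> Aut M" for g
        proof -
          have "g (f i) \<noteq> 0" using f i Aut_simps(1,12)[OF that] by metis
          then show ?thesis using True that \<open>x \<in> I\<close> f i by (simp add: Aut_simps(8)[OF that] field_simps)
        qed
      qed
      have "\<sigma> (f x) * x = \<sigma> (f i) / f i * (f x * x)" if "x \<in> I" for x
      proof -
        have "\<sigma> (f x / f i * f i) = f x / f i * \<sigma> (f i)"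
          using q[OF that] k_kb f i \<sigma>(2)[OF q[OF that]] by (subst hom_on_mult[OF kb \<sigma>(1)]) auto
        then show ?thesis using f i by (simp add: field_simps)
      qed
      then have "(\<Sum>x\<in>I. \<sigma> (f x) * x) = \<sigma> (f i) / f i * (\<Sum>x\<in>I. f x * x)"
        by (simp add: sum_distrib_left)
      then show ?thesis using rel by simp
    next
      case False
      then obtain g j where g: "g \<in> Aut M" and j: "j \<in> I" "g (f j) * f i \<noteq> f j * g (f i)" by blast
      define c where "c x = g (f x) * f i - f x * g (f i)" for x
      have gk: "g \<in> Aut k" using g Aut_mono[of k M] k_K M(2) by blast
      have "\<forall>x\<in>I. c x \<in> kb"
        using f i Aut_kb_closed[OF gk] by (auto simp: c_def intro!: subfld_diff[OF kb] subfld_mult[OF kb])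
      moreover have "(\<Sum>x\<in>I. c x * x) = 0"
      proof -
        have "(\<Sum>x\<in>I. g (f x) * x) = g (\<Sum>x\<in>I. f x * x)"
          unfolding Aut_simps(10)[OF g] using I(2) by (intro sum.cong) (auto simp: Aut_simps(4)[OF g] Aut_fixes[OF g])
        then have "(\<Sum>x\<in>I. g (f x) * x) = 0" using rel Aut_simps(1)[OF g] by simp
        moreover have "(\<Sum>x\<in>I. c x * x) = f i * (\<Sum>x\<in>I. g (f x) * x) - g (f i) * (\<Sum>x\<in>I. f x * x)"
          by (simp add: c_def sum_subtractf sum_distrib_left algebra_simps)
        ultimately show ?thesis using rel by simp
      qed
      moreover have "c i = 0" "c j \<noteq> 0" using j(2) by (auto simp: c_def)
      ultimately show ?thesis using i j(1) by blast
    qed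
  qed
  obtain \<phi> where \<phi>: "hom_on (lspan kb M) \<phi>" "\<And>a x. a \<in> kb \<Longrightarrow> x \<in> M \<Longrightarrow> \<phi> (a * x) = \<sigma> a * x"
    using lspan_hom[OF kb \<sigma>(1) subfld_1[OF M(1)] subfld_mult[OF M(1)], of "\<lambda>x. x"] tr by auto
  have \<phi>M: "\<phi> x = x" if "x \<in> M" for x
    using \<phi>(2)[OF subfld_1[OF kb] that] hom_on_1[OF kb \<sigma>(1)] by simp
  have \<phi>kb: "\<phi> x = \<sigma> x" if "x \<in> kb" for x
    using \<phi>(2)[OF that subfld_1[OF M(1)]] by simp
  note E = lspan_kb_subfld[OF M(1,2)]
  obtain g where g: "g \<in> Aut K" "\<And>a. a \<in> lspan kb M \<Longrightarrow> g a = \<phi> a"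
    using extend_to_Aut[OF E(1) _ \<phi>(1)] M(2) E(2) \<phi>M by (metis subset_iff)
  show thesis
  proof (rule that)
    show "g \<in> Aut M" using g E(2) \<phi>M by (auto simp: Aut_def)
    show "g x = \<sigma> x" if "x \<in> kb" for x using that g(2) E(3) \<phi>kb by auto
  qed
qed

text \<open>Descent one constant at a time: an element fixed by the stabilizer of \<open>e\<close> is a polynomial in
  \<open>e\<close> with coefficients fixed by the whole group.\<close>

lemma generated_by_fixed:
  assumes G: "G \<subseteq> Aut K" "(\<lambda>x. x) \<in> G" "\<And>g h. g \<in> G \<Longrightarrow> h \<in> G \<Longrightarrow> (\<lambda>x. g (h x)) \<in> G"
    "\<And>g. g \<in> G \<Longrightarrow> \<exists>g'\<in>G. \<forall>x. g' (g x) = x"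
    and es: "set es \<subseteq> kb" and x: "\<And>g. g \<in> G \<Longrightarrow> (\<forall>e\<in>set es. g e = e) \<Longrightarrow> g x = x"
  shows "x \<in> lspan kb (fixed G)"
  using assms
proof (induction es arbitrary: G x)
  case Nil
  then have "x \<in> fixed G" by (simp add: fixed_def)
  then show ?case using lspan_term[OF subfld_1[OF kb]] by fastforce
next
  case (Cons e es)
  define H where "H = {g \<in> G. g e = e}"
  have "x \<in> lspan kb (fixed H)"
  proof (rule Cons.IH)
    show "H \<subseteq> Aut K" "(\<lambda>x. x) \<in> H" "set es \<subseteq> kb" using Cons.prems by (auto simp: H_def)
    show "(\<lambda>x. g (h x)) \<in> H" if "g \<in> H" "h \<in> H" for g h using that Cons.prems(3) by (auto simp: H_def)
    show "\<exists>g'\<in>H. \<forall>x. g' (g x) = x" if gH: "g \<in> H" for g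
    proof -
      obtain g' where g': "g' \<in> G" "\<forall>x. g' (g x) = x" using Cons.prems(4)[of g] gH by (auto simp: H_def)
      have "g' e = e" using g'(2) gH by (metis (mono_tags, lifting) H_def mem_Collect_eq)
      then show ?thesis using g' by (auto simp: H_def)
    qed
    show "g x = x" if "g \<in> H" "\<forall>e\<in>set es. g e = e" for g
      using that Cons.prems(6) by (auto simp: H_def)
  qed
  have e: "e \<in> kb" using Cons.prems by simp
  have subf: "subfld (fixed G)" by (rule subfld_fixed[OF Cons.prems(1)])
  have GA: "G \<subseteq> Aut {}" using Cons.prems(1) Aut_mono[of "{}" K] by blast
  have Gk: "G \<subseteq> Aut k" using Cons.prems(1) Aut_K_k by blast
  have step: "y \<in> lspan kb (fixed G)" if y: "y \<in> fixed H" for y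
  proof -
    have fin: "finite {g e |g. g \<in> G}"
      by (rule finite_subset[OF _ finite_orbit[OF sep_imp_algebraic[OF kb_sep[OF e]]]]) (use Gk in auto)
    have det: "g y = h y" if gh: "g \<in> G" "h \<in> G" "g e = h e" for g h
    proof -
      obtain h' where h': "h' \<in> G" "\<forall>x. h' (h x) = x" using Cons.prems(4)[OF gh(2)] by blast
      have "(\<lambda>x. h' (g x)) \<in> H" using Cons.prems(3)[OF h'(1) gh(1)] gh(3) h'(2) by (simp add: H_def)
      then have "h' (g y) = y" using y by (auto simp: fixed_def)
      then have "h' (g y) = h' (h y)" using h'(2) by simp
      then show ?thesis using Aut_simps(12)[of h' "{}"] h'(1) GA by blast
    qed
    obtain q where q: "poly_in (fixed G \<inter> UNIV) q" "poly q e = y"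
    proof (rule fixed_interpolation[where G = G and x = y and e = e and B = UNIV])
      show "\<And>g h. g \<in> G \<Longrightarrow> h \<in> G \<Longrightarrow> (\<lambda>x. g (h x)) \<in> G" by (rule Cons.prems(3))
    qed (use GA Cons.prems(2) fin det subfld_UNIV that in auto)
    have "(\<Sum>i\<in>I. poly.coeff q i * e ^ i) \<in> lspan kb (fixed G)" for I
    proof (induction I rule: infinite_finite_induct)
      case (insert i I)
      have "e ^ i * poly.coeff q i \<in> lspan kb (fixed G)"
        by (rule lspan_term) (use e subfld_power[OF kb] q(1) in \<open>auto simp: poly_in_def\<close>)
      then show ?case using insert lspan_add[OF kb] by (simp add: mult.commute)
    qed (auto simp: lspan_0)
    then show ?thesis unfolding q(2)[symmetric] poly_altdef .
  qed
  have mult: "a * y \<in> lspan kb (fixed G)" if "a \<in> kb" "y \<in> lspan kb (fixed G)" for a y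
    using lspan_mult[OF kb subfld_mult[OF subf] lspan_term[OF that(1) subfld_1[OF subf]] that(2)] by simp
  from \<open>x \<in> lspan kb (fixed H)\<close> show ?case
    by (induction rule: lspan_induct) (auto intro: lspan_0 lspan_add[OF kb] mult step)
qed

end

section \<open>Kummer theory\<close>

lemma separable_binomial:
  fixes b :: "'o::field"
  assumes n: "of_nat n \<noteq> (0 :: 'o)" and b: "b \<noteq> 0"
  shows "coprime (Polynomial.monom 1 n - [:b:]) (pderiv (Polynomial.monom 1 n - [:b:]))"
proof (rule coprimeI)
  fix d assume d: "d dvd Polynomial.monom 1 n - [:b:]" "d dvd pderiv (Polynomial.monom 1 n - [:b:])"
  obtain m where m: "n = Suc m" using n by (cases n) auto
  have "pderiv (Polynomial.monom 1 n - [:b:]) = Polynomial.monom (of_nat n) m"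
    by (simp add: pderiv_diff pderiv_monom pderiv_pCons m)
  then have "[:0, 1:] * pderiv (Polynomial.monom 1 n - [:b:]) = Polynomial.monom (of_nat n) n"
    by (simp add: m monom_Suc)
  moreover have "Polynomial.smult (of_nat n) (Polynomial.monom 1 n - [:b:])
      = Polynomial.monom (of_nat n) n - [:of_nat n * b:]"
    by (simp add: smult_diff_right smult_monom)
  ultimately have "[:of_nat n * b:] = [:0, 1:] * pderiv (Polynomial.monom 1 n - [:b:])
      - Polynomial.smult (of_nat n) (Polynomial.monom 1 n - [:b:])" by simp
  then have "d dvd [:of_nat n * b:]"
    using d by (metis dvd_diff dvd_mult dvd_smult)
  moreover have "is_unit [:of_nat n * b:]" using n b by (simp add: is_unit_const_poly_iff dvd_field_iff)
  ultimately show "is_unit d" by (rule dvd_unit_imp_unit)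
qed

definition mgrp :: "'o::field set \<Rightarrow> bool" where
  "mgrp D \<longleftrightarrow> 1 \<in> D \<and> 0 \<notin> D \<and> (\<forall>x\<in>D. \<forall>y\<in>D. x * y \<in> D) \<and> (\<forall>x\<in>D. inverse x \<in> D)"

lemma mgrp_power: "mgrp D \<Longrightarrow> x \<in> D \<Longrightarrow> x ^ n \<in> D"
  by (induction n) (auto simp: mgrp_def)

lemma mgrp_divide: "mgrp D \<Longrightarrow> x \<in> D \<Longrightarrow> y \<in> D \<Longrightarrow> x / y \<in> D"
  by (auto simp: mgrp_def divide_inverse)

text \<open>A Galois equivariant splitting of the inclusion of \<open>kb\<^sup>\<star>\<close> into \<open>F\<^sup>\<star>\<close>. The automorphisms of
  \<open>F\<close> through its second factor are the restrictions of elements of \<open>Aut K\<close>.\<close>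

locale kummer_retraction = sep_tower k kb K F for k kb K F :: "'a::field set" +
  fixes r :: "'a \<Rightarrow> 'a"
  assumes r_mult: "\<And>x y. x \<in> F - {0} \<Longrightarrow> y \<in> F - {0} \<Longrightarrow> r (x * y) = r x * r y"
    and r_kb: "\<And>x. x \<in> kb - {0} \<Longrightarrow> r x = x"
    and r_range: "\<And>x. x \<in> F - {0} \<Longrightarrow> r x \<in> kb - {0}"
    and r_equivariant: "\<And>g x. g \<in> Aut K \<Longrightarrow> x \<in> F - {0} \<Longrightarrow> r (g x) = g (r x)"
begin

definition N :: "'a set" where
  "N = {x \<in> F - {0}. r x = 1}"

definition radicals :: "'a set" where
  "radicals = {y. y \<noteq> 0 \<and> (\<exists>n. of_nat n \<noteq> (0 :: 'a) \<and> y ^ n \<in> F)}"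

lemma mgrp_N: "mgrp N"
  unfolding mgrp_def
proof (intro conjI ballI)
  show "1 \<in> N" using r_kb[of 1] subfld_1[OF kb] subfld_1[OF F] by (simp add: N_def)
  show "0 \<notin> N" by (simp add: N_def)
  fix x assume x: "x \<in> N"
  show "x * y \<in> N" if "y \<in> N" for y
    using x that r_mult[of x y] subfld_mult[OF F] by (auto simp: N_def)
  have "r (x * inverse x) = r x * r (inverse x)"
    using x subfld_inverse[OF F] by (intro r_mult) (auto simp: N_def)
  then show "inverse x \<in> N"
    using x subfld_inverse[OF F, of x] r_kb[of 1] subfld_1[OF kb] by (auto simp: N_def)
qed

lemma N_kb: "N \<inter> kb \<subseteq> {1}"
  using r_kb by (auto simp: N_def)

lemma F_decomp:
  assumes "x \<in> F" "x \<noteq> 0"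
  obtains b where "b \<in> kb" "b \<noteq> 0" "x / b \<in> N"
proof -
  have b: "r x \<in> kb" "r x \<noteq> 0" using r_range assms by auto
  have bF: "r x \<in> F" using b kb_F by blast
  have q: "x / r x \<in> F - {0}" using assms b bF subfld_divide[OF F] by auto
  have "r (x / r x * r x) = r (x / r x) * r (r x)" using q b bF by (intro r_mult) auto
  then have "r (x / r x) = 1" using b r_kb[of "r x"] by simp
  then show thesis using b q by (intro that[of "r x"]) (auto simp: N_def)
qed

lemma Aut_N:
  assumes "g \<in> Aut K" "x \<in> N"
  shows "g x \<in> N"
proof -
  have "g x \<in> F" using Aut_F[OF assms(1)] assms(2) by (auto simp: N_def)
  moreover have "g x \<noteq> 0" using assms(2) Aut_simps(1,12)[OF assms(1)] by (auto simp: N_def) metis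
  ultimately show ?thesis
    using r_equivariant[OF assms(1), of x] assms(2) Aut_simps(2)[OF assms(1)] by (auto simp: N_def)
qed

lemma mgrp_radicals: "mgrp radicals"
  unfolding mgrp_def
proof (intro conjI ballI)
  show "1 \<in> radicals" using subfld_1[OF F] by (auto simp: radicals_def intro!: exI[of _ 1])
  show "0 \<notin> radicals" by (simp add: radicals_def)
  fix x assume "x \<in> radicals"
  then obtain n where x: "x \<noteq> 0" "of_nat n \<noteq> (0 :: 'a)" "x ^ n \<in> F" by (auto simp: radicals_def)
  then show "inverse x \<in> radicals"
    using subfld_inverse[OF F, of "x ^ n"] by (auto simp: radicals_def power_inverse)
  fix y assume "y \<in> radicals"
  then obtain m where y: "y \<noteq> 0" "of_nat m \<noteq> (0 :: 'a)" "y ^ m \<in> F" by (auto simp: radicals_def)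
  have "(x * y) ^ (n * m) = (x ^ n) ^ m * (y ^ m) ^ n"
    by (simp add: power_mult_distrib power_mult[symmetric] mult.commute)
  then have "(x * y) ^ (n * m) \<in> F" using x y by (simp add: subfld_mult[OF F] subfld_power[OF F])
  then show "x * y \<in> radicals"
    using x y by (auto simp: radicals_def intro!: exI[of _ "n * m"])
qed

lemma F_radicals: "x \<in> F \<Longrightarrow> x \<noteq> 0 \<Longrightarrow> x \<in> radicals"
  by (auto simp: radicals_def intro!: exI[of _ 1])

lemma kb_root:
  assumes "b \<in> kb" "b \<noteq> 0" "of_nat n \<noteq> (0 :: 'a)" "x ^ n = b"
  shows "x \<in> kb"
proof (rule separable_roots_in[OF kb kb_closed _ separable_binomial[OF assms(3,2)]])
  show "poly_in kb (Polynomial.monom 1 n - [:b:])"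
    using assms(1) by (intro poly_in_diff[OF kb] poly_in_monom[OF kb] poly_in_const[OF kb] subfld_1[OF kb])
  show "poly (Polynomial.monom 1 n - [:b:]) x = 0" using assms(4) by (simp add: poly_monom)
qed

lemma ex_root:
  fixes b :: 'a
  assumes "b \<noteq> 0" "of_nat n \<noteq> (0 :: 'a)"
  obtains x where "x ^ n = b"
proof -
  have "n > 0" using assms(2) by (cases n) auto
  then have "degree (Polynomial.monom 1 n - [:b:]) > 0"
    using le_degree[of "Polynomial.monom 1 n - [:b:]" n] by (cases n) auto
  then obtain x where "poly (Polynomial.monom 1 n - [:b:]) x = 0"
    using closed separable_binomial[OF assms(2,1)] by (auto simp: sep_closed_def poly_in_def)
  then show thesis by (intro that[of x]) (simp add: poly_monom)
qed

definition partial_complement :: "'a set \<Rightarrow> bool" where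
  "partial_complement D \<longleftrightarrow> mgrp D \<and> N \<subseteq> D \<and> D \<subseteq> radicals \<and> D \<inter> kb \<subseteq> {1}"

text \<open>A maximal \<open>D\<close> is a full complement. Given a radical \<open>y\<close>, let \<open>n\<close> be its order modulo \<open>D kb\<^sup>\<star>\<close>. It
  is invertible in the field, so \<open>y\<close> can be divided by an \<open>n\<close>-th root of a constant to achieve
  \<open>y\<^sup>n \<in> D\<close>; then the group generated by \<open>D\<close> and \<open>y\<close> still meets \<open>kb\<close> trivially.\<close>

lemma exists_complement:
  obtains D where "partial_complement D" "\<And>y. y \<in> radicals \<Longrightarrow> \<exists>d\<in>D. \<exists>b\<in>kb. y = d * b"
proof -
  have "\<exists>M\<in>Collect partial_complement. \<forall>W\<in>Collect partial_complement. M \<subseteq> W \<longrightarrow> W = M"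
  proof (rule subset_Zorn_nonempty)
    have "N \<subseteq> radicals" using F_radicals by (auto simp: N_def)
    then show "Collect partial_complement \<noteq> {}" using mgrp_N N_kb by (auto simp: partial_complement_def)
    fix C assume C: "C \<noteq> {}" "subset.chain (Collect partial_complement) C"
    then have Cg: "\<And>G. G \<in> C \<Longrightarrow> partial_complement G" and tot: "\<And>G H. G \<in> C \<Longrightarrow> H \<in> C \<Longrightarrow> G \<subseteq> H \<or> H \<subseteq> G"
      by (auto simp: subset_chain_def)
    have mult: "u * v \<in> \<Union>C" if uv: "u \<in> \<Union>C" "v \<in> \<Union>C" for u v
    proof -
      obtain G H where GH: "G \<in> C" "H \<in> C" "u \<in> G" "v \<in> H" using uv by blast
      have cl: "x * y \<in> W" if "W \<in> C" "x \<in> W" "y \<in> W" for x y W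
        using Cg[OF that(1)] that(2,3) by (simp add: partial_complement_def mgrp_def)
      from tot[OF GH(1,2)] have "u * v \<in> H \<or> u * v \<in> G"
        using cl[OF GH(1), of u v] cl[OF GH(2), of u v] GH(3,4) by (auto simp: subset_iff)
      then show ?thesis using GH(1,2) by blast
    qed
    have "mgrp (\<Union>C)"
      unfolding mgrp_def
    proof (intro conjI ballI)
      show "1 \<in> \<Union>C" "0 \<notin> \<Union>C" using C(1) Cg by (auto simp: partial_complement_def mgrp_def)
      fix u assume "u \<in> \<Union>C"
      then obtain W where "W \<in> C" "u \<in> W" by blast
      then have "inverse u \<in> W" using Cg by (simp add: partial_complement_def mgrp_def)
      then show "inverse u \<in> \<Union>C" using \<open>W \<in> C\<close> by blast
    next
      show "u * v \<in> \<Union>C" if "u \<in> \<Union>C" "v \<in> \<Union>C" for u v using that by (rule mult)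
    qed
    moreover have "N \<subseteq> \<Union>C" "\<Union>C \<subseteq> radicals" "\<Union>C \<inter> kb \<subseteq> {1}"
      using C(1) Cg unfolding partial_complement_def by (blast, blast, blast)
    ultimately show "\<Union>C \<in> Collect partial_complement" by (simp add: partial_complement_def)
  qed
  then obtain D where D: "partial_complement D" "\<And>W. partial_complement W \<Longrightarrow> D \<subseteq> W \<Longrightarrow> W = D" by blast
  have mD: "mgrp D" and ND: "N \<subseteq> D" and DR: "D \<subseteq> radicals" and Dkb: "D \<inter> kb \<subseteq> {1}"
    using D(1) by (auto simp: partial_complement_def)
  define P where "P = {d * b |d b. d \<in> D \<and> b \<in> kb \<and> b \<noteq> 0}"
  have mP: "mgrp P"
    unfolding mgrp_def
  proof (intro conjI ballI)
    show "1 \<in> P" using mD subfld_1[OF kb] by (force simp: P_def mgrp_def)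
    show "0 \<notin> P" using mD by (auto simp: P_def mgrp_def)
    fix x assume "x \<in> P"
    then obtain d b where x: "x = d * b" "d \<in> D" "b \<in> kb" "b \<noteq> 0" by (auto simp: P_def)
    then have "inverse x = inverse d * inverse b" "inverse d \<in> D" "inverse b \<in> kb" "inverse b \<noteq> 0"
      using mD subfld_inverse[OF kb] by (auto simp: mgrp_def)
    then show "inverse x \<in> P" unfolding P_def by blast
    fix y assume "y \<in> P"
    then obtain d' b' where y: "y = d' * b'" "d' \<in> D" "b' \<in> kb" "b' \<noteq> 0" by (auto simp: P_def)
    have "x * y = (d * d') * (b * b')" "d * d' \<in> D" "b * b' \<in> kb" "b * b' \<noteq> 0"
      using x y mD subfld_mult[OF kb] by (auto simp: mgrp_def)
    then show "x * y \<in> P" unfolding P_def by blast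
  qed
  have FP: "x \<in> P" if x: "x \<in> F" "x \<noteq> 0" for x
  proof -
    obtain b where b: "b \<in> kb" "b \<noteq> 0" "x / b \<in> N" using F_decomp[OF x] .
    then have "x = (x / b) * b" "x / b \<in> D" using ND by auto
    then show ?thesis using b unfolding P_def by blast
  qed
  have "\<exists>d\<in>D. \<exists>b\<in>kb. y = d * b" if y: "y \<in> radicals" for y
  proof -
    obtain n0 where n0: "y \<noteq> 0" "of_nat n0 \<noteq> (0 :: 'a)" "y ^ n0 \<in> F" using y by (auto simp: radicals_def)
    have "n0 > 0 \<and> y ^ n0 \<in> P" using n0 FP by (cases n0) auto
    define n where "n = (LEAST n. n > 0 \<and> y ^ n \<in> P)"
    have n: "n > 0" "y ^ n \<in> P"
      using LeastI[of "\<lambda>n. n > 0 \<and> y ^ n \<in> P", OF \<open>n0 > 0 \<and> y ^ n0 \<in> P\<close>] by (auto simp: n_def)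
    have ndvd: "n dvd m" if "y ^ m \<in> P" for m
    proof -
      have "y ^ m = (y ^ n) ^ (m div n) * y ^ (m mod n)"
        by (simp flip: power_mult power_add)
      then have "y ^ (m mod n) = y ^ m / (y ^ n) ^ (m div n)" using n0(1) by simp
      also have "\<dots> \<in> P" by (rule mgrp_divide[OF mP that mgrp_power[OF mP n(2)]])
      finally have "y ^ (m mod n) \<in> P" .
      then have "m mod n = 0"
        using not_less_Least[of "m mod n" "\<lambda>n. n > 0 \<and> y ^ n \<in> P"] mod_less_divisor[OF n(1), of m]
        unfolding n_def[symmetric] by simp
      then show ?thesis by auto
    qed
    have "n dvd n0" using ndvd \<open>n0 > 0 \<and> y ^ n0 \<in> P\<close> by blast
    then have nz: "of_nat n \<noteq> (0 :: 'a)" using n0(2) by (auto elim!: dvdE)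
    obtain d b where db: "d \<in> D" "b \<in> kb" "b \<noteq> 0" "y ^ n = d * b" using n(2) by (auto simp: P_def)
    obtain \<beta> where \<beta>: "\<beta> ^ n = b" using ex_root[OF db(3) nz] .
    then have \<beta>kb: "\<beta> \<in> kb" "\<beta> \<noteq> 0" using kb_root[OF db(2,3) nz] db(3) n(1) by auto
    define z where "z = y / \<beta>"
    have z: "z ^ n = d" "z \<noteq> 0" using db(4) \<beta> db(3) n0(1) \<beta>kb by (auto simp: z_def power_divide)
    define D' where "D' = {e * z ^ i |e i. e \<in> D}"
    have zR: "z \<in> radicals"
      unfolding z_def using y F_radicals[of \<beta>] \<beta>kb kb_F by (intro mgrp_divide mgrp_radicals) auto
    have D0: "0 \<notin> D" and D1: "1 \<in> D" and Dm: "\<And>x y. x \<in> D \<Longrightarrow> y \<in> D \<Longrightarrow> x * y \<in> D"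
      and Di: "\<And>x. x \<in> D \<Longrightarrow> inverse x \<in> D" using mD by (auto simp: mgrp_def)
    have "mgrp D'"
      unfolding mgrp_def
    proof (intro conjI ballI)
      show "1 \<in> D'" unfolding D'_def using D1 by (intro CollectI exI[of _ 1] exI[of _ 0]) simp
      show "0 \<notin> D'" using D0 z(2) by (auto simp: D'_def)
      fix x assume "x \<in> D'"
      then obtain e i where x: "x = e * z ^ i" "e \<in> D" by (auto simp: D'_def)
      have "z ^ ((n - 1) * i) * z ^ i = d ^ i"
        using n(1) z(1) by (simp flip: power_add power_mult add: mult.commute[of _ i] diff_mult_distrib2)
          (simp add: power_mult mult.commute[of i])
      then have "inverse (z ^ i) = inverse d ^ i * z ^ ((n - 1) * i)"
        using z D0 db(1) by (auto simp: field_simps power_inverse)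
      then have "inverse x = (inverse e * inverse d ^ i) * z ^ ((n - 1) * i)" by (simp add: x(1))
      moreover have "inverse e * inverse d ^ i \<in> D" using x(2) db(1) Dm Di mgrp_power[OF mD] by blast
      ultimately show "inverse x \<in> D'" unfolding D'_def by blast
      fix y assume "y \<in> D'"
      then obtain e' j where y: "y = e' * z ^ j" "e' \<in> D" by (auto simp: D'_def)
      have "x * y = (e * e') * z ^ (i + j)" by (simp add: x y power_add)
      then show "x * y \<in> D'" unfolding D'_def using Dm[OF x(2) y(2)] by blast
    qed
    moreover have DD: "D \<subseteq> D'"
    proof
      fix e assume "e \<in> D"
      then show "e \<in> D'" unfolding D'_def by (intro CollectI exI[of _ e] exI[of _ 0]) simp
    qed
    moreover have "D' \<subseteq> radicals"
      using DR zR mgrp_radicals mgrp_power[OF mgrp_radicals zR] by (auto simp: D'_def mgrp_def)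
    moreover have "D' \<inter> kb \<subseteq> {1}"
    proof
      fix c assume c: "c \<in> D' \<inter> kb"
      then obtain e i where e: "c = e * z ^ i" "e \<in> D" by (auto simp: D'_def)
      have "e \<noteq> 0" using e(2) D0 by auto
      then have "y ^ i = inverse e * (c * \<beta> ^ i)" using \<beta>kb by (simp add: e(1) z_def power_divide)
      moreover have "c * \<beta> ^ i \<in> kb" "c * \<beta> ^ i \<noteq> 0"
        using c \<beta>kb e(1) z(2) \<open>e \<noteq> 0\<close> subfld_mult[OF kb] subfld_power[OF kb] by auto
      ultimately have "y ^ i \<in> P" using Di[OF e(2)] unfolding P_def by blast
      then obtain j where "i = n * j" using ndvd by (auto elim: dvdE)
      then have "z ^ i = d ^ j" by (simp add: power_mult z(1))
      then have "c \<in> D" using e db(1) Dm mgrp_power[OF mD] by simp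
      then show "c \<in> {1}" using c Dkb by blast
    qed
    ultimately have "partial_complement D'" using ND by (auto simp: partial_complement_def)
    then have "D' = D" using D(2) DD by blast
    moreover have "z \<in> D'" unfolding D'_def using D1 by (intro CollectI exI[of _ 1] exI[of _ 1]) simp
    ultimately have "z \<in> D" "y = z * \<beta>" using \<beta>kb by (auto simp: z_def)
    then show ?thesis using \<beta>kb by blast
  qed
  then show thesis using that D(1) by blast
qed

context
  fixes D assumes D: "partial_complement D" and decomp: "\<And>y. y \<in> radicals \<Longrightarrow> \<exists>d\<in>D. \<exists>b\<in>kb. y = d * b"
begin

lemma mgrp_D: "mgrp D" and N_D: "N \<subseteq> D" and D_radicals: "D \<subseteq> radicals" and D_kb: "D \<inter> kb \<subseteq> {1}"
  using D by (auto simp: partial_complement_def)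

lemma D_nz: "d \<in> D \<Longrightarrow> d \<noteq> 0" and D_1: "1 \<in> D" and D_mult: "x \<in> D \<Longrightarrow> y \<in> D \<Longrightarrow> x * y \<in> D"
  and D_inverse: "x \<in> D \<Longrightarrow> inverse x \<in> D"
  using mgrp_D by (auto simp: mgrp_def)

lemma D_unique:
  assumes "d \<in> D" "d' \<in> D" "b \<in> kb" "b' \<in> kb" "b \<noteq> 0" "d * b = d' * b'"
  shows "d = d'"
proof -
  have "d' \<noteq> 0" "b' \<noteq> 0" using D_nz assms by auto
  then have "d / d' = b' / b" using assms(5,6) by (simp add: field_simps)
  moreover have "d / d' \<in> D" "b' / b \<in> kb" using assms by (auto intro: mgrp_divide[OF mgrp_D] subfld_divide[OF kb])
  ultimately have "d / d' \<in> D \<inter> kb" by simp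
  then have "d / d' = 1" using D_kb by blast
  then show ?thesis using \<open>d' \<noteq> 0\<close> by simp
qed

text \<open>Since \<open>F\<^sup>\<star> = kb\<^sup>\<star> N\<close> and \<open>N \<subseteq> D\<close>, the group \<open>D\<close> adds nothing to \<open>N\<close> inside of \<open>F\<close>.\<close>

lemma D_F: "d \<in> D \<Longrightarrow> d \<in> F \<Longrightarrow> d \<in> N"
proof -
  assume d: "d \<in> D" "d \<in> F"
  obtain b where b: "b \<in> kb" "b \<noteq> 0" "d / b \<in> N" using F_decomp[OF d(2) D_nz[OF d(1)]] .
  have "d * 1 = (d / b) * b" using b by simp
  then have "d = d / b" using D_unique[of d "d / b" 1 b] d b N_D subfld_1[OF kb] by auto
  then show ?thesis using b by simp
qed

lemma Aut_radicals:
  assumes "g \<in> Aut K" "y \<in> radicals"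
  shows "g y \<in> radicals"
proof -
  obtain n where n: "y \<noteq> 0" "of_nat n \<noteq> (0 :: 'a)" "y ^ n \<in> F" using assms(2) by (auto simp: radicals_def)
  have "g y ^ n \<in> F" using Aut_F[OF assms(1)] n(3) by (metis Aut_simps(9)[OF assms(1)] imageI)
  moreover have "g y \<noteq> 0" using n(1) Aut_simps(1,12)[OF assms(1)] by metis
  ultimately show ?thesis using n by (auto simp: radicals_def)
qed

text \<open>The Kummer character of a radical takes values in roots of unity, which are constants.\<close>

lemma radical_character:
  assumes "g \<in> Aut F" "d \<in> radicals"
  shows "g d / d \<in> kb" "g d / d \<noteq> 0"
proof -
  obtain n where n: "d \<noteq> 0" "of_nat n \<noteq> (0 :: 'a)" "d ^ n \<in> F" using assms(2) by (auto simp: radicals_def)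
  have "g d ^ n = d ^ n" using Aut_fixes[OF assms(1) n(3)] by (simp add: Aut_simps(9)[OF assms(1)])
  then have "(g d / d) ^ n = 1" using n by (simp add: power_divide)
  then show "g d / d \<in> kb" using kb_root[of 1 n] n subfld_1[OF kb] by simp
  show "g d / d \<noteq> 0" using n Aut_simps(1,12)[OF assms(1)] by (metis divide_eq_0_iff)
qed

text \<open>Let \<open>\<delta>(d)\<close> be the component of \<open>g0(d)\<close> in \<open>D\<close> with respect to the decomposition of the radicals as
  \<open>D kb\<^sup>\<star>\<close>. The new automorphism is \<open>g0\<close> on \<open>F\<close> and \<open>\<delta>\<close> on \<open>D\<close>. That these fit together is Kummer theory:
  elements of \<open>D\<close> in different cosets of \<open>F\<^sup>\<star>\<close> have different Kummer characters, hence satisfy no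
  relation over \<open>F\<close>, while within one coset \<open>\<delta>\<close> agrees with \<open>g0\<close> up to a common factor.\<close>

lemma lift_preserving_complement:
  assumes g0: "g0 \<in> Aut K"
  obtains g where "g \<in> Aut K" "\<And>x. x \<in> kb \<Longrightarrow> g x = g0 x" "g ` D = D"
proof -
  define \<delta> where "\<delta> d = (SOME e. e \<in> D \<and> (\<exists>b\<in>kb. b \<noteq> 0 \<and> g0 d = e * b))" for d
  have \<delta>ex: "\<exists>e. e \<in> D \<and> (\<exists>b\<in>kb. b \<noteq> 0 \<and> g0 d = e * b)" if "d \<in> D" for d
  proof -
    have R: "g0 d \<in> radicals" using Aut_radicals[OF g0] D_radicals that by blast
    then have "g0 d \<noteq> 0" by (simp add: radicals_def)
    then show ?thesis using decomp[OF R] by (metis mult_zero_right)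
  qed
  have \<delta>: "\<delta> d \<in> D" "\<exists>b\<in>kb. b \<noteq> 0 \<and> g0 d = \<delta> d * b" if "d \<in> D" for d
    using someI_ex[OF \<delta>ex[OF that]] unfolding \<delta>_def by blast+
  have \<delta>eq: "\<delta> d = e" if "d \<in> D" "e \<in> D" "b \<in> kb" "b \<noteq> 0" "g0 d = e * b" for d e b
    using \<delta>[OF that(1)] D_unique that by metis
  have \<delta>N: "\<delta> d = g0 d" if "d \<in> N" for d
    using \<delta>eq[of d "g0 d" 1] that N_D Aut_N[OF g0 that] subfld_1[OF kb] by auto
  have \<delta>mult: "\<delta> (d * e) = \<delta> d * \<delta> e" if de: "d \<in> D" "e \<in> D" for d e
  proof -
    obtain b c where "b \<in> kb" "b \<noteq> 0" "g0 d = \<delta> d * b" "c \<in> kb" "c \<noteq> 0" "g0 e = \<delta> e * c"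
      using \<delta>(2) de by metis
    then show ?thesis
      using de \<delta>(1) by (intro \<delta>eq[of _ _ "b * c"]) (auto simp: D_mult Aut_simps(4)[OF g0] subfld_mult[OF kb])
  qed
  have hF: "hom_on F g0" using Aut_hom[OF g0] hom_on_mono by blast
  have one: "\<delta> 1 = 1" using \<delta>N[of 1] mgrp_N Aut_simps(2)[OF g0] by (simp add: mgrp_def)
  have tr: "(\<Sum>x\<in>I. g0 (f x) * \<delta> x) = 0"
    if "finite I" "I \<subseteq> D" "\<forall>x\<in>I. f x \<in> F" "(\<Sum>x\<in>I. f x * x) = 0" for I f
  proof (rule relation_transfer[OF F hF _ that])
    fix I f assume I: "finite I" "I \<subseteq> D" "I \<noteq> {}" and f: "\<forall>x\<in>I. f x \<in> F \<and> f x \<noteq> 0"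
      and rel: "(\<Sum>x\<in>I. f x * x) = 0"
    obtain i where i: "i \<in> I" using I by blast
    then have iD: "i \<in> D" "i \<noteq> 0" using I(2) D_nz by auto
    show "(\<Sum>x\<in>I. g0 (f x) * \<delta> x) = 0 \<or> (\<exists>c. (\<forall>x\<in>I. c x \<in> F) \<and> (\<Sum>x\<in>I. c x * x) = 0 \<and>
        (\<exists>i\<in>I. c i = 0) \<and> (\<exists>j\<in>I. c j \<noteq> 0))"
    proof (cases "\<forall>g\<in>Aut F. \<forall>x\<in>I. g x / x = g i / i")
      case True
      \<comment> \<open>All terms lie in one coset of \<open>F\<close>, hence of \<open>N\<close>, where \<open>\<delta>\<close> agrees with \<open>g0\<close>.\<close>
      have q: "x / i \<in> N" if x: "x \<in> I" for x
      proof -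
        have xD: "x \<in> D" using x I(2) by blast
        have "x / i \<in> F"
        proof (rule ccontr)
          assume "x / i \<notin> F"
          then obtain g where g: "g \<in> Aut F" "g (x / i) \<noteq> x / i"
            using Aut_moves[OF F K_F _ F_sep] by metis
          have "g i \<noteq> 0" using iD(2) Aut_simps(1,12)[OF g(1)] by metis
          have "g x / x = g i / i" using True g(1) x by blast
          then show False using g(2) D_nz[OF xD] iD(2) \<open>g i \<noteq> 0\<close>
            by (simp add: Aut_simps(8)[OF g(1)] field_simps)
        qed
        then show ?thesis using D_F[OF mgrp_divide[OF mgrp_D xD iD(1)]] by blast
      qed
      have eq: "g0 (f x) * \<delta> x = g0 (f x * (x / i)) * \<delta> i" if "x \<in> I" for x
      proof -
        have "\<delta> (x / i * i) = g0 (x / i) * \<delta> i"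
          using \<delta>mult[of "x / i" i] \<delta>N[OF q[OF that]] q[OF that] N_D iD(1) by auto
        then have "\<delta> x = g0 (x / i) * \<delta> i" using iD(2) by simp
        then show ?thesis by (simp only: Aut_simps(4)[OF g0] mult.assoc)
      qed
      have "(\<Sum>x\<in>I. g0 (f x) * \<delta> x) = (\<Sum>x\<in>I. g0 (f x * (x / i)) * \<delta> i)"
        by (intro sum.cong refl eq)
      also have "\<dots> = g0 (\<Sum>x\<in>I. f x * (x / i)) * \<delta> i"
        by (simp add: Aut_simps(10)[OF g0] sum_distrib_right)
      also have "(\<Sum>x\<in>I. f x * (x / i)) = (\<Sum>x\<in>I. f x * x) / i" by (simp add: sum_divide_distrib)
      finally show ?thesis using rel Aut_simps(1)[OF g0] by simp
    next
      case False
      then obtain g j where g: "g \<in> Aut F" and j: "j \<in> I" "g j / j \<noteq> g i / i" by blast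
      define c where "c x = f x * (g x / x - g i / i)" for x
      have char: "g x / x \<in> F" if "x \<in> I" for x
        using radical_character[OF g, of x] that I(2) D_radicals kb_F by blast
      have "\<forall>x\<in>I. c x \<in> F"
        using f i char by (auto simp: c_def intro!: subfld_diff[OF F] subfld_mult[OF F])
      moreover have "(\<Sum>x\<in>I. c x * x) = 0"
      proof -
        have "g (\<Sum>x\<in>I. f x * x) = (\<Sum>x\<in>I. f x * g x)"
          unfolding Aut_simps(10)[OF g] using f by (intro sum.cong) (auto simp: Aut_simps(4)[OF g] Aut_fixes[OF g])
        then have 0: "(\<Sum>x\<in>I. f x * g x) = 0" using rel Aut_simps(1)[OF g] by simp
        have "(\<Sum>x\<in>I. c x * x) = (\<Sum>x\<in>I. f x * g x - g i / i * (f x * x))"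
        proof (rule sum.cong)
          fix x assume "x \<in> I"
          then have "x \<noteq> 0" using D_nz I(2) by blast
          then show "c x * x = f x * g x - g i / i * (f x * x)" by (simp add: c_def algebra_simps)
        qed simp
        also have "\<dots> = (\<Sum>x\<in>I. f x * g x) - g i / i * (\<Sum>x\<in>I. f x * x)"
          by (simp add: sum_subtractf sum_distrib_left)
        finally show ?thesis using rel 0 by simp
      qed
      moreover have "c i = 0" "c j \<noteq> 0" using j f by (auto simp: c_def)
      ultimately show ?thesis using i j(1) by blast
    qed
  qed
  obtain \<phi> where \<phi>: "hom_on (lspan F D) \<phi>" "\<And>a x. a \<in> F \<Longrightarrow> x \<in> D \<Longrightarrow> \<phi> (a * x) = g0 a * \<delta> x"
    using lspan_hom[OF F hF D_1 D_mult one \<delta>mult] tr by blast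
  have \<phi>F: "\<phi> x = g0 x" if "x \<in> F" for x using \<phi>(2)[OF that D_1] one by simp
  have \<phi>D: "\<phi> x = \<delta> x" if "x \<in> D" for x
    using \<phi>(2)[OF subfld_1[OF F] that] Aut_simps(2)[OF g0] by simp
  have sub: "F \<subseteq> lspan F D" "D \<subseteq> lspan F D"
    using lspan_term[of _ F 1 D] lspan_term[of 1 F _ D] D_1 subfld_1[OF F] by force+
  have E: "subfld (lspan F D)"
  proof (rule alg_subring_subfld[OF F sub(1)])
    show "algebraic_over F x" for x by (rule sep_imp_algebraic[OF F_sep])
    show "x - y \<in> lspan F D" if "x \<in> lspan F D" "y \<in> lspan F D" for x y
      using lspan_add[OF F that(1) lspan_uminus[OF F that(2)]] by simp
    show "x * y \<in> lspan F D" if "x \<in> lspan F D" "y \<in> lspan F D" for x y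
      using lspan_mult[OF F D_mult that] by blast
  qed
  have "\<phi> x = x" if "x \<in> K" for x using \<phi>F that K_F Aut_fixes[OF g0 that] by auto
  then obtain g where g: "g \<in> Aut K" "\<And>a. a \<in> lspan F D \<Longrightarrow> g a = \<phi> a"
    using extend_to_Aut[OF E _ \<phi>(1)] K_F sub(1) by (metis subset_trans)
  have gD: "g d = \<delta> d" if "d \<in> D" for d using g(2) \<phi>D sub(2) that by auto
  show thesis
  proof (rule that)
    show "g \<in> Aut K" by fact
    show "g x = g0 x" if "x \<in> kb" for x
    proof -
      have "x \<in> F" using that kb_F by blast
      then show ?thesis using g(2)[of x] \<phi>F[of x] sub(1) by auto
    qed
    show "g ` D = D"
    proof
      show "g ` D \<subseteq> D" using gD \<delta>(1) by auto
      show "D \<subseteq> g ` D"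
      proof
        fix d assume d: "d \<in> D"
        obtain g0' where g0': "g0' \<in> Aut K" "\<And>x. g0 (g0' x) = x" using Aut_inverse[OF g0] by metis
        have R: "g0' d \<in> radicals" using Aut_radicals[OF g0'(1)] D_radicals d by blast
        then obtain e b where e: "e \<in> D" "b \<in> kb" "g0' d = e * b" using decomp by blast
        have b0: "b \<noteq> 0" using R e(3) by (auto simp: radicals_def)
        have b: "g0 b \<in> kb" "g0 b \<noteq> 0"
          using Aut_kb[OF g0] e(2) b0 Aut_simps(1,12)[OF g0] by (blast, metis)
        have "d = g0 e * g0 b" using g0'(2)[of d] e(3) by (simp add: Aut_simps(4)[OF g0])
        then have "g0 e = d * inverse (g0 b)" using b by (simp add: field_simps)
        then have "\<delta> e = d" using b d e(1) subfld_inverse[OF kb] by (intro \<delta>eq[of _ _ "inverse (g0 b)"]) auto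
        then show "d \<in> g ` D" using gD e(1) by force
      qed
    qed
  qed
qed

end

text \<open>\<open>M\<close> is the field fixed by the automorphisms that preserve \<open>D\<close>. These induce all automorphisms
  of \<open>kb/k\<close>, hence \<open>M \<inter> kb = k\<close>. An element \<open>d\<close> of \<open>D\<close> is fixed as soon as the finitely many constants
  that occur in the power \<open>d\<^sup>n \<in> F\<close> are, because \<open>D\<close> contains no root of unity other than 1.\<close>

lemma kummer_complement:
  obtains M where "subfld M" "K \<subseteq> M" "M \<inter> kb \<subseteq> k" "radicals \<subseteq> lspan kb M"
proof -
  obtain D where D: "partial_complement D" and decomp: "\<And>y. y \<in> radicals \<Longrightarrow> \<exists>d\<in>D. \<exists>b\<in>kb. y = d * b"
    using exists_complement by metis
  define G where "G = {g \<in> Aut K. g ` D = D}"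
  have G: "G \<subseteq> Aut K" by (auto simp: G_def)
  have Gid: "(\<lambda>x. x) \<in> G" using Aut_id by (auto simp: G_def)
  have Gcomp: "(\<lambda>x. g (h x)) \<in> G" if "g \<in> G" "h \<in> G" for g h
    using that Aut_comp[of g K h] image_image[of g h D] by (auto simp: G_def)
  have Ginv: "\<exists>g'\<in>G. \<forall>x. g' (g x) = x" if gG: "g \<in> G" for g
  proof -
    have gA: "g \<in> Aut K" using gG G by blast
    obtain g' where g': "g' \<in> Aut K" "\<And>x. g' (g x) = x" using Aut_inverse[OF gA] by metis
    have "g' ` (g ` D) = D" using g'(2) by (simp add: image_image)
    then have "g' \<in> G" using gG g'(1) by (simp add: G_def)
    then show ?thesis using g'(2) by blast
  qed
  have subf: "subfld (fixed G)" by (rule subfld_fixed[OF G])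
  show thesis
  proof (rule that[of "fixed G"])
    show "subfld (fixed G)" by fact
    show "K \<subseteq> fixed G" using G by (auto simp: fixed_def Aut_def)
    show "fixed G \<inter> kb \<subseteq> k"
    proof
      fix x assume x: "x \<in> fixed G \<inter> kb"
      show "x \<in> k"
      proof (rule kb_moves[OF K _ K_kb])
        fix g0 assume "g0 \<in> Aut K"
        then obtain g where "g \<in> Aut K" "\<And>x. x \<in> kb \<Longrightarrow> g x = g0 x" "g ` D = D"
          using lift_preserving_complement[OF D decomp] by metis
        then show "g0 x = x" using x by (auto simp: G_def fixed_def)
      qed (use x in auto)
    qed
    have DE: "d \<in> lspan kb (fixed G)" if d: "d \<in> D" for d
    proof -
      have "d \<in> radicals" using D d by (auto simp: partial_complement_def)
      then obtain n where n: "d \<noteq> 0" "of_nat n \<noteq> (0 :: 'a)" "d ^ n \<in> F" by (auto simp: radicals_def)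
      obtain I f where If: "finite I" "I \<subseteq> K" "\<forall>x\<in>I. f x \<in> kb" "d ^ n = (\<Sum>x\<in>I. f x * x)"
        using n(3) unfolding F_eq lspan_def by blast
      obtain es where es: "set es = f ` I" using finite_list[OF finite_imageI[OF If(1)]] by metis
      show ?thesis
      proof (rule generated_by_fixed[where es = es])
        show "(\<lambda>x. g (h x)) \<in> G" if "g \<in> G" "h \<in> G" for g h using that by (rule Gcomp)
        show "\<exists>g'\<in>G. \<forall>x. g' (g x) = x" if "g \<in> G" for g using that by (rule Ginv)
        show "G \<subseteq> Aut K" "(\<lambda>x. x) \<in> G" by fact+
        show "set es \<subseteq> kb" using es If(3) by auto
        fix g assume g: "g \<in> G" "\<forall>e\<in>set es. g e = e"
        then have gA: "g \<in> Aut K" using G by blast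
        have "g (d ^ n) = d ^ n"
          unfolding If(4) Aut_simps(10)[OF gA]
          by (intro sum.cong) (use g(2) es If(2) gA in \<open>auto simp: Aut_simps(4)[OF gA] Aut_def\<close>)
        then have "(g d / d) ^ n = 1" using n by (simp add: Aut_simps(9)[OF gA] power_divide)
        then have "g d / d \<in> kb" using kb_root[of 1 n] n subfld_1[OF kb] by simp
        moreover have "g d / d \<in> D" using g(1) d D by (auto simp: G_def partial_complement_def intro: mgrp_divide)
        ultimately have "g d / d = 1" using D by (auto simp: partial_complement_def)
        then show "g d = d" using n(1) by simp
      qed
    qed
    show "radicals \<subseteq> lspan kb (fixed G)"
    proof
      fix y assume "y \<in> radicals"
      then obtain d b where db: "d \<in> D" "b \<in> kb" "y = d * b" using decomp by metis
      then have "y = b * d" by simp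
      then show "y \<in> lspan kb (fixed G)"
        using lspan_mult[OF kb subfld_mult[OF subf] lspan_term[OF db(2) subfld_1[OF subf]] DE[OF db(1)]] by simp
    qed
  qed
qed

end

section \<open>Artin-Schreier theory\<close>

lemma linear_dependence:
  assumes A: "subfld A" and "finite J" "card J > d"
    and "\<And>j. j \<in> J \<Longrightarrow> poly_in A (q j)" "\<And>j i. j \<in> J \<Longrightarrow> i \<ge> d \<Longrightarrow> poly.coeff (q j) i = 0"
  shows "\<exists>c. (\<forall>j\<in>J. c j \<in> A) \<and> (\<exists>j\<in>J. c j \<noteq> 0) \<and> (\<Sum>j\<in>J. Polynomial.smult (c j) (q j)) = 0"
  using assms(2-)
proof (induction d arbitrary: J q)
  case 0
  then have "q j = 0" if "j \<in> J" for j using that by (intro poly_eqI) simp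
  moreover have "J \<noteq> {}" using 0(2) by auto
  ultimately show ?case using subfld_1[OF A] by (intro exI[of _ "\<lambda>_. 1"]) auto
next
  case (Suc d)
  show ?case
  proof (cases "\<forall>j\<in>J. poly.coeff (q j) d = 0")
    case True
    then have "poly.coeff (q j) i = 0" if "j \<in> J" "i \<ge> d" for j i
      using that Suc.prems(4)[of j i] by (cases "i = d") auto
    then show ?thesis using Suc.IH[of J q] Suc.prems by auto
  next
    case False
    then obtain j0 where j0: "j0 \<in> J" "poly.coeff (q j0) d \<noteq> 0" by blast
    define t where "t j = poly.coeff (q j) d / poly.coeff (q j0) d" for j
    have t: "t j \<in> A" if "j \<in> J" for j
      using Suc.prems(3)[OF that] Suc.prems(3)[OF j0(1)] by (auto simp: t_def poly_in_def intro: subfld_divide[OF A])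
    define q' where "q' j = q j - Polynomial.smult (t j) (q j0)" for j
    have "\<exists>c. (\<forall>j\<in>J - {j0}. c j \<in> A) \<and> (\<exists>j\<in>J - {j0}. c j \<noteq> 0) \<and>
        (\<Sum>j\<in>J - {j0}. Polynomial.smult (c j) (q' j)) = 0"
    proof (rule Suc.IH)
      show "finite (J - {j0})" "card (J - {j0}) > d" using Suc.prems(1,2) j0(1) by auto
      show "poly_in A (q' j)" if "j \<in> J - {j0}" for j
        using that t Suc.prems(3) j0(1) by (auto simp: q'_def intro!: poly_in_diff[OF A] poly_in_smult[OF A])
      show "poly.coeff (q' j) i = 0" if "j \<in> J - {j0}" "i \<ge> d" for j i
        using that Suc.prems(4)[of j i] Suc.prems(4)[of j0 i] j0 by (cases "i = d") (auto simp: q'_def t_def)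
    qed
    then obtain c where c: "\<forall>j\<in>J - {j0}. c j \<in> A" "\<exists>j\<in>J - {j0}. c j \<noteq> 0"
      "(\<Sum>j\<in>J - {j0}. Polynomial.smult (c j) (q' j)) = 0" by blast
    define c' where "c' = c(j0 := - (\<Sum>j\<in>J - {j0}. c j * t j))"
    have "(\<Sum>j\<in>J. Polynomial.smult (c' j) (q j))
        = Polynomial.smult (c' j0) (q j0) + (\<Sum>j\<in>J - {j0}. Polynomial.smult (c' j) (q j))"
      using Suc.prems(1) j0(1) by (rule sum.remove)
    also have "(\<Sum>j\<in>J - {j0}. Polynomial.smult (c' j) (q j)) = (\<Sum>j\<in>J - {j0}. Polynomial.smult (c j) (q j))"
      by (rule sum.cong) (auto simp: c'_def)
    also have "Polynomial.smult (c' j0) (q j0) = - (\<Sum>j\<in>J - {j0}. Polynomial.smult (c j * t j) (q j0))"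
      by (simp add: c'_def smult_sum)
    also have "- (\<Sum>j\<in>J - {j0}. Polynomial.smult (c j * t j) (q j0)) + (\<Sum>j\<in>J - {j0}. Polynomial.smult (c j) (q j))
        = (\<Sum>j\<in>J - {j0}. Polynomial.smult (c j) (q' j))"
      by (simp add: q'_def smult_diff_right sum_subtractf)
    finally have "(\<Sum>j\<in>J. Polynomial.smult (c' j) (q j)) = 0" using c(3) by simp
    moreover have "\<forall>j\<in>J. c' j \<in> A"
      using c(1) t by (auto simp: c'_def intro!: subfld_uminus[OF A] subfld_sum[OF A] subfld_mult[OF A])
    moreover have "\<exists>j\<in>J. c' j \<noteq> 0" using c(2) by (auto simp: c'_def)
    ultimately show ?thesis by blast
  qed
qed

text \<open>The powers \<open>e\<^sup>p\<^sup>^\<^sup>j\<close> all lie in the finite-dimensional space \<open>A(e)\<close>.\<close>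

lemma frobenius_relation:
  assumes A: "subfld A" and e: "algebraic_over A e"
  obtains n b where "\<And>j. b j \<in> A" "b n \<noteq> 0" "(\<Sum>j\<le>n. b j * e ^ (p ^ j)) = 0"
proof -
  obtain \<mu> where \<mu>: "min_poly_of A e \<mu>" using min_poly_ex[OF A e] .
  then have ov: "poly_in A \<mu>" and nz: "\<mu> \<noteq> 0" and root: "poly \<mu> e = 0" by (auto simp: min_poly_of_def)
  define d where "d = degree \<mu>"
  define q where "q j = Polynomial.monom 1 (p ^ j) mod \<mu>" for j
  have "\<exists>c. (\<forall>j\<in>{..d}. c j \<in> A) \<and> (\<exists>j\<in>{..d}. c j \<noteq> 0) \<and> (\<Sum>j\<in>{..d}. Polynomial.smult (c j) (q j)) = 0"
  proof (rule linear_dependence[OF A])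
    show "poly_in A (q j)" for j
      using poly_in_div_mod[OF A poly_in_monom[OF A subfld_1[OF A]] ov] by (simp add: q_def)
    show "poly.coeff (q j) i = 0" if "i \<ge> d" for j i
    proof -
      have "q j = 0 \<or> degree (q j) < d" using degree_mod_less[OF nz] by (simp add: q_def d_def)
      then show ?thesis using that by (auto simp: coeff_eq_0)
    qed
  qed auto
  then obtain c where c: "\<forall>j\<le>d. c j \<in> A" "\<exists>j\<le>d. c j \<noteq> 0" "(\<Sum>j\<le>d. Polynomial.smult (c j) (q j)) = 0"
    by auto
  have "poly (q j) e = e ^ (p ^ j)" for j
    using root by (simp add: q_def poly_mod poly_monom)
  then have rel: "(\<Sum>j\<le>d. c j * e ^ (p ^ j)) = 0"
    using arg_cong[OF c(3), of "\<lambda>f. poly f e"] by (simp add: poly_sum)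
  define n where "n = Max {j. j \<le> d \<and> c j \<noteq> 0}"
  have ne: "finite {j. j \<le> d \<and> c j \<noteq> 0}" "{j. j \<le> d \<and> c j \<noteq> 0} \<noteq> {}" using c(2) by auto
  have n: "n \<le> d" "c n \<noteq> 0" using Max_in[OF ne] by (auto simp: n_def)
  have above: "c j = 0" if "n < j" "j \<le> d" for j
    using Max_ge[OF ne(1), of j] that by (fastforce simp: n_def)
  define b where "b j = (if j \<le> d then c j else 0)" for j
  have "(\<Sum>j\<le>n. b j * e ^ (p ^ j)) = (\<Sum>j\<le>d. c j * e ^ (p ^ j))"
    by (rule sum.mono_neutral_cong_left) (use n(1) above in \<open>auto simp: b_def\<close>)
  then show thesis using that[of b n] c(1) n rel subfld_0[OF A] by (auto simp: b_def)
qed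

text \<open>The polynomials \<open>x\<^sup>n - 1\<close> with \<open>n\<close> prime to the characteristic have \<open>n\<close> distinct roots.\<close>

lemma sep_closed_infinite:
  assumes "sep_closed (UNIV :: 'o::field set)"
  shows "infinite (UNIV :: 'o set)"
proof
  assume fin: "finite (UNIV :: 'o set)"
  define c where "c = card (UNIV :: 'o set)"
  obtain n where n: "n > c" "of_nat n \<noteq> (0 :: 'o)"
    by (cases "of_nat (Suc c) = (0 :: 'o)") (use that[of "Suc c"] that[of "Suc (Suc c)"] in auto)
  define f where "f = Polynomial.monom (1 :: 'o) n - [:1:]"
  have "coprime f (pderiv f)" using separable_binomial[OF n(2), of 1] by (simp add: f_def)
  then obtain S :: "'o set" where "card S = degree f"
    using separable_splits[OF subfld_UNIV assms, of f] by (auto simp: poly_in_def)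
  moreover have "card S \<le> c" for S :: "'o set" using fin by (simp add: c_def card_mono)
  moreover have "degree f \<ge> n" using n(1) by (intro le_degree) (cases n; simp add: f_def)
  ultimately show False using n(1) by (metis leD order_trans)
qed

text \<open>The monic polynomial whose simple roots are the elements of \<open>V\<close>. If \<open>V\<close> is a finite additive
  subgroup, then it is an additive polynomial.\<close>

definition subgroup_poly :: "'o::field set \<Rightarrow> 'o poly" where
  "subgroup_poly V = (\<Prod>v\<in>V. [:- v, 1:])"

context
  fixes V :: "'o::field set"
  assumes V: "finite V" "0 \<in> V" "\<And>u v. u \<in> V \<Longrightarrow> v \<in> V \<Longrightarrow> u + v \<in> V"
begin

lemma poly_subgroup_poly: "poly (subgroup_poly V) x = (\<Prod>v\<in>V. x - v)"
  by (simp add: subgroup_poly_def poly_prod)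

lemma subgroup_translate:
  assumes "u \<in> V"
  shows "(\<lambda>v. v + u) ` V = V"
  by (rule endo_inj_surj) (use V assms in auto)

lemma subgroup_poly_shift:
  assumes "u \<in> V"
  shows "poly (subgroup_poly V) (x + u) = poly (subgroup_poly V) x"
proof -
  have "(\<Prod>v\<in>V. x + u - v) = (\<Prod>v\<in>(\<lambda>v. v + u) ` V. x + u - v)" by (simp add: subgroup_translate assms)
  also have "\<dots> = (\<Prod>v\<in>V. x - v)" by (subst prod.reindex) (auto simp: inj_on_def)
  finally show ?thesis by (simp add: poly_subgroup_poly)
qed

lemma subgroup_poly_degree: "degree (subgroup_poly V) = card V" "lead_coeff (subgroup_poly V) = 1"
proof -
  show "degree (subgroup_poly V) = card V"
    by (simp add: subgroup_poly_def degree_prod_eq_sum_degree)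
  show "lead_coeff (subgroup_poly V) = 1"
    unfolding subgroup_poly_def lead_coeff_prod by simp
qed

text \<open>Additivity, as an identity of polynomials: both sides are monic of degree \<open>|V|\<close> and agree on
  the elements of \<open>V\<close>.\<close>

lemma subgroup_poly_translate:
  "pcompose (subgroup_poly V) [:y, 1:] = subgroup_poly V + [:poly (subgroup_poly V) y:]"
proof (rule poly_eqI_degree_lead_coeff)
  have pos: "card V > 0" using V(1,2) by (auto simp: card_gt_0_iff)
  have d: "degree (pcompose (subgroup_poly V) [:y, 1:]) = card V"
    by (simp add: degree_pcompose subgroup_poly_degree)
  have "lead_coeff (pcompose (subgroup_poly V) [:y, 1:]) = 1"
    by (subst lead_coeff_comp) (auto simp: subgroup_poly_degree(2)[unfolded subgroup_poly_degree(1)] subgroup_poly_degree(1))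
  then show "poly.coeff (pcompose (subgroup_poly V) [:y, 1:]) (card V)
      = poly.coeff (subgroup_poly V + [:poly (subgroup_poly V) y:]) (card V)"
    using d subgroup_poly_degree(2) subgroup_poly_degree(1) pos
    by (cases "card V") (auto simp: subgroup_poly_degree(1))
  show "card V \<ge> card V" ..
  show "degree (pcompose (subgroup_poly V) [:y, 1:]) \<le> card V" using d by simp
  show "degree (subgroup_poly V + [:poly (subgroup_poly V) y:]) \<le> card V"
    by (rule degree_add_le) (auto simp: subgroup_poly_degree)
  fix v assume v: "v \<in> V"
  have "poly (subgroup_poly V) v = 0" using v V(1) by (auto simp: poly_subgroup_poly)
  then show "poly (pcompose (subgroup_poly V) [:y, 1:]) v = poly (subgroup_poly V + [:poly (subgroup_poly V) y:]) v"
    using subgroup_poly_shift[OF v, of y] by (simp add: poly_pcompose add.commute)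
qed

lemma subgroup_poly_add:
  "poly (subgroup_poly V) (x + y) = poly (subgroup_poly V) x + poly (subgroup_poly V) y"
  using arg_cong[OF subgroup_poly_translate[of y], of "\<lambda>f. poly f x"] by (simp add: poly_pcompose add.commute)

text \<open>The derivative of an additive polynomial is translation invariant, hence constant; it is not
  zero because the roots are simple. So all the equations \<open>Q(x) = b\<close> are separable.\<close>

lemma subgroup_poly_surj:
  assumes L: "subfld L" "sep_closed L" "V \<subseteq> L" "b \<in> L" and U: "sep_closed (UNIV :: 'o set)"
  obtains x where "x \<in> L" "poly (subgroup_poly V) x = b"
proof -
  let ?Q = "subgroup_poly V"
  have "poly (pderiv ?Q) y = poly (pderiv ?Q) 0" for y
    using arg_cong[OF subgroup_poly_translate[of y], of "\<lambda>f. poly (pderiv f) 0"]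
    by (simp add: pderiv_pcompose poly_pcompose pderiv_add pderiv_pCons)
  then have "poly (pderiv ?Q - [:poly (pderiv ?Q) 0:]) y = 0" for y by simp
  then have "pderiv ?Q - [:poly (pderiv ?Q) 0:] = 0"
    using poly_roots_finite[of "pderiv ?Q - [:poly (pderiv ?Q) 0:]"] sep_closed_infinite[OF U] by auto
  then have der: "pderiv ?Q = [:poly (pderiv ?Q) 0:]" by simp
  have "?Q = [:0, 1:] * subgroup_poly (V - {0})"
    unfolding subgroup_poly_def using V(1,2) by (simp add: prod.remove[of V 0])
  then have "poly (pderiv ?Q) 0 = poly (subgroup_poly (V - {0})) 0"
    by (simp add: pderiv_mult pderiv_pCons)
  also have "\<dots> \<noteq> 0" using V(1) by (auto simp: subgroup_poly_def poly_prod prod_zero_iff)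
  finally have nz: "poly (pderiv ?Q) 0 \<noteq> 0" .
  have "pderiv (?Q - [:b:]) = [:poly (pderiv ?Q) 0:]" using der by (simp add: pderiv_diff pderiv_pCons)
  moreover have "is_unit [:poly (pderiv ?Q) 0:]" using nz by (simp add: is_unit_const_poly_iff dvd_field_iff)
  ultimately have "coprime (?Q - [:b:]) (pderiv (?Q - [:b:]))" by (metis coprimeI dvd_unit_imp_unit)
  moreover have "poly_in L (?Q - [:b:])"
    unfolding subgroup_poly_def using L(3,4) by (intro poly_in_diff[OF L(1)] poly_in_prod[OF L(1)] poly_in_pCons[OF L(1)] poly_in_0[OF L(1)] subfld_uminus[OF L(1)] subfld_1[OF L(1)]) auto
  moreover have "degree (?Q - [:b:]) > 0"
  proof -
    have "card V > 0" using V(1,2) by (auto simp: card_gt_0_iff)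
    moreover have "poly.coeff (?Q - [:b:]) (card V) \<noteq> 0"
      using subgroup_poly_degree calculation by (cases "card V") auto
    ultimately show ?thesis using le_degree[of "?Q - [:b:]" "card V"] by linarith
  qed
  ultimately obtain x where "x \<in> L" "poly (?Q - [:b:]) x = 0" using L(2) unfolding sep_closed_def by blast
  then show thesis by (intro that[of x]) auto
qed

end

context sep_tower
begin

text \<open>Additive Hilbert 90 for \<open>M kb / kb\<close>: every class modulo \<open>kb\<close> that is invariant has a
  representative in \<open>M\<close>. If a coefficient of \<open>c\<close> is moved by \<open>g\<close>, then \<open>g c - c \<in> kb\<close> expresses one of the
  elements of \<open>M\<close> that occur in \<open>c\<close> by the others.\<close>

lemma kb_coboundary:
  assumes M: "subfld M" "K \<subseteq> M" "M \<inter> kb \<subseteq> k"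
    and c: "c \<in> lspan kb M" "\<And>g. g \<in> Aut M \<Longrightarrow> g c - c \<in> kb"
  obtains m b where "m \<in> M" "b \<in> kb" "c = m + b"
proof -
  have kM: "k \<subseteq> M" using k_K M(2) by blast
  have gk: "g \<in> Aut k" if "g \<in> Aut M" for g using that Aut_mono[OF kM] by blast
  have "\<exists>m\<in>M. \<exists>b\<in>kb. c = m + b"
    if "finite I" "I \<subseteq> M" "\<forall>x\<in>I. f x \<in> kb" "m \<in> M" "b \<in> kb" "c = (\<Sum>x\<in>I. f x * x) + m + b" for I f m b
    using that
  proof (induction "card I" arbitrary: I f m b rule: less_induct)
    case less
    show ?case
    proof (cases "\<forall>g\<in>Aut M. \<forall>x\<in>I. g (f x) = f x")
      case True
      then have "f x \<in> k" if "x \<in> I" for x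
        using kb_moves[OF M, of "f x"] less.prems(3) that by blast
      then have "(\<Sum>x\<in>I. f x * x) \<in> M"
        using less.prems(2) kM by (intro subfld_sum[OF M(1)] subfld_mult[OF M(1)]) auto
      then show ?thesis using less.prems subfld_add[OF M(1)] by blast
    next
      case False
      then obtain g j where g: "g \<in> Aut M" and j: "j \<in> I" "g (f j) \<noteq> f j" by blast
      define a where "a x = g (f x) - f x" for x
      have a: "a x \<in> kb" if "x \<in> I" for x
        using that less.prems(3) Aut_kb_closed[OF gk[OF g]] subfld_diff[OF kb] by (auto simp: a_def)
      have aj: "a j \<noteq> 0" using j by (simp add: a_def)
      define \<beta> where "\<beta> = (g c - c) - (g b - b)"
      have \<beta>: "\<beta> \<in> kb"
        using c(2)[OF g] less.prems(5) Aut_kb_closed[OF gk[OF g]] by (auto simp: \<beta>_def intro!: subfld_diff[OF kb])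
      have "g (\<Sum>x\<in>I. f x * x) = (\<Sum>x\<in>I. g (f x) * x)"
        unfolding Aut_simps(10)[OF g] using less.prems(2)
        by (intro sum.cong) (auto simp: Aut_simps(4)[OF g] Aut_fixes[OF g])
      then have "\<beta> = (\<Sum>x\<in>I. a x * x)"
        using Aut_fixes[OF g less.prems(4)] less.prems(6)
        by (simp add: \<beta>_def a_def Aut_simps(3)[OF g] left_diff_distrib sum_subtractf)
      also have "\<dots> = a j * j + (\<Sum>x\<in>I - {j}. a x * x)" by (rule sum.remove[OF less.prems(1) j(1)])
      finally have jeq: "j = (\<beta> - (\<Sum>x\<in>I - {j}. a x * x)) / a j" using aj by (simp add: field_simps)
      define t where "t = f j / a j"
      have t: "t \<in> kb" using less.prems(3) j(1) a by (auto simp: t_def intro: subfld_divide[OF kb])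
      have "f j * j = t * \<beta> - t * (\<Sum>x\<in>I - {j}. a x * x)"
        by (subst jeq) (simp add: t_def right_diff_distrib diff_divide_distrib)
      then have "(\<Sum>x\<in>I. f x * x) = t * \<beta> + (\<Sum>x\<in>I - {j}. (f x - t * a x) * x)"
        by (subst sum.remove[OF less.prems(1) j(1)])
          (simp add: left_diff_distrib sum_subtractf sum_distrib_left mult.assoc)
      then have "c = (\<Sum>x\<in>I - {j}. (f x - t * a x) * x) + m + (b + t * \<beta>)"
        using less.prems(6) by simp
      moreover have "card (I - {j}) < card I" using less.prems(1) j(1) by (meson card_Diff1_less)
      moreover have "\<forall>x\<in>I - {j}. f x - t * a x \<in> kb" "b + t * \<beta> \<in> kb"
        using less.prems(3,5) a t \<beta> by (auto intro!: subfld_diff[OF kb] subfld_add[OF kb] subfld_mult[OF kb])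
      ultimately show ?thesis
        using less.prems(1,2,4) by (intro less.hyps[of "I - {j}" "\<lambda>x. f x - t * a x" m "b + t * \<beta>"]) auto
    qed
  qed
  moreover obtain I f where "finite I" "I \<subseteq> M" "\<forall>x\<in>I. f x \<in> kb" "c = (\<Sum>x\<in>I. f x * x) + 0 + 0"
    using c(1) unfolding lspan_def by auto
  ultimately show thesis using that subfld_0[OF M(1)] subfld_0[OF kb] by blast
qed

text \<open>Put \<open>E = M kb\<close>, and let \<open>V\<close> be the finite group of all \<open>h z - z\<close> with \<open>h\<close> in \<open>Aut E\<close>, with its
  additive polynomial \<open>Q\<close>. Then \<open>Q(z)\<close> lies in \<open>E\<close> and is invariant modulo \<open>kb\<close>, so \<open>Q(z) = m + b\<close>
  with \<open>m \<in> M\<close> and \<open>b \<in> kb\<close>. Choose \<open>b'\<close> in \<open>kb\<close> with \<open>Q(b') = b\<close> and put \<open>y = z - b'\<close>. Every automorphism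
  over \<open>M\<close> moves \<open>y\<close> by an element of \<open>V\<close>, so it can be corrected by one over \<open>E\<close> to fix \<open>y\<close>, without
  changing its effect on \<open>kb\<close>. Hence \<open>M(y)\<close> contains no new constants.\<close>

lemma complement_step:
  assumes M: "subfld M" "K \<subseteq> M" "M \<inter> kb \<subseteq> k"
    and z: "z \<notin> lspan kb M" and fin: "finite {g z - z |g. g \<in> Aut M}" and cz: "\<And>g. g \<in> Aut M \<Longrightarrow> g z - z \<in> kb"
  obtains M' where "subfld M'" "M \<subset> M'" "M' \<inter> kb \<subseteq> k"
proof -
  define E where "E = lspan kb M"
  note Es = lspan_kb_subfld[OF M(1,2), folded E_def]
  have KE: "K \<subseteq> E" using K_F Es(4) by blast
  have EM: "Aut E \<subseteq> Aut M" by (rule Aut_mono[OF Es(2)])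
  define V where "V = {h z - z |h. h \<in> Aut E}"
  have Vkb: "V \<subseteq> kb" using cz EM by (auto simp: V_def)
  have VE: "V \<subseteq> E" using Vkb Es(3) by blast
  have finV: "finite V" by (rule finite_subset[OF _ fin]) (use EM in \<open>auto simp: V_def\<close>)
  have V0: "0 \<in> V" using Aut_id by (force simp: V_def)
  have Vadd: "u + v \<in> V" if "u \<in> V" "v \<in> V" for u v
  proof -
    obtain g h where gh: "g \<in> Aut E" "h \<in> Aut E" "u = g z - z" "v = h z - z" using \<open>u \<in> V\<close> \<open>v \<in> V\<close> by (auto simp: V_def)
    have "g v = v" using Aut_fixes[OF gh(1)] that(2) VE by blast
    then have "g (h z) - g z = h z - z" by (simp add: gh(4) Aut_simps(5)[OF gh(1)])
    moreover have "g (h z) - z = (g z - z) + (g (h z) - g z)" by simp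
    ultimately have "g (h z) - z = u + v" using gh(3,4) by simp
    then show ?thesis using Aut_comp[OF gh(1,2)] by (force simp: V_def)
  qed
  note VV = finV V0 Vadd
  have Vneg: "- u \<in> V" if "u \<in> V" for u
    using subgroup_translate[OF VV that] V0 by (metis add_eq_0_iff2 imageE)
  have Vg: "g v \<in> V" if g: "g \<in> Aut M" and "v \<in> V" for g v
  proof -
    obtain h where h: "h \<in> Aut E" "v = h z - z" using \<open>v \<in> V\<close> by (auto simp: V_def)
    obtain g' where g': "g' \<in> Aut M" "\<And>x. g' (g x) = x" "\<And>x. g (g' x) = x" using Aut_inverse[OF g] by metis
    define h' where "h' = (\<lambda>x. g (h (g' x)))"
    have "h' \<in> Aut {}"
    proof -
      have "g \<in> Aut {}" "g' \<in> Aut {}" "h \<in> Aut {}"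
        using g g'(1) h(1) Aut_mono[OF empty_subsetI, of M] Aut_mono[OF empty_subsetI, of E] by auto
      then show ?thesis using Aut_comp[of g "{}" "\<lambda>x. h (g' x)"] Aut_comp[of h "{}" g'] by (simp add: h'_def)
    qed
    moreover have "h' x = x" if "x \<in> E" for x
    proof -
      have "g' x \<in> E" using Aut_lspan[OF M(2) g'(1)] that by (auto simp: E_def)
      then show ?thesis using Aut_fixes[OF h(1)] g'(3) by (simp add: h'_def)
    qed
    ultimately have h'E: "h' \<in> Aut E" by (simp add: Aut_def)
    have "g z - z \<in> E" using cz[OF g] Es(3) by blast
    then have "h' (g z - z) = g z - z" by (rule Aut_fixes[OF h'E])
    then have "h' z - z = h' (g z) - g z" by (simp add: Aut_simps(5)[OF h'E] algebra_simps)
    also have "\<dots> = g v" using h(2) g'(2) by (simp add: h'_def Aut_simps(5)[OF g])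
    finally show ?thesis unfolding V_def using h'E by (intro CollectI exI[of _ h']) simp
  qed
  define Q where "Q = poly (subgroup_poly V)"
  have Qprod: "Q x = (\<Prod>v\<in>V. x - v)" for x by (simp add: Q_def poly_subgroup_poly[OF VV])
  have Qadd: "Q (x + y) = Q x + Q y" for x y unfolding Q_def by (rule subgroup_poly_add[OF VV])
  have Q0: "Q x = 0 \<longleftrightarrow> x \<in> V" for x using finV by (auto simp: Qprod prod_zero_iff)
  have Qdiff: "Q (x - y) = Q x - Q y" for x y using Qadd[of "x - y" y] by simp
  have Qkb: "Q x \<in> kb" if "x \<in> kb" for x
    unfolding Qprod using that Vkb by (intro subfld_prod[OF kb] subfld_diff[OF kb]) auto
  have Qg: "g (Q x) = Q (g x)" if g: "g \<in> Aut M" for g x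
  proof -
    have "g ` V = V"
      using finV Vg[OF g] Aut_simps(12)[OF g] by (intro endo_inj_surj) (auto simp: inj_on_def)
    then have "(\<Prod>v\<in>V. g x - v) = (\<Prod>v\<in>g ` V. g x - v)" by simp
    also have "\<dots> = (\<Prod>v\<in>V. g x - g v)" using Aut_simps(12)[OF g] by (subst prod.reindex) (auto simp: inj_on_def)
    also have "\<dots> = g (\<Prod>v\<in>V. x - v)"
      using finV by (induction V rule: finite_induct) (auto simp: Aut_simps(2,4,5)[OF g])
    finally show ?thesis by (simp add: Qprod)
  qed
  have cE: "Q z \<in> E"
  proof (rule ccontr)
    assume "Q z \<notin> E"
    then obtain h where h: "h \<in> Aut E" "h (Q z) \<noteq> Q z"
      using Aut_moves[OF Es(1) KE _ sep_over_mono[OF F_sep Es(4)]] by metis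
    have "h (Q z) = Q (z + (h z - z))" using Qg h(1) EM by auto
    also have "\<dots> = Q z + Q (h z - z)" by (rule Qadd)
    also have "Q (h z - z) = 0" unfolding Q0 V_def using h(1) by blast
    finally show False using h(2) by simp
  qed
  have "g (Q z) - Q z \<in> kb" if "g \<in> Aut M" for g
    using Qkb[OF cz[OF that]] by (simp add: Qg[OF that] Qdiff)
  then obtain m b where mb: "m \<in> M" "b \<in> kb" "Q z = m + b"
    using kb_coboundary[OF M cE[unfolded E_def]] by blast
  obtain b' where b': "b' \<in> kb" "Q b' = b"
    using subgroup_poly_surj[OF VV kb kb_closed Vkb mb(2) closed] unfolding Q_def by metis
  define y where "y = z - b'"
  have Qy: "Q y = m" using mb b' by (simp add: y_def Qdiff)
  have ynE: "y \<notin> E"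
  proof
    assume "y \<in> E"
    then have "y + b' \<in> E" using b'(1) Es(1,3) subfld_add by blast
    then show False using z by (simp add: y_def E_def)
  qed
  have hy: "h y - y = h z - z" if "h \<in> Aut E" for h
  proof -
    have "h b' = b'" using Aut_fixes[OF that] b'(1) Es(3) by blast
    then show ?thesis by (simp add: y_def Aut_simps(5)[OF that])
  qed
  have alg: "algebraic_over M y"
  proof -
    define f where "f = subgroup_poly V - [:m:]"
    have "poly_in M f"
    proof -
      have "poly.coeff f i \<in> M" for i
      proof -
        have "poly_in kb (subgroup_poly V)"
          unfolding subgroup_poly_def using Vkb by (intro poly_in_prod[OF kb] poly_in_pCons[OF kb] poly_in_0[OF kb] subfld_uminus[OF kb] subfld_1[OF kb]) auto
        then have ckb: "poly.coeff (subgroup_poly V) i \<in> kb" for i by (simp add: poly_in_def)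
        have "poly.coeff (subgroup_poly V) i \<in> k" for i
        proof (rule kb_moves[OF M ckb])
          fix g assume g: "g \<in> Aut M"
          have inf: "infinite (range g)"
            using sep_closed_infinite[OF closed] Aut_bij[OF g] by (simp add: bij_def)
          have eq: "poly (map_poly g (subgroup_poly V)) x = poly (subgroup_poly V) x" if "x \<in> range g" for x
            using Qg[OF g] Aut_poly[OF g] that by (auto simp: Q_def)
          have "map_poly g (subgroup_poly V) - subgroup_poly V = 0"
          proof (rule ccontr)
            assume "map_poly g (subgroup_poly V) - subgroup_poly V \<noteq> 0"
            from poly_roots_finite[OF this] have "finite (range g)"
              by (rule finite_subset[rotated]) (use eq in auto)
            then show False using inf by blast
          qed
          then have "map_poly g (subgroup_poly V) = subgroup_poly V" by simp
          then show "g (poly.coeff (subgroup_poly V) i) = poly.coeff (subgroup_poly V) i"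
            using coeff_map[OF subfld_UNIV Aut_hom[OF g]] by metis
        qed
        then have "poly.coeff (subgroup_poly V) i \<in> M" using k_K M(2) by blast
        moreover have "poly.coeff [:m:] i \<in> M" using mb(1) subfld_0[OF M(1)] by (cases i) auto
        ultimately show ?thesis by (simp add: f_def subfld_diff[OF M(1)])
      qed
      then show ?thesis by (simp add: poly_in_def)
    qed
    moreover have "poly f y = 0" using Qy by (simp add: f_def Q_def)
    moreover have "f \<noteq> 0"
    proof
      assume "f = 0"
      then have "card V = 0" using subgroup_poly_degree(1)[OF VV] by (simp add: f_def)
      then show False using finV V0 by auto
    qed
    ultimately show ?thesis by (auto simp: algebraic_over_def)
  qed
  show thesis
  proof (rule that[of "adjoin M y"])
    show "subfld (adjoin M y)" by (rule adjoin_subfld[OF M(1) alg])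
    show "M \<subset> adjoin M y" using adjoin_subset[OF M(1)] adjoin_gen[OF M(1), of y] ynE Es(2) by blast
    show "adjoin M y \<inter> kb \<subseteq> k"
    proof
      fix x assume x: "x \<in> adjoin M y \<inter> kb"
      show "x \<in> k"
      proof (rule kb_moves[OF M])
        fix g assume g: "g \<in> Aut M"
        \<comment> \<open>An element of \<open>Aut E\<close>, which fixes \<open>x\<close>, corrects \<open>g\<close> to an automorphism fixing \<open>y\<close>.\<close>
        obtain g' where g': "g' \<in> Aut M" "\<And>x. g' (g x) = x" "\<And>x. g (g' x) = x" using Aut_inverse[OF g] by metis
        have "Q (g y - y) = 0" using Qy Qg[OF g, of y] Aut_fixes[OF g mb(1)] by (simp add: Qdiff)
        then have "g' (- (g y - y)) \<in> V" using Q0 Vneg Vg[OF g'(1)] by blast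
        then obtain h where h: "h \<in> Aut E" "h y - y = g' (- (g y - y))" using hy by (auto simp: V_def)
        then have "g (h y) = y"
          using g'(3)[of "- (g y - y)"] by (simp add: Aut_simps(5,6)[OF g] Aut_simps(3,5)[OF g] diff_eq_eq)
        moreover have "(\<lambda>x. g (h x)) \<in> Aut M" using Aut_comp[OF g] h(1) EM by blast
        ultimately have "g (h x) = x"
        proof -
          obtain f where f: "poly_in M f" "x = poly f y" using x by (auto simp: adjoin_def)
          have "poly (map_poly (\<lambda>x. g (h x)) f) (g (h y)) = g (h (poly f y))"
            by (rule Aut_poly) fact
          then show ?thesis using Aut_map_id[OF \<open>(\<lambda>x. g (h x)) \<in> Aut M\<close> f(1)] f(2) \<open>g (h y) = y\<close> by simp
        qed
        moreover have "h x = x" using Aut_fixes[OF h(1)] x Es(3) by blast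
        ultimately show "g x = x" by simp
      qed (use x in auto)
    qed
  qed
qed

lemma prime_char:
  assumes "Factorial_Ring.prime (p :: nat)" "of_nat p = (0 :: 'o)"
  shows "CHAR('o) = p"
proof -
  have "CHAR('o) dvd p" using assms(2) of_nat_eq_0_iff_char_dvd by blast
  then show ?thesis using assms(1) CHAR_not_1 by (metis One_nat_def prime_nat_iff)
qed

lemma artin_schreier_separable:
  fixes a :: 'o
  assumes p: "Factorial_Ring.prime (p :: nat)" "of_nat p = (0 :: 'o)"
  shows "coprime (Polynomial.monom 1 p - [:0, 1:] - [:a:]) (pderiv (Polynomial.monom 1 p - [:0, 1:] - [:a:]))"
    "degree (Polynomial.monom 1 p - [:0, 1:] - [:a:]) > 0"
proof -
  have "pderiv (Polynomial.monom 1 p - [:0, 1:] - [:a:]) = - [:1:]"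
    using p(2) by (simp add: pderiv_diff pderiv_monom pderiv_pCons)
  moreover have "is_unit (- [:1 :: 'o:])" by (simp add: is_unit_const_poly_iff flip: one_pCons)
  ultimately show "coprime (Polynomial.monom 1 p - [:0, 1:] - [:a:]) (pderiv (Polynomial.monom 1 p - [:0, 1:] - [:a:]))"
    by (metis coprimeI dvd_unit_imp_unit)
  have "p > 1" using p(1) by (rule prime_gt_1_nat)
  then have "poly.coeff (Polynomial.monom 1 p - [:0, 1:] - [:a:]) p \<noteq> 0"
    by (auto simp: coeff_pCons split: nat.splits)
  then show "degree (Polynomial.monom 1 p - [:0, 1:] - [:a:]) > 0"
    using \<open>p > 1\<close> le_degree by fastforce
qed

lemma artin_schreier_root_kb:
  assumes p: "Factorial_Ring.prime (p :: nat)" "of_nat p = (0 :: 'o)" and "x ^ p - x = (0 :: 'o)"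
  shows "x \<in> kb"
proof (rule separable_roots_in[OF kb kb_closed _ artin_schreier_separable(1)[OF p, of 0]])
  show "poly_in kb (Polynomial.monom 1 p - [:0, 1:] - [:0:])"
    by (intro poly_in_diff[OF kb] poly_in_monom[OF kb] poly_in_pCons[OF kb] poly_in_0[OF kb] subfld_0[OF kb] subfld_1[OF kb])
  show "poly (Polynomial.monom 1 p - [:0, 1:] - [:0:]) x = 0" using assms(3) by (simp add: poly_monom)
qed

lemma frobenius_add:
  assumes p: "Factorial_Ring.prime (p :: nat)" "of_nat p = (0 :: 'o)"
  shows "(x + y :: 'o) ^ (p ^ n) = x ^ (p ^ n) + y ^ (p ^ n)" "(x - y :: 'o) ^ (p ^ n) = x ^ (p ^ n) - y ^ (p ^ n)"
    "(sum f I :: 'o) ^ (p ^ n) = (\<Sum>i\<in>I. f i ^ (p ^ n))"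
proof -
  have c: "CHAR('o) = p" by (rule prime_char[OF p])
  show add: "(x + y :: 'o) ^ (p ^ n) = x ^ (p ^ n) + y ^ (p ^ n)" for x y
    using freshmans_dream'[of "p ^ n" n x y] p(1) c by simp
  show "(x - y :: 'o) ^ (p ^ n) = x ^ (p ^ n) - y ^ (p ^ n)"
    using add[of "x - y" y] by (simp add: algebra_simps)
  show "(sum f I :: 'o) ^ (p ^ n) = (\<Sum>i\<in>I. f i ^ (p ^ n))"
    using freshmans_dream_sum'[of "p ^ n" n f I] p(1) c by simp
qed

text \<open>As \<open>M kb\<close> is spanned by products \<open>e m\<close> of a constant and an element of \<open>M\<close>, it is enough to show
  that \<open>e m\<close> belongs to the group \<open>P\<close> of all \<open>w\<^sup>p - w\<close>. Modulo \<open>P\<close> every element equals its \<open>p\<close>-th power.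
  Choose a relation \<open>\<Sum>\<^sub>j b\<^sub>j e\<^sup>p\<^sup>^\<^sup>j = 0\<close> over \<open>k\<close> and solve \<open>\<Sum>\<^sub>i (b\<^sub>n\<^sub>-\<^sub>i z)\<^sup>p\<^sup>^\<^sup>i = m\<^sup>p\<^sup>^\<^sup>n\<close>. This polynomial is additive
  with coefficients in \<open>k\<close>, so \<open>z\<close> lies in \<open>M kb\<close> by assumption. Multiplying by \<open>e\<^sup>p\<^sup>^\<^sup>n\<close> and raising the
  \<open>i\<close>-th summand to the power \<open>p\<^sup>n\<^sup>-\<^sup>i\<close> turns the left side into a multiple of the relation, that is, into
  0, while the right side is \<open>(e m)\<^sup>p\<^sup>^\<^sup>n\<close>.\<close>

lemma artin_schreier_closed:
  assumes M: "subfld M" "K \<subseteq> M" "M \<inter> kb \<subseteq> k"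
    and max: "\<And>z. finite {g z - z |g. g \<in> Aut M} \<Longrightarrow> (\<And>g. g \<in> Aut M \<Longrightarrow> g z - z \<in> kb) \<Longrightarrow> z \<in> lspan kb M"
    and p: "Factorial_Ring.prime (p :: nat)" "of_nat p = (0 :: 'o)" and y: "y ^ p - y \<in> lspan kb M"
  shows "y \<in> lspan kb M"
proof -
  define E where "E = lspan kb M"
  note Es = lspan_kb_subfld[OF M(1,2), folded E_def]
  have kM: "k \<subseteq> M" using k_K M(2) by blast
  define P where "P = {w ^ p - w |w. w \<in> E}"
  have fr1: "(x + y :: 'o) ^ p = x ^ p + y ^ p" "(x - y :: 'o) ^ p = x ^ p - y ^ p" for x y
    using frobenius_add(1,2)[OF p, of x y 1] by auto
  have P0: "0 \<in> P" using subfld_0[OF Es(1)] prime_gt_0_nat[OF p(1)] unfolding P_def by (intro CollectI exI[of _ 0]) (simp add: power_0_left)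
  have Padd: "a + b \<in> P" if "a \<in> P" "b \<in> P" for a b
  proof -
    obtain v w where "v \<in> E" "w \<in> E" "a = v ^ p - v" "b = w ^ p - w" using \<open>a \<in> P\<close> \<open>b \<in> P\<close> by (auto simp: P_def)
    then have "a + b = (v + w) ^ p - (v + w)" "v + w \<in> E" by (auto simp: fr1 subfld_add[OF Es(1)])
    then show ?thesis by (auto simp: P_def)
  qed
  have Pneg: "- a \<in> P" if "a \<in> P" for a
  proof -
    obtain v where "v \<in> E" "a = v ^ p - v" using \<open>a \<in> P\<close> by (auto simp: P_def)
    then have "- a = (0 - v) ^ p - (0 - v)" "0 - v \<in> E"
      using prime_gt_0_nat[OF p(1)] by (simp_all only: fr1 subfld_diff[OF Es(1)] subfld_0[OF Es(1)]) (simp add: power_0_left)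
    then show ?thesis unfolding P_def by blast
  qed
  have Pdiff: "a - b \<in> P" if "a \<in> P" "b \<in> P" for a b using Padd[OF that(1) Pneg[OF that(2)]] by simp
  have Psum: "(\<Sum>i\<in>I. f i) \<in> P" if "\<And>i. i \<in> I \<Longrightarrow> f i \<in> P" for I :: "nat set" and f
    using that by (induction I rule: infinite_finite_induct) (auto intro: P0 Padd)
  have Pfrob: "u - u ^ (p ^ n) \<in> P" if "u \<in> E" for u n
  proof (induction n)
    case (Suc n)
    have "(u ^ (p ^ n)) ^ p - u ^ (p ^ n) \<in> P" using subfld_power[OF Es(1) that] by (auto simp: P_def)
    moreover have "u - u ^ (p ^ Suc n) = (u - u ^ (p ^ n)) - ((u ^ (p ^ n)) ^ p - u ^ (p ^ n))"
      by (simp add: mult.commute flip: power_mult)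
    ultimately show ?case using Suc Pdiff by metis
  qed (simp add: P0)
  have lift: "x \<in> E" if "x ^ p - x \<in> P" for x
  proof -
    obtain w where w: "w \<in> E" "x ^ p - x = w ^ p - w" using \<open>x ^ p - x \<in> P\<close> by (auto simp: P_def)
    have "(x - w) ^ p - (x - w) = (x ^ p - x) - (w ^ p - w)" by (simp add: fr1)
    then have "(x - w) ^ p - (x - w) = 0" using w(2) by simp
    then have "x - w \<in> E" using artin_schreier_root_kb[OF p] Es(3) by blast
    then show ?thesis using subfld_add[OF Es(1) _ w(1)] by fastforce
  qed
  have simple: "e * m \<in> P" if e: "e \<in> kb" and m: "m \<in> M" for e m
  proof -
    obtain n b where b: "\<And>j. b j \<in> k" "b n \<noteq> 0" "(\<Sum>j\<le>n. b j * e ^ (p ^ j)) = 0"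
      using frobenius_relation[OF k sep_imp_algebraic[OF kb_sep[OF e]]] by metis
    define f where "f = (\<Sum>i\<le>n. Polynomial.monom (b (n - i) ^ (p ^ i)) (p ^ i))"
    have fk: "poly_in k f"
      unfolding f_def by (intro poly_in_sum[OF k] poly_in_monom[OF k] subfld_power[OF k] b(1))
    have pf: "poly f x = (\<Sum>i\<le>n. (b (n - i) * x) ^ (p ^ i))" for x
      by (simp add: f_def poly_sum poly_monom power_mult_distrib)
    have "pderiv (sum h I) = (\<Sum>i\<in>I. pderiv (h i))" for h :: "nat \<Rightarrow> 'o poly" and I
      by (induction I rule: infinite_finite_induct) (auto simp: pderiv_add)
    then have "pderiv f = (\<Sum>i\<le>n. pderiv (Polynomial.monom (b (n - i) ^ (p ^ i)) (p ^ i)))"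
      by (simp add: f_def)
    also have "\<dots> = (\<Sum>i\<le>n. if i = 0 then [:b n:] else 0)"
      by (rule sum.cong) (use p(2) in \<open>auto simp: pderiv_monom monom_0 power_0_left\<close>)
    finally have df: "pderiv f = [:b n:]" by simp
    have unit: "is_unit [:b n:]" using b(2) by (simp add: is_unit_const_poly_iff dvd_field_iff)
    have dfa: "pderiv (f - [:a:]) = [:b n:]" for a by (simp add: pderiv_diff pderiv_pCons df)
    have fc: "coprime (f - [:a:]) (pderiv (f - [:a:]))" for a
      unfolding dfa by (rule coprimeI) (use unit dvd_unit_imp_unit in blast)
    have nz: "degree (f - [:a:]) > 0" for a
    proof (rule ccontr)
      assume "\<not> degree (f - [:a:]) > 0"
      then obtain c where "f - [:a:] = [:c:]" by (auto elim: degree_eq_zeroE)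
      then have "pderiv (f - [:a:]) = 0" by (simp add: pderiv_pCons)
      then show False using b(2) by (simp add: dfa)
    qed
    define m1 where "m1 = m ^ (p ^ n)"
    obtain z where "poly (f - [:m1:]) z = 0"
      using closed fc[of m1] nz[of m1] by (auto simp: sep_closed_def poly_in_def)
    then have z: "poly f z = m1" by simp
    have add: "poly f (x - y) = poly f x - poly f y" for x y
      by (simp add: pf right_diff_distrib frobenius_add(2)[OF p] sum_subtractf)
    have gz: "poly f (g z - z) = 0" if "g \<in> Aut M" for g
    proof -
      have "poly f (g z) = g (poly f z)"
        using Aut_poly[OF that, of f z] Aut_map_id[OF that poly_in_mono[OF fk kM]] by simp
      also have "\<dots> = m1" using z Aut_fixes[OF that] m subfld_power[OF M(1)] by (simp add: m1_def)
      finally show ?thesis using z by (simp add: add)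
    qed
    have roots_kb: "x \<in> kb" if "poly f x = 0" for x
      using separable_roots_in[OF kb kb_closed poly_in_mono[OF fk k_kb], of x] fc[of 0] that by simp
    have "f \<noteq> 0" using nz[of 0] by auto
    have zE: "z \<in> E"
      unfolding E_def
    proof (rule max)
      show "finite {g z - z |g. g \<in> Aut M}"
        by (rule finite_subset[OF _ poly_roots_finite[OF \<open>f \<noteq> 0\<close>]]) (use gz in auto)
      show "g z - z \<in> kb" if "g \<in> Aut M" for g using gz[OF that] by (rule roots_kb)
    qed
    define e1 where "e1 = e ^ (p ^ n)"
    define u where "u i = e1 * (b (n - i) * z) ^ (p ^ i)" for i
    have uE: "u i \<in> E" for i
      unfolding u_def e1_def using e b(1) zE Es(2,3) kM
      by (intro subfld_mult[OF Es(1)] subfld_power[OF Es(1)]) auto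
    have "(\<Sum>i\<le>n. u i - u i ^ (p ^ (n - i))) \<in> P" using uE by (intro Psum Pfrob)
    moreover have "(\<Sum>i\<le>n. u i) = e1 * m1"
      by (simp add: u_def z[symmetric] pf sum_distrib_left)
    moreover have "(\<Sum>i\<le>n. u i ^ (p ^ (n - i))) = 0"
    proof -
      have "u i ^ (p ^ (n - i)) = (z * (b (n - i) * e ^ (p ^ (n - i)))) ^ (p ^ n)" if "i \<le> n" for i
      proof -
        have pn: "p ^ n = p ^ i * p ^ (n - i)" using that by (simp flip: power_add)
        have "u i ^ (p ^ (n - i)) = (e ^ (p ^ n)) ^ (p ^ (n - i)) * ((b (n - i) * z) ^ (p ^ i)) ^ (p ^ (n - i))"
          by (simp add: u_def e1_def power_mult_distrib)
        also have "(e ^ (p ^ n)) ^ (p ^ (n - i)) = (e ^ (p ^ (n - i))) ^ (p ^ n)"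
          by (simp add: mult.commute flip: power_mult)
        also have "((b (n - i) * z) ^ (p ^ i)) ^ (p ^ (n - i)) = (b (n - i) * z) ^ (p ^ n)"
          by (simp add: pn power_mult)
        finally show ?thesis by (simp add: power_mult_distrib mult_ac)
      qed
      then have "(\<Sum>i\<le>n. u i ^ (p ^ (n - i))) = (\<Sum>i\<le>n. (z * (b (n - i) * e ^ (p ^ (n - i)))) ^ (p ^ n))"
        by (intro sum.cong) auto
      also have "\<dots> = (z * (\<Sum>i\<le>n. b (n - i) * e ^ (p ^ (n - i)))) ^ (p ^ n)"
        by (simp add: sum_distrib_left frobenius_add(3)[OF p])
      also have "(\<Sum>i\<le>n. b (n - i) * e ^ (p ^ (n - i))) = (\<Sum>j\<le>n. b j * e ^ (p ^ j))"
        by (rule sum.nat_diff_reindex[of "\<lambda>j. b j * e ^ (p ^ j)" "Suc n", simplified lessThan_Suc_atMost, simplified])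
      finally show ?thesis using b(3) prime_gt_0_nat[OF p(1)] by (simp add: power_0_left)
    qed
    ultimately have "e1 * m1 \<in> P" by (simp add: sum_subtractf)
    moreover have "e * m - (e * m) ^ (p ^ n) \<in> P"
      using e m Es(2,3) by (intro Pfrob subfld_mult[OF Es(1)]) auto
    ultimately have "(e * m - (e * m) ^ (p ^ n)) + e1 * m1 \<in> P" using Padd by blast
    then show ?thesis by (simp add: e1_def m1_def power_mult_distrib)
  qed
  have "a \<in> P" if "a \<in> lspan kb M" for a
    using that
  proof (induction rule: lspan_induct)
    case (add e m u)
    then show ?case using simple Padd by blast
  qed (rule P0)
  then have "y ^ p - y \<in> P" using y .
  from lift[OF this] show ?thesis by (simp add: E_def)
qed

lemma artin_schreier_complement:
  assumes M0: "subfld M0" "K \<subseteq> M0" "M0 \<inter> kb \<subseteq> k"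
  obtains M where "subfld M" "M0 \<subseteq> M" "M \<inter> kb \<subseteq> k"
    "\<And>p y. Factorial_Ring.prime (p :: nat) \<Longrightarrow> of_nat p = (0 :: 'o) \<Longrightarrow> y ^ p - y \<in> lspan kb M \<Longrightarrow> y \<in> lspan kb M"
proof -
  define good where "good M \<longleftrightarrow> subfld M \<and> M0 \<subseteq> M \<and> M \<inter> kb \<subseteq> k" for M
  have "\<exists>M\<in>Collect good. \<forall>W\<in>Collect good. M \<subseteq> W \<longrightarrow> W = M"
  proof (rule subset_Zorn_nonempty)
    show "Collect good \<noteq> {}" using M0 by (auto simp: good_def)
    fix C assume C: "C \<noteq> {}" "subset.chain (Collect good) C"
    then have Cg: "\<And>G. G \<in> C \<Longrightarrow> good G" and tot: "\<And>G H. G \<in> C \<Longrightarrow> H \<in> C \<Longrightarrow> G \<subseteq> H \<or> H \<subseteq> G"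
      by (auto simp: subset_chain_def)
    have two: "\<exists>G\<in>C. u \<in> G \<and> v \<in> G" if "u \<in> \<Union>C" "v \<in> \<Union>C" for u v
    proof -
      obtain G H where GH: "G \<in> C" "H \<in> C" "u \<in> G" "v \<in> H" using \<open>u \<in> \<Union>C\<close> \<open>v \<in> \<Union>C\<close> by blast
      from tot[OF GH(1,2)] show ?thesis using GH by auto
    qed
    have sub: "subfld G" if "G \<in> C" for G using Cg[OF that] by (simp add: good_def)
    have "subfld (\<Union>C)"
    proof (rule subfldI)
      show "1 \<in> \<Union>C" using C(1) sub subfld_1 by blast
      fix u v assume "u \<in> \<Union>C" "v \<in> \<Union>C"
      then obtain G where G: "G \<in> C" "u \<in> G" "v \<in> G" using two by blast
      show "u - v \<in> \<Union>C" "u * v \<in> \<Union>C"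
        using subfld_diff[OF sub[OF G(1)] G(2,3)] subfld_mult[OF sub[OF G(1)] G(2,3)] G(1) by blast+
    next
      fix u assume "u \<in> \<Union>C"
      then obtain G where G: "G \<in> C" "u \<in> G" by blast
      then show "inverse u \<in> \<Union>C" using subfld_inverse[OF sub[OF G(1)] G(2)] by blast
    qed
    moreover have "M0 \<subseteq> \<Union>C" "\<Union>C \<inter> kb \<subseteq> k" using C(1) Cg unfolding good_def by (blast, blast)
    ultimately show "\<Union>C \<in> Collect good" by (simp add: good_def)
  qed
  then obtain M where M: "good M" "\<And>W. good W \<Longrightarrow> M \<subseteq> W \<Longrightarrow> W = M" by blast
  have Ms: "subfld M" "K \<subseteq> M" "M \<inter> kb \<subseteq> k" "M0 \<subseteq> M" using M(1) M0(2) by (auto simp: good_def)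
  have max: "z \<in> lspan kb M"
    if fin: "finite {g z - z |g. g \<in> Aut M}" and cz: "\<And>g. g \<in> Aut M \<Longrightarrow> g z - z \<in> kb" for z
  proof (rule ccontr)
    assume "z \<notin> lspan kb M"
    obtain M' where "subfld M'" "M \<subset> M'" "M' \<inter> kb \<subseteq> k"
      by (rule complement_step[OF Ms(1-3) \<open>z \<notin> lspan kb M\<close> fin]) (use cz in auto)
    then have "good M'" using Ms(4) by (auto simp: good_def)
    then show False using M(2)[of M'] \<open>M \<subset> M'\<close> by blast
  qed
  show thesis
    using that[OF Ms(1,4,3)] artin_schreier_closed[OF Ms(1-3) max] by blast
qed

end

section \<open>Abelian extensions\<close>

context sep_tower
begin

text \<open>The field fixed by the commutators of \<open>Aut F\<close>; it is identified with the maximal abelian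
  extension of \<open>F\<close> below.\<close>

definition abelian_part :: "'o set" where
  "abelian_part = {x. \<forall>g\<in>Aut F. \<forall>h\<in>Aut F. g (h x) = h (g x)}"

lemma abelian_part_subfld: "subfld abelian_part"
  unfolding abelian_part_def by (rule subfldI) (auto simp: Aut_simps(2,4,5,7))

lemma F_abelian_part: "F \<subseteq> abelian_part"
  by (auto simp: abelian_part_def Aut_fixes)

lemma Aut_abelian_part:
  assumes f: "f \<in> Aut F" and x: "x \<in> abelian_part"
  shows "f x \<in> abelian_part"
  unfolding abelian_part_def
proof (intro CollectI ballI)
  have comm: "g (h x) = h (g x)" if "g \<in> Aut F" "h \<in> Aut F" for g h
    using x that by (simp add: abelian_part_def)
  fix g h assume g: "g \<in> Aut F" and h: "h \<in> Aut F"
  have "g (h (f x)) = h (f (g x))" using comm[OF g Aut_comp[OF h f]] by simp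
  also have "\<dots> = h (g (f x))" using comm[OF g f] by simp
  finally show "g (h (f x)) = h (g (f x))" .
qed

lemma Aut_F_fixed:
  assumes "\<And>g. g \<in> Aut F \<Longrightarrow> g x = x"
  shows "x \<in> F"
  using Aut_moves[OF F K_F _ F_sep] assms by metis

lemma Aut_funpow: "g \<in> Aut A \<Longrightarrow> g ^^ n \<in> Aut A"
proof (induction n)
  case 0
  then show ?case using Aut_id by (simp add: id_def)
next
  case (Suc n)
  then show ?case using Aut_comp[of g A "g ^^ n"] by (simp add: comp_def)
qed

lemma funpow_fixed_mult: "(g ^^ n) x = x \<Longrightarrow> (g ^^ (n * m)) x = x"
  by (induction m) (auto simp: funpow_add)

text \<open>Suppose that the abelian part is not contained in \<open>E\<close>, and let \<open>x\<close> be an element outside of \<open>E\<close> with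
  an orbit of minimal size. The contradiction comes from the group through which \<open>Aut F\<close> acts on the
  orbit of \<open>x\<close>: either it contains an element whose order is the characteristic, or
  the field generated by the orbit is spanned by common eigenvectors.\<close>

context
  fixes E :: "'o set" and x :: 'o
  assumes E: "subfld E" and FE: "F \<subseteq> E"
    and xC: "x \<in> abelian_part" and xE: "x \<notin> E"
    and minimal: "\<And>y. y \<in> abelian_part \<Longrightarrow> y \<notin> E \<Longrightarrow> card {g x |g. g \<in> Aut F} \<le> card {g y |g. g \<in> Aut F}"
begin

definition stab_fixed :: "'o set" where
  "stab_fixed = {y \<in> abelian_part. \<forall>h\<in>Aut F. h x = x \<longrightarrow> h y = y}"

lemma stab_fixed_subfld: "subfld stab_fixed"
  unfolding stab_fixed_def by (rule subfldI) (auto simp: Aut_simps(2,4,5,7) intro: subfld_closed[OF abelian_part_subfld])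

lemma x_stab_fixed: "x \<in> stab_fixed" and F_stab_fixed: "F \<subseteq> stab_fixed"
  using xC F_abelian_part by (auto simp: stab_fixed_def Aut_fixes)

lemma stab_fixed_comm: "g \<in> Aut F \<Longrightarrow> h \<in> Aut F \<Longrightarrow> y \<in> stab_fixed \<Longrightarrow> g (h y) = h (g y)"
  by (simp add: stab_fixed_def abelian_part_def)

lemma Aut_stab_fixed:
  assumes "g \<in> Aut F" "y \<in> stab_fixed"
  shows "g y \<in> stab_fixed"
  unfolding stab_fixed_def
proof (intro CollectI conjI ballI impI)
  show "g y \<in> abelian_part" using Aut_abelian_part assms by (simp add: stab_fixed_def)
  show "h (g y) = g y" if "h \<in> Aut F" "h x = x" for h
  proof -
    have "h y = y" using that assms(2) unfolding stab_fixed_def by blast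
    then show ?thesis using stab_fixed_comm[OF that(1) assms] by simp
  qed
qed

lemma stab_fixed_determined:
  assumes "g \<in> Aut F" "h \<in> Aut F" "g x = h x" "y \<in> stab_fixed"
  shows "g y = h y"
proof -
  obtain h' where h': "h' \<in> Aut F" "\<And>x. h' (h x) = x" "\<And>x. h (h' x) = x" using Aut_inverse[OF assms(2)] by metis
  have "h' (g y) = y"
    using assms(4) Aut_comp[OF h'(1) assms(1)] h'(2) assms(3) by (auto simp: stab_fixed_def)
  then show ?thesis using h'(3) by metis
qed

text \<open>Since the stabilizer of \<open>x\<close> fixes \<open>y\<close>, there is a surjection \<open>h x \<mapsto> h y\<close> between their orbits. It
  is not injective because of \<open>g\<close>, so the orbit of \<open>y\<close> is too small for an element outside of \<open>E\<close>.\<close>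

lemma small_orbit:
  assumes g: "g \<in> Aut F" "g x \<noteq> x" and y: "y \<in> stab_fixed" "g y = y"
  shows "y \<in> E"
proof (rule ccontr)
  assume "y \<notin> E"
  define Orb where "Orb z = {g z |g. g \<in> Aut F}" for z
  define f where "f s = (SOME h. h \<in> Aut F \<and> h x = s) y" for s
  have f: "f (h x) = h y" if "h \<in> Aut F" for h
  proof -
    have "(SOME h'. h' \<in> Aut F \<and> h' x = h x) \<in> Aut F \<and> (SOME h'. h' \<in> Aut F \<and> h' x = h x) x = h x"
      by (rule someI[of _ h]) (use that in auto)
    then show ?thesis unfolding f_def using stab_fixed_determined that y(1) by blast
  qed
  have fin: "finite (Orb x)" unfolding Orb_def by (rule finite_orbit[OF sep_imp_algebraic[OF F_sep]])
  have im: "Orb y = f ` Orb x"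
  proof (intro equalityI subsetI)
    fix s assume "s \<in> Orb y"
    then obtain h where "h \<in> Aut F" "s = h y" by (auto simp: Orb_def)
    then show "s \<in> f ` Orb x" using f[of h] unfolding Orb_def by (metis (mono_tags, lifting) image_eqI mem_Collect_eq)
  next
    fix s assume "s \<in> f ` Orb x"
    then obtain h where "h \<in> Aut F" "s = f (h x)" by (auto simp: Orb_def)
    then show "s \<in> Orb y" using f[of h] by (auto simp: Orb_def)
  qed
  have "\<not> inj_on f (Orb x)"
  proof
    assume inj: "inj_on f (Orb x)"
    have "f x = f (g x)" using f[OF Aut_id] f[OF g(1)] y(2) by simp
    moreover have "x \<in> Orb x" unfolding Orb_def using Aut_id by (intro CollectI exI[of _ "\<lambda>x. x"]) simp
    moreover have "g x \<in> Orb x" unfolding Orb_def using g(1) by blast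
    ultimately show False using inj g(2) by (auto dest: inj_onD)
  qed
  then have "card (Orb y) < card (Orb x)"
    using eq_card_imp_inj_on[OF fin] card_image_le[OF fin, of f] im by (metis nat_less_le)
  moreover have "y \<in> abelian_part" using y(1) by (simp add: stab_fixed_def)
  ultimately show False using minimal[OF _ \<open>y \<notin> E\<close>] by (simp add: Orb_def)
qed

text \<open>The trace of the cyclic group generated by \<open>g\<close> does not vanish identically, so there is \<open>v\<close>
  with \<open>g v = v + 1\<close>. By minimality \<open>v\<^sup>p - v\<close> lies in \<open>E\<close>, hence so does \<open>v\<close>. But \<open>x\<close> is a polynomial in
  \<open>v\<close> with coefficients that are fixed by \<open>g\<close>, and these lie in \<open>E\<close> by minimality again.\<close>

lemma no_p_cycle:
  assumes p: "Factorial_Ring.prime (p :: nat)" "of_nat p = (0 :: 'o)"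
    and AS: "\<And>y. y ^ p - y \<in> E \<Longrightarrow> y \<in> E"
    and g: "g \<in> Aut F" "g x \<noteq> x" "(g ^^ p) x = x"
  shows False
proof -
  have p1: "p > 1" using p(1) by (rule prime_gt_1_nat)
  have gn: "g ^^ n \<in> Aut F" for n by (rule Aut_funpow[OF g(1)])
  have per: "(g ^^ p) y = y" if "y \<in> stab_fixed" for y
    using stab_fixed_determined[OF gn Aut_id _ that] g(3) by simp
  have distinct: "(g ^^ i) x \<noteq> (g ^^ j) x" if "i < j" "j < p" for i j
  proof
    assume eq: "(g ^^ i) x = (g ^^ j) x"
    have "(g ^^ j) x = (g ^^ i) ((g ^^ (j - i)) x)"
      using that(1) by (metis add_diff_inverse_nat comp_apply funpow_add less_imp_le_nat not_le)
    then have fx: "(g ^^ (j - i)) x = x" using eq Aut_simps(12)[OF gn[of i]] by metis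
    have "coprime (j - i) p"
      using p(1) that by (metis coprime_commute diff_is_0_eq dvd_imp_le leD less_imp_diff_less not_le_imp_less prime_imp_coprime zero_less_diff)
    then obtain a b where "(j - i) * a = p * b + 1"
      using coprime_bezout_strong[of "j - i" p] p1 by auto
    then have "(g ^^ ((j - i) * a)) x = g ((g ^^ (p * b)) x)" by simp
    then show False using funpow_fixed_mult[OF fx] funpow_fixed_mult[OF g(3)] g(2) by simp
  qed
  \<comment> \<open>Some power of \<open>x\<close> has nonzero trace, by the Vandermonde argument.\<close>
  define q where "q = (\<Prod>i\<in>{1..<p}. [:- (g ^^ i) x, 1:])"
  have "(\<Sum>i<p. poly q ((g ^^ i) x)) = (\<Sum>i<p. if i = 0 then poly q x else 0)"
  proof (rule sum.cong)
    fix i assume "i \<in> {..<p}"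
    then show "poly q ((g ^^ i) x) = (if i = 0 then poly q x else 0)"
      by (cases "i = 0") (auto simp: q_def poly_prod prod_zero_iff)
  qed simp
  also have "\<dots> = poly q x" using p1 by simp
  also have "\<dots> \<noteq> 0" using distinct[of 0] by (auto simp: q_def poly_prod prod_zero_iff)
  finally have "(\<Sum>j\<le>degree q. poly.coeff q j * (\<Sum>i<p. ((g ^^ i) x) ^ j)) \<noteq> 0"
    by (simp add: poly_altdef sum_distrib_left sum.swap[of _ "{..<p}"])
  then obtain j where j: "(\<Sum>i<p. ((g ^^ i) x) ^ j) \<noteq> 0"
    by (metis (no_types, lifting) mult_zero_right sum.neutral)
  define u where "u = x ^ j"
  have uY: "u \<in> stab_fixed" using x_stab_fixed subfld_power[OF stab_fixed_subfld] by (simp add: u_def)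
  define f where "f i = (g ^^ i) u" for i
  have fp: "f p = f 0" using per[OF uY] by (simp add: f_def)
  have fS: "g (f i) = f (Suc i)" for i by (simp add: f_def)
  have fY: "f i \<in> stab_fixed" for i using Aut_stab_fixed[OF gn uY] by (simp add: f_def)
  define t where "t = (\<Sum>i<p. f i)"
  have t: "t \<noteq> 0" "t \<in> stab_fixed"
    using j fY by (auto simp: t_def f_def u_def Aut_simps(9)[OF gn] intro: subfld_sum[OF stab_fixed_subfld])
  have shift: "(\<Sum>i<p. h (Suc i)) = (\<Sum>i<p. h i)" if "h p = h 0" for h :: "nat \<Rightarrow> 'o"
    using sum.lessThan_Suc_shift[of h p] sum.lessThan_Suc[of h p] that by simp
  have gt: "g t = t" unfolding t_def Aut_simps(10)[OF g(1)] fS using shift[of f] fp by simp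
  define v where "v = - (\<Sum>i<p. of_nat i * f i) / t"
  have vY: "v \<in> stab_fixed"
    unfolding v_def using fY t
    by (intro subfld_divide[OF stab_fixed_subfld] subfld_uminus[OF stab_fixed_subfld] subfld_sum[OF stab_fixed_subfld]
        subfld_mult[OF stab_fixed_subfld] subfld_of_nat[OF stab_fixed_subfld])
  have "g (\<Sum>i<p. of_nat i * f i) = (\<Sum>i<p. of_nat (Suc i) * f (Suc i) - f (Suc i))"
    unfolding Aut_simps(10)[OF g(1)]
    by (rule sum.cong) (auto simp: Aut_simps(4,11)[OF g(1)] fS algebra_simps)
  also have "\<dots> = (\<Sum>i<p. of_nat i * f i) - t"
    using shift[of "\<lambda>i. of_nat i * f i"] shift[of f] fp p(2) by (simp add: sum_subtractf t_def)
  finally have gv: "g v = v + 1"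
    using t(1) by (simp add: v_def Aut_simps(6,8)[OF g(1)] gt field_simps)
  have "g (v ^ p - v) = v ^ p - v"
    using frobenius_add(1)[OF p, of v 1 1] by (simp add: Aut_simps(5,9)[OF g(1)] gv)
  then have "v ^ p - v \<in> E"
    by (intro small_orbit[OF g(1,2)]) (use vY in \<open>auto intro: subfld_diff[OF stab_fixed_subfld] subfld_power[OF stab_fixed_subfld]\<close>)
  then have vE: "v \<in> E" by (rule AS)
  have giv: "(g ^^ i) v = v + of_nat i" for i
    by (induction i) (auto simp: Aut_simps(3,11)[OF g(1)] gv)
  define G where "G = range (\<lambda>i. g ^^ i)"
  have GF: "G \<subseteq> Aut F" using gn by (auto simp: G_def)
  have det: "(g ^^ i) x = (g ^^ j) x" if "(g ^^ i) v = (g ^^ j) v" for i j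
  proof -
    have *: "(g ^^ i) x = (g ^^ j) x" if "i \<le> j" "of_nat i = (of_nat j :: 'o)" for i j
    proof -
      have "of_nat (j - i) = (0 :: 'o)" using that by (simp add: of_nat_diff)
      then obtain m where m: "j - i = p * m" using prime_char[OF p] of_nat_eq_0_iff_char_dvd[of "j - i", where 'a = 'o] by (metis dvdE)
      have "(g ^^ j) x = (g ^^ i) ((g ^^ (j - i)) x)"
        using that(1) by (metis le_add_diff_inverse comp_apply funpow_add)
      then show ?thesis using funpow_fixed_mult[OF g(3), of m] m by simp
    qed
    have "of_nat i = (of_nat j :: 'o)" using that by (simp add: giv)
    then show ?thesis using *[of i j] *[of j i] by (metis nat_le_linear)
  qed
  obtain r where r: "poly_in (fixed G \<inter> stab_fixed) r" "poly r v = x"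
  proof (rule fixed_interpolation[where G = G and x = x and e = v and B = stab_fixed])
    show "G \<subseteq> Aut {}" using GF Aut_mono[OF empty_subsetI] by blast
    show "(\<lambda>x. x) \<in> G" unfolding G_def by (rule range_eqI[of _ _ 0]) (simp add: id_def)
    show "(\<lambda>x. g0 (h x)) \<in> G" if gh: "g0 \<in> G" "h \<in> G" for g0 h
    proof -
      obtain i j where ij: "g0 = g ^^ i" "h = g ^^ j" using gh by (auto simp: G_def)
      show ?thesis unfolding G_def by (rule range_eqI[of _ _ "i + j"]) (simp add: ij funpow_add comp_def)
    qed
    show "finite {g v |g. g \<in> G}"
      by (rule finite_subset[OF _ finite_orbit[OF sep_imp_algebraic[OF F_sep]]]) (use GF in blast)
    show "h x = h' x" if "h \<in> G" "h' \<in> G" "h v = h' v" for h h' using that det by (auto simp: G_def)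
  qed (use GF Aut_stab_fixed vY x_stab_fixed stab_fixed_subfld that in auto)
  have "poly.coeff r i \<in> E" for i
  proof (rule small_orbit[OF g(1,2)])
    have "g \<in> G" unfolding G_def by (rule range_eqI[of _ _ 1]) simp
    then show "poly.coeff r i \<in> stab_fixed" "g (poly.coeff r i) = poly.coeff r i"
      using r(1) by (auto simp: poly_in_def fixed_def)
  qed
  then have "poly_in E r" by (simp add: poly_in_def)
  then have "x \<in> E" using poly_in_poly[OF E _ vE] r(2) by blast
  then show False using xE by simp
qed

text \<open>If the least period of \<open>x\<close> under \<open>g\<close> were a multiple of the characteristic \<open>p\<close>, then \<open>x\<close> would have
  least period \<open>p\<close> under some power of \<open>g\<close>.\<close>

lemma tame_order:
  assumes AS: "\<And>p y. Factorial_Ring.prime (p :: nat) \<Longrightarrow> of_nat p = (0 :: 'o) \<Longrightarrow> y ^ p - y \<in> E \<Longrightarrow> y \<in> E"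
    and g: "g \<in> Aut F"
  shows "\<exists>n. of_nat n \<noteq> (0 :: 'o) \<and> (g ^^ n) x = x"
proof -
  have gn: "g ^^ n \<in> Aut F" for n by (rule Aut_funpow[OF g])
  have "finite (range (\<lambda>i. (g ^^ i) x))"
    by (rule finite_subset[OF _ finite_orbit[OF sep_imp_algebraic[OF F_sep[of x]]]]) (use gn in auto)
  then have "\<not> inj (\<lambda>i. (g ^^ i) x)" using finite_imageD infinite_UNIV_nat by blast
  then obtain i j where ij: "(g ^^ i) x = (g ^^ j) x" "i < j"
    unfolding inj_def by (metis linorder_neqE_nat)
  have "(g ^^ j) x = (g ^^ i) ((g ^^ (j - i)) x)"
    using ij(2) by (metis le_add_diff_inverse comp_apply funpow_add less_imp_le_nat)
  then have "(g ^^ (j - i)) x = x" using ij(1) Aut_simps(12)[OF gn[of i]] by metis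
  then have ex: "j - i > 0 \<and> (g ^^ (j - i)) x = x" using ij(2) by simp
  define r where "r = (LEAST n. n > 0 \<and> (g ^^ n) x = x)"
  have r: "r > 0" "(g ^^ r) x = x"
    using LeastI[of "\<lambda>n. n > 0 \<and> (g ^^ n) x = x", OF ex] by (auto simp: r_def)
  have least: "(g ^^ n) x \<noteq> x" if "0 < n" "n < r" for n
    using not_less_Least[of n "\<lambda>n. n > 0 \<and> (g ^^ n) x = x"] that by (auto simp: r_def)
  show ?thesis
  proof (rule ccontr)
    assume "\<not> ?thesis"
    then have r0: "of_nat r = (0 :: 'o)" using r(2) by blast
    define p where "p = CHAR('o)"
    have "p > 0" using r0 r(1) by (auto simp: p_def CHAR_pos_iff)
    then have p: "Factorial_Ring.prime p" "of_nat p = (0 :: 'o)"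
      using prime_CHAR_semidom[where 'a = 'o] by (auto simp: p_def)
    obtain m where m: "r = p * m" using r0 of_nat_eq_0_iff_char_dvd[of r, where 'a = 'o] by (auto simp: p_def)
    have m': "0 < m" "m < r" using r(1) prime_gt_1_nat[OF p(1)] by (auto simp: m)
    have "((g ^^ m) ^^ p) x = x" using r(2) by (simp add: m funpow_mult mult.commute)
    then show False using no_p_cycle[OF p AS[OF p] gn[of m] least[OF m']] by blast
  qed
qed

text \<open>The components of \<open>y\<close> in the eigenspaces of \<open>g\<close> add up to a multiple of \<open>y\<close>, so one of them lies
  outside of \<open>E\<close>. It is still an eigenvector of everything that had \<open>y\<close> as an eigenvector, because on
  the abelian part all automorphisms commute.\<close>

lemma eigenvector_step:
  assumes g: "g \<in> Aut F" "of_nat n \<noteq> (0 :: 'o)" "(g ^^ n) x = x" and y: "y \<in> stab_fixed" "y \<notin> E"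
  obtains z \<zeta> where "z \<in> stab_fixed" "z \<notin> E" "g z = \<zeta> * z" "\<zeta> \<in> F"
    "\<And>h \<xi>. h \<in> Aut F \<Longrightarrow> \<xi> \<in> F \<Longrightarrow> h y = \<xi> * y \<Longrightarrow> h z = \<xi> * z"
proof -
  have n0: "n > 0" using g(2) by (cases n) auto
  have gn: "g ^^ n \<in> Aut F" for n by (rule Aut_funpow[OF g(1)])
  define Z where "Z = {\<zeta> :: 'o. \<zeta> ^ n = 1}"
  have ZF: "\<zeta> \<in> F" "\<zeta> \<noteq> 0" if "\<zeta> \<in> Z" for \<zeta>
  proof -
    have "poly_in kb (Polynomial.monom 1 n - [:1:])"
      by (intro poly_in_diff[OF kb] poly_in_monom[OF kb] poly_in_pCons[OF kb] poly_in_0[OF kb] subfld_1[OF kb])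
    then have "\<zeta> \<in> kb"
      using separable_roots_in[OF kb kb_closed _ separable_binomial[OF g(2) one_neq_zero], of \<zeta>] that
      by (simp add: Z_def poly_monom)
    then show "\<zeta> \<in> F" using kb_F by blast
    show "\<zeta> \<noteq> 0" using that n0 by (auto simp: Z_def power_0_left)
  qed
  obtain S where S: "finite S" "Polynomial.monom 1 n - [:1:] =
      Polynomial.smult (lead_coeff (Polynomial.monom 1 n - [:1 :: 'o:])) (\<Prod>a\<in>S. [:- a, 1:])"
    "card S = degree (Polynomial.monom 1 n - [:1 :: 'o:])"
    using separable_splits[OF subfld_UNIV closed _ separable_binomial[OF g(2) one_neq_zero]] by (auto simp: poly_in_def)
  have deg: "degree (Polynomial.monom 1 n - [:1 :: 'o:]) \<ge> n"
    using n0 by (intro le_degree) (cases n; simp)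
  have "S \<subseteq> Z"
  proof
    fix s assume "s \<in> S"
    then have "poly (Polynomial.monom 1 n - [:1:]) s = 0"
      using S(1) by (subst S(2)) (auto simp: poly_prod)
    then show "s \<in> Z" by (simp add: Z_def poly_monom)
  qed
  have roots: "finite {\<zeta> :: 'o. \<zeta> ^ i = 1} \<and> card {\<zeta> :: 'o. \<zeta> ^ i = 1} \<le> i" if "i > 0" for i
  proof -
    have "poly.coeff (Polynomial.monom 1 i - [:1 :: 'o:]) i \<noteq> 0" using that by (cases i) auto
    then have nz: "Polynomial.monom 1 i - [:1 :: 'o:] \<noteq> 0" by (metis coeff_0)
    have eq: "{\<zeta> :: 'o. \<zeta> ^ i = 1} = {\<zeta>. poly (Polynomial.monom 1 i - [:1:]) \<zeta> = 0}" by (simp add: poly_monom)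
    have "degree (Polynomial.monom 1 i - [:1 :: 'o:]) \<le> i" by (intro degree_diff_le degree_monom_le) simp
    then show ?thesis using poly_roots_finite[OF nz] card_poly_roots_bound[OF nz] unfolding eq by linarith
  qed
  have finZ: "finite Z" and cardZ: "card Z = n"
    using roots[OF n0] card_mono[OF _ \<open>S \<subseteq> Z\<close>] S(3) deg by (auto simp: Z_def)
  have char_sum: "(\<Sum>\<zeta>\<in>Z. inverse \<zeta> ^ i) = 0" if i: "0 < i" "i < n" for i
  proof -
    have "\<not> Z \<subseteq> {\<zeta>. \<zeta> ^ i = 1}"
      using card_mono[of "{\<zeta> :: 'o. \<zeta> ^ i = 1}" Z] roots[OF i(1)] cardZ i(2) by auto
    then obtain \<omega> where \<omega>: "\<omega> \<in> Z" "\<omega> ^ i \<noteq> 1" by blast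
    have "(\<lambda>\<zeta>. \<omega> * \<zeta>) ` Z = Z"
      using finZ ZF(2)[OF \<omega>(1)] \<omega>(1) by (intro endo_inj_surj) (auto simp: Z_def inj_on_def power_mult_distrib)
    then have "(\<Sum>\<zeta>\<in>Z. inverse \<zeta> ^ i) = (\<Sum>\<zeta>\<in>(\<lambda>\<zeta>. \<omega> * \<zeta>) ` Z. inverse \<zeta> ^ i)" by simp
    also have "\<dots> = (\<Sum>\<zeta>\<in>Z. inverse (\<omega> * \<zeta>) ^ i)"
      using ZF(2)[OF \<omega>(1)] by (subst sum.reindex) (auto simp: inj_on_def)
    also have "\<dots> = inverse \<omega> ^ i * (\<Sum>\<zeta>\<in>Z. inverse \<zeta> ^ i)"
      by (simp add: sum_distrib_left power_mult_distrib)
    finally have "(1 - inverse \<omega> ^ i) * (\<Sum>\<zeta>\<in>Z. inverse \<zeta> ^ i) = 0" by (simp add: left_diff_distrib)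
    moreover have "inverse \<omega> ^ i \<noteq> 1" using \<omega>(2) by (simp add: power_inverse)
    ultimately show ?thesis by simp
  qed
  define f where "f i = (g ^^ i) y" for i
  have fn: "f n = f 0" using stab_fixed_determined[OF gn Aut_id _ y(1), of n] g(3) by (simp add: f_def)
  define c where "c \<zeta> = (\<Sum>i<n. inverse \<zeta> ^ i * f i)" for \<zeta>
  have "(\<Sum>\<zeta>\<in>Z. c \<zeta>) = (\<Sum>i<n. (\<Sum>\<zeta>\<in>Z. inverse \<zeta> ^ i) * f i)"
    unfolding c_def by (subst sum.swap) (simp add: sum_distrib_right)
  also have "\<dots> = (\<Sum>i<n. if i = 0 then of_nat n * y else 0)"
    by (rule sum.cong) (auto simp: char_sum cardZ f_def)
  also have "\<dots> = of_nat n * y" using n0 by simp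
  finally have csum: "(\<Sum>\<zeta>\<in>Z. c \<zeta>) = of_nat n * y" .
  have "\<exists>\<zeta>\<in>Z. c \<zeta> \<notin> E"
  proof (rule ccontr)
    assume "\<not> ?thesis"
    then have "of_nat n * y \<in> E" unfolding csum[symmetric] by (intro subfld_sum[OF E]) auto
    then have "of_nat n * y / of_nat n \<in> E" by (rule subfld_divide[OF E _ subfld_of_nat[OF E]])
    then show False using y(2) g(2) by simp
  qed
  then obtain \<zeta> where \<zeta>: "\<zeta> \<in> Z" "c \<zeta> \<notin> E" by blast
  note \<zeta>F = ZF[OF \<zeta>(1)]
  have inv\<zeta>: "inverse \<zeta> ^ i \<in> F" for i
    by (intro subfld_power[OF F] subfld_inverse[OF F] \<zeta>F(1))
  show thesis
  proof (rule that)
    show "c \<zeta> \<in> stab_fixed"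
      unfolding c_def f_def using inv\<zeta> F_stab_fixed Aut_stab_fixed[OF gn y(1)]
      by (intro subfld_sum[OF stab_fixed_subfld] subfld_mult[OF stab_fixed_subfld]) auto
    show "c \<zeta> \<notin> E" by fact
    show "\<zeta> \<in> F" by fact
    have "g (c \<zeta>) = (\<Sum>i<n. inverse \<zeta> ^ i * f (Suc i))"
      unfolding c_def Aut_simps(10)[OF g(1)]
      by (rule sum.cong) (auto simp: Aut_simps(4)[OF g(1)] Aut_fixes[OF g(1) inv\<zeta>] f_def)
    also have "\<dots> = \<zeta> * (\<Sum>i<n. inverse \<zeta> ^ Suc i * f (Suc i))"
      using \<zeta>F(2) by (simp add: sum_distrib_left mult.assoc[symmetric])
    also have "(\<Sum>i<n. inverse \<zeta> ^ Suc i * f (Suc i)) = c \<zeta>"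
    proof -
      have "inverse \<zeta> ^ n = 1" using \<zeta>(1) by (simp add: Z_def power_inverse)
      then show ?thesis
        using sum.lessThan_Suc_shift[of "\<lambda>i. inverse \<zeta> ^ i * f i" n] sum.lessThan_Suc[of "\<lambda>i. inverse \<zeta> ^ i * f i" n] fn
        by (simp add: c_def)
    qed
    finally show "g (c \<zeta>) = \<zeta> * c \<zeta>" .
    show "h (c \<zeta>) = \<xi> * c \<zeta>" if h: "h \<in> Aut F" "\<xi> \<in> F" "h y = \<xi> * y" for h \<xi>
    proof -
      have "h (f i) = \<xi> * f i" for i
        using stab_fixed_comm[OF h(1) gn y(1), of i] h(3) Aut_fixes[OF gn h(2), of i]
        by (simp add: f_def Aut_simps(4)[OF gn])
      then show ?thesis
        unfolding c_def Aut_simps(10)[OF h(1)] sum_distrib_left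
        by (intro sum.cong) (auto simp: Aut_simps(4)[OF h(1)] Aut_fixes[OF h(1) inv\<zeta>])
    qed
  qed
qed

text \<open>There is a common eigenvector \<open>y\<close> outside of \<open>E\<close>. Its eigenvalues are roots of unity of order
  dividing some \<open>n\<close> prime to the characteristic, so \<open>y\<^sup>n\<close> is fixed and \<open>y\<close> is a radical of an element
  of \<open>F\<close>.\<close>

lemma no_tame_orbit:
  assumes tame: "\<And>g. g \<in> Aut F \<Longrightarrow> \<exists>n. of_nat n \<noteq> (0 :: 'o) \<and> (g ^^ n) x = x"
    and kummer: "\<And>n y. of_nat n \<noteq> (0 :: 'o) \<Longrightarrow> y ^ n \<in> F \<Longrightarrow> y \<in> E"
  shows False
proof -
  have eig: "\<exists>y\<in>stab_fixed - E. \<forall>g\<in>set gs. \<exists>\<zeta>\<in>F. g y = \<zeta> * y" if "set gs \<subseteq> Aut F" for gs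
    using that
  proof (induction gs)
    case Nil
    then show ?case using x_stab_fixed xE by auto
  next
    case (Cons g gs)
    then obtain y where y: "y \<in> stab_fixed" "y \<notin> E" "\<forall>g\<in>set gs. \<exists>\<zeta>\<in>F. g y = \<zeta> * y" by auto
    obtain n where "of_nat n \<noteq> (0 :: 'o)" "(g ^^ n) x = x" using tame Cons.prems by force
    then obtain z \<zeta> where z: "z \<in> stab_fixed" "z \<notin> E" "g z = \<zeta> * z" "\<zeta> \<in> F"
      "\<And>h \<xi>. h \<in> Aut F \<Longrightarrow> \<xi> \<in> F \<Longrightarrow> h y = \<xi> * y \<Longrightarrow> h z = \<xi> * z"
      using eigenvector_step[of g n y] y(1,2) Cons.prems by (metis list.set_intros(1) subsetD)
    have "\<exists>\<zeta>\<in>F. h z = \<zeta> * z" if "h \<in> set gs" for h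
      using y(3) z(5)[of h] that Cons.prems by (metis list.set_intros(2) subsetD)
    then show ?case using z(1-4) by auto
  qed
  define Orb where "Orb = {g x |g. g \<in> Aut F}"
  have finO: "finite Orb" unfolding Orb_def by (rule finite_orbit[OF sep_imp_algebraic[OF F_sep]])
  have "\<forall>s\<in>Orb. \<exists>g. g \<in> Aut F \<and> g x = s" by (auto simp: Orb_def)
  then obtain rep where rep: "\<And>s. s \<in> Orb \<Longrightarrow> rep s \<in> Aut F \<and> rep s x = s" by metis
  then have "\<forall>s\<in>Orb. \<exists>n. of_nat n \<noteq> (0 :: 'o) \<and> (rep s ^^ n) x = x" using tame by blast
  then obtain ord where ord: "\<And>s. s \<in> Orb \<Longrightarrow> of_nat (ord s) \<noteq> (0 :: 'o) \<and> (rep s ^^ ord s) x = x" by metis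
  obtain gs where gs: "set gs = rep ` Orb" using finite_list[OF finite_imageI[OF finO]] by metis
  then obtain y where y: "y \<in> stab_fixed" "y \<notin> E" "\<And>s. s \<in> Orb \<Longrightarrow> \<exists>\<zeta>\<in>F. rep s y = \<zeta> * y"
  proof -
    have "set gs \<subseteq> Aut F" using gs rep by auto
    from eig[OF this] obtain y where "y \<in> stab_fixed - E" "\<forall>g\<in>set gs. \<exists>\<zeta>\<in>F. g y = \<zeta> * y" by blast
    then show thesis using gs by (intro that[of y]) auto
  qed
  define n where "n = (\<Prod>s\<in>Orb. ord s)"
  have n: "of_nat n \<noteq> (0 :: 'o)" using ord finO by (simp add: n_def prod_zero_iff)
  have "y ^ n \<in> F"
  proof (rule Aut_F_fixed)
    fix g assume g: "g \<in> Aut F"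
    define s where "s = g x"
    have s: "s \<in> Orb" using g by (auto simp: Orb_def s_def)
    have rs: "rep s \<in> Aut F" "rep s x = g x" using rep[OF s] by (auto simp: s_def)
    have gy: "g y = rep s y" using stab_fixed_determined[OF g rs(1) _ y(1)] rs(2) by simp
    obtain \<zeta> where \<zeta>: "\<zeta> \<in> F" "rep s y = \<zeta> * y" using y(3)[OF s] by blast
    have "(rep s ^^ i) y = \<zeta> ^ i * y" for i
      by (induction i) (auto simp: Aut_simps(4)[OF rs(1)] \<zeta>(2) Aut_fixes[OF rs(1) subfld_power[OF F \<zeta>(1)]])
    moreover have "(rep s ^^ ord s) y = y"
      using stab_fixed_determined[OF Aut_funpow[OF rs(1)] Aut_id _ y(1)] ord[OF s] by simp
    moreover have "y \<noteq> 0" using y(2) subfld_0[OF E] by auto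
    ultimately have "\<zeta> ^ ord s = 1" by (metis mult_cancel_right1)
    moreover have "ord s dvd n" using s finO by (auto simp: n_def intro: dvd_prodI)
    ultimately have "\<zeta> ^ n = 1" by (auto elim!: dvdE simp: power_mult)
    then show "g (y ^ n) = y ^ n" by (simp add: Aut_simps(9)[OF g] gy \<zeta>(2) power_mult_distrib)
  qed
  then show False using kummer[OF n] y(2) by blast
qed

end

lemma abelian_part_subset:
  assumes E: "subfld E" "F \<subseteq> E"
    and kummer: "\<And>n y. of_nat n \<noteq> (0 :: 'o) \<Longrightarrow> y ^ n \<in> F \<Longrightarrow> y \<in> E"
    and AS: "\<And>p y. Factorial_Ring.prime (p :: nat) \<Longrightarrow> of_nat p = (0 :: 'o) \<Longrightarrow> y ^ p - y \<in> E \<Longrightarrow> y \<in> E"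
  shows "abelian_part \<subseteq> E"
proof (rule ccontr)
  assume "\<not> abelian_part \<subseteq> E"
  then obtain x0 where "x0 \<in> abelian_part \<and> x0 \<notin> E" by blast
  then obtain x where x: "x \<in> abelian_part" "x \<notin> E"
    "\<And>y. y \<in> abelian_part \<Longrightarrow> y \<notin> E \<Longrightarrow> card {g x |g. g \<in> Aut F} \<le> card {g y |g. g \<in> Aut F}"
    using ex_has_least_nat[of "\<lambda>x. x \<in> abelian_part \<and> x \<notin> E" x0 "\<lambda>x. card {g x |g. g \<in> Aut F}"] by blast
  show False
    by (rule no_tame_orbit[OF E x tame_order[OF E x AS] kummer])
qed

end

section \<open>The tensor product as a tower of fields\<close>

lemma fld_simps [simp]:
  "carrier (fld L) = L" "x \<otimes>\<^bsub>fld L\<^esub> y = x * y" "x \<oplus>\<^bsub>fld L\<^esub> y = x + y"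
  "\<one>\<^bsub>fld L\<^esub> = 1" "\<zero>\<^bsub>fld L\<^esub> = 0"
  by (simp_all add: fld_def ring_of_type_algebra_def)

lemma fld_field: "subfld L \<Longrightarrow> field (fld L)"
  unfolding fld_def subfld_iff_subfield
  using ring.subfield_iff(2)[OF field.is_ring[OF field_from_type_algebra]] by blast

lemma subfld_of_int:
  assumes "subfld L"
  shows "of_int n \<in> L"
  by (cases n rule: int_cases2) (auto intro: subfld_of_nat[OF assms] subfld_uminus[OF assms])

text \<open>The homomorphism from the free abelian group that extends \<open>h\<close>.\<close>

definition frag_eval :: "('x \<Rightarrow> 'o::field) \<Rightarrow> ('x \<Rightarrow>\<^sub>0 int) \<Rightarrow> 'o" where
  "frag_eval h z = (\<Sum>x\<in>Poly_Mapping.keys z. of_int (Poly_Mapping.lookup z x) * h x)"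

lemma frag_eval_superset:
  assumes "finite S" "Poly_Mapping.keys z \<subseteq> S"
  shows "frag_eval h z = (\<Sum>x\<in>S. of_int (Poly_Mapping.lookup z x) * h x)"
  unfolding frag_eval_def
  by (rule sum.mono_neutral_left) (use assms in \<open>auto simp: in_keys_iff\<close>)

lemma frag_eval_0 [simp]: "frag_eval h 0 = 0"
  by (simp add: frag_eval_def)

lemma frag_eval_add [simp]: "frag_eval h (z + z') = frag_eval h z + frag_eval h z'"
proof -
  have fin: "finite (Poly_Mapping.keys z \<union> Poly_Mapping.keys z')" by simp
  have sub: "Poly_Mapping.keys (z + z') \<subseteq> Poly_Mapping.keys z \<union> Poly_Mapping.keys z'"
    by (rule Poly_Mapping.keys_add)
  show ?thesis
    using frag_eval_superset[OF fin sub, of h] frag_eval_superset[OF fin, of z h] frag_eval_superset[OF fin, of z' h]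
    by (simp add: lookup_add distrib_right sum.distrib)
qed

lemma frag_eval_uminus [simp]: "frag_eval h (- z) = - frag_eval h z"
  using frag_eval_add[of h z "- z"] by (simp add: add_eq_0_iff)

lemma frag_eval_diff [simp]: "frag_eval h (z - z') = frag_eval h z - frag_eval h z'"
  using frag_eval_add[of h z "- z'"] by simp

lemma frag_eval_of [simp]: "frag_eval h (frag_of x) = h x"
  by (simp add: frag_eval_def)

lemma frag_eval_sum: "frag_eval h (sum f I) = (\<Sum>i\<in>I. frag_eval h (f i))"
  by (induction I rule: infinite_finite_induct) auto

lemma fld_add_pow:
  assumes L: "subfld L" and x: "x \<in> L"
  shows "add_pow (fld L) (n :: int) x = of_int n * x"
proof -
  interpret field "fld L" by (rule fld_field[OF L])
  have nat: "add_pow (fld L) (m :: nat) x = of_nat m * x" for m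
    by (induction m) (auto simp: add_pow_def nat_pow_def algebra_simps)
  have closed: "of_nat m * x \<in> L" for m using x by (intro subfld_mult[OF L] subfld_of_nat[OF L])
  have neg: "\<ominus>\<^bsub>fld L\<^esub> y = - y" if "y \<in> L" for y
    using that subfld_uminus[OF L that] by (intro minus_equality) auto
  show ?thesis
  proof (cases "n \<ge> 0")
    case True
    then show ?thesis using add_pow_int_ge[OF True, of "fld L" x] by (simp add: nat)
  next
    case False
    then show ?thesis using add_pow_int_lt[of n "fld L" x] neg[OF closed[of "nat (- n)"]] by (simp add: nat)
  qed
qed

lemma fld_finsum:
  assumes L: "subfld L" and "\<And>i. i \<in> I \<Longrightarrow> f i \<in> L" "finite I"
  shows "finsum (fld L) f I = sum f I"
proof -
  interpret field "fld L" by (rule fld_field[OF L])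
  show ?thesis using assms(3,2)
  proof (induction I rule: finite_induct)
    case (insert i I)
    then show ?case by (subst finsum_insert) auto
  qed simp
qed

text \<open>A balanced biadditive map kills the relations that define the tensor product.\<close>

lemma tensor_relations_eval:
  assumes A: "cring A" and \<alpha>: "\<alpha> \<in> ring_hom A T" and T: "T = fld F"
    and lf: "\<And>x y. x \<in> L \<Longrightarrow> y \<in> L \<Longrightarrow> lf (x + y) = lf x + lf y"
      "\<And>l x. x \<in> L \<Longrightarrow> lf (\<iota> l * x) = \<alpha> (cA l) * lf x"
    and c: "\<And>l. cA l \<in> carrier A" "\<And>l. \<iota> l \<in> L" and L: "subfld L"
    and z: "z \<in> generate (free_Abelian_group (carrier A \<times> L)) (tensor_relations cA A \<iota> (fld L))"
  shows "frag_eval (\<lambda>(a, b). \<alpha> a * lf b) z = (0 :: 'o::field)"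
proof -
  interpret A: cring A by (rule A)
  let ?h = "\<lambda>(a, b). \<alpha> a * lf b"
  have rel: "frag_eval ?h u = 0 \<and> Poly_Mapping.keys u \<subseteq> carrier A \<times> L"
    if u: "u \<in> tensor_relations cA A \<iota> (fld L)" for u
  proof -
    have k3: "Poly_Mapping.keys (frag_of p - frag_of q - frag_of r) \<subseteq> carrier A \<times> L"
      if "p \<in> carrier A \<times> L" "q \<in> carrier A \<times> L" "r \<in> carrier A \<times> L" for p q r
      using that keys_diff[of "frag_of p - frag_of q" "frag_of r"] keys_diff[of "frag_of p" "frag_of q"] by fastforce
    have k2: "Poly_Mapping.keys (frag_of p - frag_of q) \<subseteq> carrier A \<times> L"
      if "p \<in> carrier A \<times> L" "q \<in> carrier A \<times> L" for p q
      using that keys_diff[of "frag_of p" "frag_of q"] by fastforce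
    consider (1) a a' b where "u = frag_of (a \<oplus>\<^bsub>A\<^esub> a', b) - frag_of (a, b) - frag_of (a', b)"
        "a \<in> carrier A" "a' \<in> carrier A" "b \<in> L"
      | (2) a b b' where "u = frag_of (a, b + b') - frag_of (a, b) - frag_of (a, b')"
        "a \<in> carrier A" "b \<in> L" "b' \<in> L"
      | (3) l a b where "u = frag_of (cA l \<otimes>\<^bsub>A\<^esub> a, b) - frag_of (a, \<iota> l * b)" "a \<in> carrier A" "b \<in> L"
      using u unfolding tensor_relations_def by auto
    then show ?thesis
    proof cases
      case 1
      have "frag_eval ?h u = 0"
        using 1 ring_hom_add[OF \<alpha>, of a a'] by (simp add: T distrib_right)
      moreover have "Poly_Mapping.keys u \<subseteq> carrier A \<times> L" unfolding 1(1) by (rule k3) (use 1 in auto)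
      ultimately show ?thesis ..
    next
      case 2
      have "frag_eval ?h u = 0" using 2 by (simp add: lf distrib_left)
      moreover have "Poly_Mapping.keys u \<subseteq> carrier A \<times> L"
        unfolding 2(1) by (rule k3) (use 2 subfld_add[OF L] in auto)
      ultimately show ?thesis ..
    next
      case 3
      have "frag_eval ?h u = 0"
        using 3 ring_hom_mult[OF \<alpha>, of "cA l" a] c by (simp add: T lf)
      moreover have "Poly_Mapping.keys u \<subseteq> carrier A \<times> L"
        unfolding 3(1) by (rule k2) (use 3 c subfld_mult[OF L] in auto)
      ultimately show ?thesis ..
    qed
  qed
  from z show ?thesis
  proof (induction rule: generate.induct)
    case (inv h)
    then show ?case using rel[of h] by simp
  qed (use rel in auto)
qed

lemma linear_functional:
  fixes \<iota> :: "'k::field \<Rightarrow> 'o::field"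
  assumes "\<iota> 1 = 1" "\<And>x y. \<iota> (x + y) = \<iota> x + \<iota> y" "\<And>x y. \<iota> (x * y) = \<iota> x * \<iota> y"
  obtains lf :: "'o \<Rightarrow> 'k" where "lf 1 = 1" "\<And>x y. lf (x + y) = lf x + lf y" "\<And>c x. lf (\<iota> c * x) = c * lf x"
proof -
  interpret vector_space_pair "\<lambda>c x. \<iota> c * x" "(*) :: 'k \<Rightarrow> 'k \<Rightarrow> 'k"
    by unfold_locales (auto simp: assms algebra_simps)
  have "vs1.independent {1}" by (simp add: vs1.dependent_single)
  from linear_independent_extend[OF this, of "\<lambda>_. 1"] obtain lf where
    lf: "Vector_Spaces.linear (\<lambda>c x. \<iota> c * x) (*) lf" "lf 1 = 1" by auto
  interpret lf: Vector_Spaces.linear "\<lambda>c x. \<iota> c * x" "(*)" lf by (rule lf(1))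
  show thesis by (rule that[OF lf(2) lf.add lf.scale])
qed

text \<open>A \<open>k\<close>-linear functional on \<open>kb\<close> that maps 1 to 1 induces a \<open>K\<close>-linear retraction \<open>\<psi>\<close> from \<open>F\<close> to \<open>K\<close>
  that maps \<open>kb\<close> to \<open>k\<close>. It fixes the elements of \<open>K \<inter> kb\<close>, which therefore lie in \<open>k\<close>, and it shows that
  \<open>K\<close> is closed under inversion, since \<open>y w = 1\<close> implies \<open>y \<psi>(w) = 1\<close>.\<close>

lemma tensor_product_tower:
  fixes \<iota> :: "'k::field \<Rightarrow> 'o::field" and A :: "('a, 'm) ring_scheme"
  assumes tp: "tensor_product cA A \<iota> (fld kb) (fld F) \<alpha> (\<lambda>x. x)" and A: "cring A"
    and \<iota>: "\<iota> 1 = 1" "\<And>x y. \<iota> (x + y) = \<iota> x + \<iota> y" "\<And>x y. \<iota> (x * y) = \<iota> x * \<iota> y"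
    and c: "\<And>l. cA l \<in> carrier A" and kb: "subfld kb" "range \<iota> \<subseteq> kb" and F: "subfld F"
  defines "K \<equiv> \<alpha> ` carrier A"
  shows "subfld K" "range \<iota> \<subseteq> K" "K \<inter> kb \<subseteq> range \<iota>" "F = lspan kb K"
proof -
  interpret A: cring A by (rule A)
  let ?S = "carrier A \<times> kb"
  define \<phi> where "\<phi> = (\<lambda>z :: 'a \<times> 'o \<Rightarrow>\<^sub>0 int. \<Oplus>\<^bsub>fld F\<^esub>ab\<in>Poly_Mapping.keys z.
                add_pow (fld F) (Poly_Mapping.lookup z ab) (\<alpha> (fst ab) \<otimes>\<^bsub>fld F\<^esub> snd ab))"
  have \<alpha>: "\<alpha> \<in> ring_hom A (fld F)" and kbF: "kb \<subseteq> F" and \<alpha>c: "\<And>l. \<alpha> (cA l) = \<iota> l"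
    and surj: "\<phi> ` carrier (free_Abelian_group ?S) = F"
    and ker: "\<And>z. z \<in> carrier (free_Abelian_group ?S) \<Longrightarrow> \<phi> z = 0 \<Longrightarrow>
      z \<in> generate (free_Abelian_group ?S) (tensor_relations cA A \<iota> (fld kb))"
    using tp unfolding tensor_product_def Let_def \<phi>_def by (auto simp: ring_hom_def)
  have \<alpha>F: "\<alpha> a \<in> F" if "a \<in> carrier A" for a using ring_hom_closed[OF \<alpha> that] by simp
  have \<phi>: "\<phi> z = frag_eval (\<lambda>(a, b). \<alpha> a * b) z" if "Poly_Mapping.keys z \<subseteq> ?S" for z
  proof -
    have mem: "\<alpha> (fst ab) * snd ab \<in> F" if "ab \<in> Poly_Mapping.keys z" for ab
    proof -
      have "ab \<in> ?S" using \<open>Poly_Mapping.keys z \<subseteq> ?S\<close> that by blast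
      then show ?thesis using kbF \<alpha>F by (intro subfld_mult[OF F]) (auto simp: mem_Times_iff)
    qed
    have cl: "of_int n * (\<alpha> (fst ab) * snd ab) \<in> F" if "ab \<in> Poly_Mapping.keys z" for n ab
      by (rule subfld_mult[OF F subfld_of_int[OF F] mem[OF that]])
    have ap: "add_pow (fld F) n (\<alpha> (fst ab) * snd ab) = of_int n * (\<alpha> (fst ab) * snd ab)"
      if "ab \<in> Poly_Mapping.keys z" for n :: int and ab
      by (rule fld_add_pow[OF F mem[OF that]])
    have "\<phi> z = (\<Sum>ab\<in>Poly_Mapping.keys z. add_pow (fld F) (Poly_Mapping.lookup z ab) (\<alpha> (fst ab) \<otimes>\<^bsub>fld F\<^esub> snd ab))"
      unfolding \<phi>_def by (rule fld_finsum[OF F]) (simp_all add: ap cl)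
    also have "\<dots> = (\<Sum>ab\<in>Poly_Mapping.keys z. of_int (Poly_Mapping.lookup z ab) * (\<alpha> (fst ab) * snd ab))"
      by (rule sum.cong) (simp_all add: ap)
    finally have "\<phi> z = (\<Sum>ab\<in>Poly_Mapping.keys z. of_int (Poly_Mapping.lookup z ab) * (\<alpha> (fst ab) * snd ab))" .
    then show ?thesis by (simp add: frag_eval_def case_prod_beta)
  qed
  obtain lf :: "'o \<Rightarrow> 'k" where lf: "lf 1 = 1" "\<And>x y. lf (x + y) = lf x + lf y" "\<And>c x. lf (\<iota> c * x) = c * lf x"
    using linear_functional[OF \<iota>] by metis
  have \<psi>: "frag_eval (\<lambda>(a, b). \<alpha> a * \<iota> (lf b)) z = 0"
    if "Poly_Mapping.keys z \<subseteq> ?S" "frag_eval (\<lambda>(a, b). \<alpha> a * b) z = 0" for z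
  proof -
    have "z \<in> generate (free_Abelian_group ?S) (tensor_relations cA A \<iota> (fld kb))"
      using ker[of z] that \<phi>[OF that(1)] by simp
    then show ?thesis
      by (rule tensor_relations_eval[OF A \<alpha> refl, rotated -1]) (use lf \<iota> \<alpha>c c kb in auto)
  qed
  have ops: "\<alpha> (a \<oplus>\<^bsub>A\<^esub> b) = \<alpha> a + \<alpha> b" "\<alpha> (a \<otimes>\<^bsub>A\<^esub> b) = \<alpha> a * \<alpha> b" if "a \<in> carrier A" "b \<in> carrier A" for a b
    using ring_hom_add[OF \<alpha> that] ring_hom_mult[OF \<alpha> that] by auto
  have \<alpha>1: "\<alpha> \<one>\<^bsub>A\<^esub> = 1" using ring_hom_one[OF \<alpha>] by simp
  have Kadd: "x + y \<in> K" if "x \<in> K" "y \<in> K" for x y using that ops(1) unfolding K_def by (auto simp flip: ops)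
  have Kmult: "x * y \<in> K" if "x \<in> K" "y \<in> K" for x y using that unfolding K_def by (auto simp flip: ops)
  show \<iota>K: "range \<iota> \<subseteq> K" using c \<alpha>c unfolding K_def by (metis image_iff image_subsetI rangeE subsetI)
  have K1: "1 \<in> K" using \<iota>K \<iota>(1) by (metis rangeI subsetD)
  have \<iota>0: "\<iota> 0 = 0" using \<iota>(2)[of 0 0] by (metis add.right_neutral add_left_cancel)
  have "\<iota> (- 1) = - 1" using \<iota>(2)[of 1 "- 1"] \<iota>(1) \<iota>0 by (simp add: add_eq_0_iff)
  then have Kneg: "- x \<in> K" if "x \<in> K" for x
    using Kmult[OF _ that, of "- 1"] \<iota>K by (metis mult_minus1 rangeI subsetD)
  have K0: "0 \<in> K" using \<iota>K \<iota>0 by (metis rangeI subsetD)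
  have Ksum: "sum f I \<in> K" if "\<And>i. i \<in> I \<Longrightarrow> f i \<in> K" for f :: "'o \<Rightarrow> 'o" and I
    using that by (induction I rule: infinite_finite_induct) (auto intro: K0 Kadd)
  show "K \<inter> kb \<subseteq> range \<iota>"
  proof
    fix x assume x: "x \<in> K \<inter> kb"
    then obtain a where a: "a \<in> carrier A" "x = \<alpha> a" by (auto simp: K_def)
    define z where "z = frag_of (a, 1 :: 'o) - frag_of (\<one>\<^bsub>A\<^esub>, x)"
    have "Poly_Mapping.keys z \<subseteq> ?S"
      using keys_diff[of "frag_of (a, 1 :: 'o)" "frag_of (\<one>\<^bsub>A\<^esub>, x)"] a x subfld_1[OF kb(1)] by (auto simp: z_def)
    then have "frag_eval (\<lambda>(a, b). \<alpha> a * \<iota> (lf b)) z = 0"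
      by (rule \<psi>) (simp add: z_def a \<alpha>1)
    then have "x = \<iota> (lf x)" by (simp add: z_def a \<alpha>1 lf(1) \<iota>(1))
    then show "x \<in> range \<iota>" by (rule range_eqI)
  qed
  have KF: "K \<subseteq> F" using \<alpha>F by (auto simp: K_def)
  show Fspan: "F = lspan kb K"
  proof
    show "lspan kb K \<subseteq> F" by (rule lspan_least[OF F kbF KF])
    show "F \<subseteq> lspan kb K"
    proof
      fix x assume "x \<in> F"
      then obtain z where z: "Poly_Mapping.keys z \<subseteq> ?S" "x = \<phi> z" using surj by force
      have "of_int n * b \<in> kb" if "b \<in> kb" for n b
        by (rule subfld_mult[OF kb(1) subfld_of_int[OF kb(1)] that])
      then have t: "of_int (Poly_Mapping.lookup z ab) * (\<alpha> (fst ab) * snd ab) \<in> lspan kb K" if "ab \<in> Poly_Mapping.keys z" for ab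
        using lspan_term[of "of_int (Poly_Mapping.lookup z ab) * snd ab" kb "\<alpha> (fst ab)" K] z(1) that
        by (auto simp: K_def mult_ac)
      have "(\<Sum>ab\<in>I. of_int (Poly_Mapping.lookup z ab) * (\<alpha> (fst ab) * snd ab)) \<in> lspan kb K"
        if "I \<subseteq> Poly_Mapping.keys z" for I
        using that by (induction I rule: infinite_finite_induct) (auto intro: lspan_0 lspan_add[OF kb(1)] t)
      then show "x \<in> lspan kb K" by (simp add: z(2) \<phi>[OF z(1)] frag_eval_def case_prod_beta)
    qed
  qed
  show "subfld K"
  proof (rule subfldI)
    fix y assume y: "y \<in> K" "y \<noteq> 0"
    then obtain a where a: "a \<in> carrier A" "y = \<alpha> a" by (auto simp: K_def)
    have "inverse y \<in> F" using y KF subfld_inverse[OF F] by blast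
    then obtain I f where If: "finite I" "I \<subseteq> K" "\<forall>x\<in>I. f x \<in> kb" "inverse y = (\<Sum>x\<in>I. f x * x)"
      using Fspan unfolding lspan_def by blast
    have "\<forall>x\<in>I. \<exists>b. b \<in> carrier A \<and> \<alpha> b = x" using If(2) by (auto simp: K_def)
    then obtain s where s: "\<And>x. x \<in> I \<Longrightarrow> s x \<in> carrier A \<and> \<alpha> (s x) = x" by metis
    define z where "z = (\<Sum>x\<in>I. frag_of (a \<otimes>\<^bsub>A\<^esub> s x, f x)) - frag_of (\<one>\<^bsub>A\<^esub>, 1)"
    have "(\<Sum>x\<in>I. frag_of (a \<otimes>\<^bsub>A\<^esub> s x, f x)) \<in> carrier (free_Abelian_group ?S)"
      by (rule sum_closed_free_Abelian_group) (use s If a in auto)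
    then have "Poly_Mapping.keys z \<subseteq> ?S"
      using keys_diff[of "\<Sum>x\<in>I. frag_of (a \<otimes>\<^bsub>A\<^esub> s x, f x)" "frag_of (\<one>\<^bsub>A\<^esub>, 1)"] subfld_1[OF kb(1)]
      by (fastforce simp: z_def)
    moreover have "frag_eval (\<lambda>(a, b). \<alpha> a * b) z = y * (\<Sum>x\<in>I. f x * x) - 1"
      unfolding sum_distrib_left
      by (simp add: z_def frag_eval_sum \<alpha>1) (rule sum.cong, use s a in \<open>auto simp: ops\<close>)
    ultimately have "frag_eval (\<lambda>(a, b). \<alpha> a * \<iota> (lf b)) z = 0"
      using If(4)[symmetric] y(2) by (intro \<psi>) auto
    moreover have "frag_eval (\<lambda>(a, b). \<alpha> a * \<iota> (lf b)) z = y * (\<Sum>x\<in>I. \<iota> (lf (f x)) * x) - 1"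
      unfolding sum_distrib_left
      by (simp add: z_def frag_eval_sum \<alpha>1 lf(1) \<iota>(1)) (rule sum.cong, use s a in \<open>auto simp: ops\<close>)
    ultimately have "inverse y = (\<Sum>x\<in>I. \<iota> (lf (f x)) * x)" by (simp add: inverse_unique)
    also have "\<dots> \<in> K" using If(2) \<iota>K by (intro Ksum Kmult) auto
    finally show "inverse y \<in> K" .
  qed (use K1 Kadd Kmult Kneg in \<open>auto simp: diff_conv_add_uminus simp del: add_uminus_conv_diff\<close>)
qed

section \<open>Galois groups and restrictions of automorphisms\<close>

lemma Gal_iff:
  "\<sigma> \<in> carrier (Gal L E) \<longleftrightarrow> \<sigma> \<in> Bij L \<and> \<sigma> 1 = 1 \<and>
    (\<forall>x\<in>L. \<forall>y\<in>L. \<sigma> (x * y) = \<sigma> x * \<sigma> y \<and> \<sigma> (x + y) = \<sigma> x + \<sigma> y) \<and> (\<forall>x\<in>E. \<sigma> x = x)"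
proof
  assume "\<sigma> \<in> carrier (Gal L E)"
  then show "\<sigma> \<in> Bij L \<and> \<sigma> 1 = 1 \<and>
    (\<forall>x\<in>L. \<forall>y\<in>L. \<sigma> (x * y) = \<sigma> x * \<sigma> y \<and> \<sigma> (x + y) = \<sigma> x + \<sigma> y) \<and> (\<forall>x\<in>E. \<sigma> x = x)"
    by (simp add: Gal_def ring_hom_def)
next
  assume *: "\<sigma> \<in> Bij L \<and> \<sigma> 1 = 1 \<and>
    (\<forall>x\<in>L. \<forall>y\<in>L. \<sigma> (x * y) = \<sigma> x * \<sigma> y \<and> \<sigma> (x + y) = \<sigma> x + \<sigma> y) \<and> (\<forall>x\<in>E. \<sigma> x = x)"
  then have "\<sigma> \<in> L \<rightarrow> L" using Bij_imp_funcset by blast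
  then show "\<sigma> \<in> carrier (Gal L E)" using * by (simp add: Gal_def ring_hom_def)
qed

lemma Gal_mult: "\<sigma> \<in> carrier (Gal L E) \<Longrightarrow> \<tau> \<in> carrier (Gal L E) \<Longrightarrow> \<sigma> \<otimes>\<^bsub>Gal L E\<^esub> \<tau> = compose L \<sigma> \<tau>"
  by (simp add: Gal_def BijGroup_def)

lemma Gal_one: "\<one>\<^bsub>Gal L E\<^esub> = (\<lambda>x\<in>L. x)"
  by (simp add: Gal_def BijGroup_def)

lemma Gal_hom: "\<sigma> \<in> carrier (Gal L E) \<Longrightarrow> hom_on L \<sigma>"
  by (simp add: Gal_iff hom_on_def)

lemma Gal_closed: "\<sigma> \<in> carrier (Gal L E) \<Longrightarrow> x \<in> L \<Longrightarrow> \<sigma> x \<in> L"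
  using Bij_imp_funcset by (fastforce simp: Gal_iff)

lemma Gal_extensional: "\<sigma> \<in> carrier (Gal L E) \<Longrightarrow> \<sigma> \<in> extensional L"
  using Bij_imp_extensional by (auto simp: Gal_iff)

lemma restrict_Gal:
  assumes g: "g \<in> Aut E" "g ` L = L" and L: "subfld L" "E \<subseteq> L"
  shows "restrict g L \<in> carrier (Gal L E)"
proof -
  have "bij_betw (restrict g L) L L"
    using g(2) Aut_simps(12)[OF g(1)] by (auto simp: bij_betw_def inj_on_def)
  then have "restrict g L \<in> Bij L" by (simp add: Bij_def)
  then show ?thesis
    using L(2) by (auto simp: Gal_iff subfld_1[OF L(1)] subfld_add[OF L(1)] subfld_mult[OF L(1)]
        Aut_simps(2,3,4)[OF g(1)] Aut_fixes[OF g(1)])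
qed

lemma openin_krull:
  assumes U: "U \<subseteq> carrier (Gal L E)"
    and nbhd: "\<And>\<sigma>. \<sigma> \<in> U \<Longrightarrow> \<exists>S. finite S \<and> S \<subseteq> L \<and>
      (\<forall>\<tau>\<in>carrier (Gal L E). (\<forall>x\<in>S. \<tau> x = \<sigma> x) \<longrightarrow> \<tau> \<in> U)"
  shows "openin (krull L E) U"
proof (rule openin_subopen[THEN iffD2], rule ballI)
  fix \<sigma> assume \<sigma>: "\<sigma> \<in> U"
  from nbhd[OF this] obtain S where "finite S \<and> S \<subseteq> L \<and>
    (\<forall>\<tau>\<in>carrier (Gal L E). (\<forall>x\<in>S. \<tau> x = \<sigma> x) \<longrightarrow> \<tau> \<in> U)" ..
  then have S: "finite S" "S \<subseteq> L" "\<And>\<tau>. \<tau> \<in> carrier (Gal L E) \<Longrightarrow> \<forall>x\<in>S. \<tau> x = \<sigma> x \<Longrightarrow> \<tau> \<in> U"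
    by auto
  have \<sigma>G: "\<sigma> \<in> carrier (Gal L E)" using U \<sigma> by blast
  define T where "T = PiE L (\<lambda>x. if x \<in> S then {\<sigma> x} else L)"
  have "openin (product_topology (\<lambda>_. discrete_topology L) L) T"
    unfolding T_def openin_PiE_gen
  proof (rule disjI2, rule conjI)
    show "finite {i \<in> L. (if i \<in> S then {\<sigma> i} else L) \<noteq> topspace (discrete_topology L)}"
      by (rule finite_subset[OF _ S(1)]) auto
    show "\<forall>i\<in>L. openin (discrete_topology L) (if i \<in> S then {\<sigma> i} else L)"
      using Gal_closed[OF \<sigma>G] by auto
  qed
  then have "openin (krull L E) (T \<inter> carrier (Gal L E))"
    unfolding krull_def by (rule openin_subtopology_Int)
  moreover have "\<sigma> \<in> T \<inter> carrier (Gal L E)"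
    using \<sigma>G Gal_closed[OF \<sigma>G] Gal_extensional[OF \<sigma>G] by (auto simp: T_def PiE_def)
  moreover have "T \<inter> carrier (Gal L E) \<subseteq> U"
  proof
    fix \<tau> assume \<tau>: "\<tau> \<in> T \<inter> carrier (Gal L E)"
    have "\<tau> x = \<sigma> x" if "x \<in> S" for x
      using \<tau> that S(2) PiE_mem[of \<tau> L "\<lambda>x. if x \<in> S then {\<sigma> x} else L" x] by (auto simp: T_def)
    then show "\<tau> \<in> U" using S(3) \<tau> by blast
  qed
  ultimately show "\<exists>V. openin (krull L E) V \<and> \<sigma> \<in> V \<and> V \<subseteq> U" by blast
qed

lemma topspace_krull: "topspace (krull L E) = carrier (Gal L E)"
proof -
  have "carrier (Gal L E) \<subseteq> PiE L (\<lambda>_. L)"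
    unfolding PiE_iff subset_iff using Gal_closed[of _ L E] Gal_extensional[of _ L E] by blast
  then show ?thesis by (auto simp: krull_def)
qed

section \<open>From the elementary obstruction to an equivariant retraction\<close>

lemma comm_group_with_action:
  assumes "comm_group M"
  shows "comm_group (with_action M a)"
proof -
  interpret M: comm_group M by (rule assms)
  show ?thesis
    by (rule comm_groupI) (auto simp: with_action_def M.m_assoc M.m_comm M.m_lcomm intro!: bexI[of _ "inv\<^bsub>M\<^esub> _"])
qed

lemma comm_group_DirProd:
  assumes "comm_group M" "comm_group N"
  shows "comm_group (M \<times>\<times> N)"
proof -
  interpret M: comm_group M by (rule assms)
  interpret N: comm_group N by (rule assms)
  show ?thesis
    by (rule comm_groupI)
      (auto simp: M.m_assoc N.m_assoc M.m_comm N.m_comm M.m_lcomm N.m_lcomm mult_DirProd' intro!: bexI[of _ "(inv\<^bsub>M\<^esub> _, inv\<^bsub>N\<^esub> _)"])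
qed

lemma comm_group_units:
  assumes L: "subfld L"
  shows "comm_group (mult_of (fld L))"
proof (rule comm_groupI)
  fix x assume "x \<in> carrier (mult_of (fld L))"
  then show "\<exists>y\<in>carrier (mult_of (fld L)). y \<otimes>\<^bsub>mult_of (fld L)\<^esub> x = \<one>\<^bsub>mult_of (fld L)\<^esub>"
    using subfld_inverse[OF L, of x] by (intro bexI[of _ "inverse x"]) auto
qed (auto simp: subfld_1[OF L] subfld_mult[OF L])

context sep_tower
begin

text \<open>Some automorphism of the ambient field over \<open>K\<close> that induces \<open>\<sigma>\<close> on \<open>kb\<close>. Its effect on \<open>F\<close> is
  determined by \<open>\<sigma>\<close>.\<close>

definition lift :: "('o \<Rightarrow> 'o) \<Rightarrow> 'o \<Rightarrow> 'o" where
  "lift \<sigma> = (SOME g. g \<in> Aut K \<and> (\<forall>x\<in>kb. g x = \<sigma> x))"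

lemma lift:
  assumes "\<sigma> \<in> carrier (Gal kb k)"
  shows "lift \<sigma> \<in> Aut K" "\<And>x. x \<in> kb \<Longrightarrow> lift \<sigma> x = \<sigma> x"
proof -
  have "\<exists>g. g \<in> Aut K \<and> (\<forall>x\<in>kb. g x = \<sigma> x)"
    using extend_constants[OF K order_refl K_kb Gal_hom[OF assms]] assms by (metis Gal_iff)
  from someI_ex[OF this] show "lift \<sigma> \<in> Aut K" "\<And>x. x \<in> kb \<Longrightarrow> lift \<sigma> x = \<sigma> x"
    unfolding lift_def by blast+
qed

lemma Aut_agree:
  assumes "g \<in> Aut M" "h \<in> Aut M" "\<And>x. x \<in> kb \<Longrightarrow> g x = h x" "x \<in> lspan kb M"
  shows "g x = h x"
  using assms(4)
proof (induction rule: lspan_induct)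
  case zero
  then show ?case using Aut_simps(1) assms(1,2) by metis
next
  case (add a y u)
  then show ?case
    using assms(3)[of a] Aut_fixes[OF assms(1), of y] Aut_fixes[OF assms(2), of y]
    by (simp add: Aut_simps(3,4)[OF assms(1)] Aut_simps(3,4)[OF assms(2)])
qed

lemma Aut_agree_F:
  "g \<in> Aut K \<Longrightarrow> h \<in> Aut K \<Longrightarrow> (\<And>x. x \<in> kb \<Longrightarrow> g x = h x) \<Longrightarrow> x \<in> F \<Longrightarrow> g x = h x"
  using Aut_agree[of g K h x] F_eq by blast

lemma restrict_kb: "g \<in> Aut K \<Longrightarrow> restrict g kb \<in> carrier (Gal kb k)"
  using restrict_Gal[OF Aut_K_k Aut_kb kb k_kb] .

lemma second_factor_action:
  assumes \<sigma>: "\<sigma> \<in> carrier (Gal kb k)"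
  shows "second_factor_action kb K F \<sigma> = restrict (lift \<sigma>) F"
  unfolding second_factor_action_def
proof (rule the_equality)
  note l = lift[OF \<sigma>]
  show "restrict (lift \<sigma>) F \<in> carrier (Gal F K) \<and> (\<forall>x\<in>kb. restrict (lift \<sigma>) F x = \<sigma> x)"
    using restrict_Gal[OF l(1) Aut_F[OF l(1)] F K_F] l(2) kb_F by auto
  fix \<tau> assume \<tau>: "\<tau> \<in> carrier (Gal F K) \<and> (\<forall>x\<in>kb. \<tau> x = \<sigma> x)"
  then have h: "hom_on F \<tau>" using Gal_hom by blast
  have "\<tau> x = lift \<sigma> x \<and> x \<in> F" if "x \<in> lspan kb K" for x
    using that
  proof (induction rule: lspan_induct)
    case zero
    then show ?case using hom_on_0[OF F h] Aut_simps(1)[OF l(1)] subfld_0[OF F] by simp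
  next
    case (add a y u)
    have ay: "a \<in> F" "y \<in> F" "a * y \<in> F" using add kb_F K_F subfld_mult[OF F] by auto
    have "\<tau> y = y" using \<tau> add(2) by (simp add: Gal_iff)
    then have "\<tau> (a * y + u) = \<sigma> a * y + lift \<sigma> u"
      using add ay \<tau> by (simp add: hom_on_add[OF F h] hom_on_mult[OF F h])
    moreover have "lift \<sigma> (a * y + u) = \<sigma> a * y + lift \<sigma> u"
      using add by (simp add: Aut_simps(3,4)[OF l(1)] l(2) Aut_fixes[OF l(1)])
    ultimately show ?case using add ay subfld_add[OF F] by simp
  qed
  then show "\<tau> = restrict (lift \<sigma>) F"
    using Gal_extensional[of \<tau> F K] \<tau> F_eq by (intro extensionalityI[of _ F]) auto
qed

lemma lift_mult:
  assumes "\<sigma> \<in> carrier (Gal kb k)" "\<tau> \<in> carrier (Gal kb k)" "x \<in> F"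
  shows "\<sigma> \<otimes>\<^bsub>Gal kb k\<^esub> \<tau> \<in> carrier (Gal kb k)" "lift (\<sigma> \<otimes>\<^bsub>Gal kb k\<^esub> \<tau>) x = lift \<sigma> (lift \<tau> x)"
proof -
  have c: "(\<lambda>x. lift \<sigma> (lift \<tau> x)) \<in> Aut K" using Aut_comp lift(1) assms(1,2) by blast
  have eq: "\<sigma> \<otimes>\<^bsub>Gal kb k\<^esub> \<tau> = restrict (\<lambda>x. lift \<sigma> (lift \<tau> x)) kb"
    using assms(1,2) Gal_closed[OF assms(2)] by (auto simp: Gal_mult compose_def lift restrict_def)
  show 1: "\<sigma> \<otimes>\<^bsub>Gal kb k\<^esub> \<tau> \<in> carrier (Gal kb k)" unfolding eq by (rule restrict_kb[OF c])
  show "lift (\<sigma> \<otimes>\<^bsub>Gal kb k\<^esub> \<tau>) x = lift \<sigma> (lift \<tau> x)"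
    by (rule Aut_agree_F[OF lift(1)[OF 1] c _ assms(3)]) (simp add: lift(2)[OF 1], simp add: eq)
qed

lemma lift_one: "x \<in> F \<Longrightarrow> lift \<one>\<^bsub>Gal kb k\<^esub> x = x"
proof -
  assume x: "x \<in> F"
  have 1: "\<one>\<^bsub>Gal kb k\<^esub> \<in> carrier (Gal kb k)" using restrict_kb[OF Aut_id] by (simp add: Gal_one)
  show ?thesis
    by (rule Aut_agree_F[OF lift(1)[OF 1] Aut_id _ x]) (simp add: lift(2)[OF 1], simp add: Gal_one)
qed

lemma lift_units: "\<sigma> \<in> carrier (Gal kb k) \<Longrightarrow> x \<in> F - {0} \<Longrightarrow> lift \<sigma> x \<in> F - {0}"
  using Aut_F[OF lift(1)] Aut_simps(1,12)[OF lift(1)] by (metis Diff_iff imageI singletonD singletonI)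

lemma lift_constants: "\<sigma> \<in> carrier (Gal kb k) \<Longrightarrow> lift \<sigma> ` (kb - {0}) = kb - {0}"
  using Aut_kb[OF lift(1)] Aut_simps(1,12)[OF lift(1)]
  by (subst image_set_diff) (auto simp: inj_def)

lemma lift_locally_constant:
  assumes "x \<in> F"
  obtains S where "finite S" "S \<subseteq> kb"
    "\<And>\<sigma> \<tau>. \<sigma> \<in> carrier (Gal kb k) \<Longrightarrow> \<tau> \<in> carrier (Gal kb k) \<Longrightarrow> \<forall>y\<in>S. \<tau> y = \<sigma> y \<Longrightarrow> lift \<tau> x = lift \<sigma> x"
proof -
  obtain I f where If: "finite I" "I \<subseteq> K" "\<forall>x\<in>I. f x \<in> kb" "x = (\<Sum>x\<in>I. f x * x)"
    using assms unfolding F_eq lspan_def by blast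
  have eq: "lift \<sigma> x = (\<Sum>x\<in>I. \<sigma> (f x) * x)" if "\<sigma> \<in> carrier (Gal kb k)" for \<sigma>
    unfolding If(4) Aut_simps(10)[OF lift(1)[OF that]]
    by (rule sum.cong) (use If(2,3) lift[OF that] in \<open>auto simp: Aut_simps(4)[OF lift(1)[OF that]] Aut_def\<close>)
  show thesis
    by (rule that[of "f ` I"]) (use If(1,3) in \<open>auto simp: eq\<close>)
qed

abbreviation "G_k \<equiv> Gal kb k"
abbreviation "coset x \<equiv> (kb - {0}) #>\<^bsub>mult_of (fld F)\<^esub> x"

lemma constants_normal: "normal (kb - {0}) (mult_of (fld F))"
proof -
  interpret U: comm_group "mult_of (fld F)" by (rule comm_group_units[OF F])
  have inv: "inv\<^bsub>mult_of (fld F)\<^esub> x = inverse x" if "x \<in> F - {0}" for x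
    using that subfld_inverse[OF F] by (intro U.inv_equality) auto
  have "subgroup (kb - {0}) (mult_of (fld F))"
  proof (rule U.subgroupI)
    show "kb - {0} \<subseteq> carrier (mult_of (fld F))" using kb_F by auto
    have "1 \<in> kb - {0}" using subfld_1[OF kb] by simp
    then show "kb - {0} \<noteq> {}" by blast
    show "inv\<^bsub>mult_of (fld F)\<^esub> a \<in> kb - {0}" if "a \<in> kb - {0}" for a
      using that kb_F inv[of a] subfld_inverse[OF kb, of a] by auto
    show "a \<otimes>\<^bsub>mult_of (fld F)\<^esub> b \<in> kb - {0}" if "a \<in> kb - {0}" "b \<in> kb - {0}" for a b
      using that subfld_mult[OF kb, of a b] by auto
  qed
  then show ?thesis by (rule U.subgroup_imp_normal)
qed

lemma action_coset:
  assumes \<sigma>: "\<sigma> \<in> carrier G_k" and x: "x \<in> F - {0}"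
  shows "second_factor_action kb K F \<sigma> ` coset x = coset (lift \<sigma> x)"
proof -
  have cs: "coset y = (\<lambda>b. b * y) ` (kb - {0})" for y by (auto simp: r_coset_def)
  have "coset x \<subseteq> F" using x kb_F subfld_mult[OF F] by (auto simp: cs)
  then have "second_factor_action kb K F \<sigma> ` coset x = lift \<sigma> ` coset x"
    unfolding second_factor_action[OF \<sigma>] by (intro image_cong) auto
  also have "\<dots> = (\<lambda>b. b * lift \<sigma> x) ` (lift \<sigma> ` (kb - {0}))"
    by (simp add: cs image_image Aut_simps(4)[OF lift(1)[OF \<sigma>]])
  also have "\<dots> = coset (lift \<sigma> x)" by (simp add: lift_constants[OF \<sigma>] cs)
  finally show ?thesis .
qed

lemma discrete_constants: "discrete_module G_k (krull kb k) (constants_module kb)"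
  unfolding discrete_module_def
proof (intro conjI ballI)
  have car: "carrier (constants_module kb) = kb - {0}" and act: "act (constants_module kb) = (\<lambda>\<sigma> x. \<sigma> x)"
    by (simp_all add: constants_module_def with_action_def)
  show "comm_group (constants_module kb)"
    unfolding constants_module_def by (rule comm_group_with_action[OF comm_group_units[OF kb]])
  fix \<sigma> assume \<sigma>: "\<sigma> \<in> carrier G_k"
  show "act (constants_module kb) \<sigma> \<in> hom (constants_module kb) (constants_module kb)"
  proof (rule homI)
    fix x assume x: "x \<in> carrier (constants_module kb)"
    then show "act (constants_module kb) \<sigma> x \<in> carrier (constants_module kb)"
      using Gal_closed[OF \<sigma>, of x] hom_on_inj[OF kb Gal_hom[OF \<sigma>], of x] unfolding car act by blast
    fix y assume "y \<in> carrier (constants_module kb)"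
    then show "act (constants_module kb) \<sigma> (x \<otimes>\<^bsub>constants_module kb\<^esub> y) =
        act (constants_module kb) \<sigma> x \<otimes>\<^bsub>constants_module kb\<^esub> act (constants_module kb) \<sigma> y"
      using x hom_on_mult[OF kb Gal_hom[OF \<sigma>]] unfolding car act
      by (simp add: constants_module_def with_action_def)
  qed
  fix \<tau> m assume "\<tau> \<in> carrier G_k" "m \<in> carrier (constants_module kb)"
  then show "act (constants_module kb) (\<sigma> \<otimes>\<^bsub>G_k\<^esub> \<tau>) m = act (constants_module kb) \<sigma> (act (constants_module kb) \<tau> m)"
    using \<sigma> by (simp add: act car Gal_mult compose_def)
next
  fix m assume m: "m \<in> carrier (constants_module kb)"
  then have mkb: "m \<in> kb" by (simp add: constants_module_def with_action_def)
  then show "act (constants_module kb) \<one>\<^bsub>G_k\<^esub> m = m"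
    by (simp add: constants_module_def with_action_def Gal_one)
  show "openin (krull kb k) {g \<in> carrier G_k. act (constants_module kb) g m = m}"
  proof (rule openin_krull)
    fix \<sigma> assume "\<sigma> \<in> {g \<in> carrier G_k. act (constants_module kb) g m = m}"
    then show "\<exists>S. finite S \<and> S \<subseteq> kb \<and> (\<forall>\<tau>\<in>carrier G_k. (\<forall>x\<in>S. \<tau> x = \<sigma> x) \<longrightarrow>
        \<tau> \<in> {g \<in> carrier G_k. act (constants_module kb) g m = m})"
      using mkb by (intro exI[of _ "{m}"]) (simp add: constants_module_def with_action_def)
  qed simp
qed

lemma discrete_quotient: "discrete_module G_k (krull kb k) (quotient_module kb K F)"
proof -
  let ?C = "quotient_module kb K F"
  interpret normal "kb - {0}" "mult_of (fld F)" by (rule constants_normal)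
  have car: "carrier ?C = {coset x |x. x \<in> F - {0}}"
    by (auto simp: quotient_module_def with_action_def FactGroup_def RCOSETS_def)
  have act: "act ?C \<sigma> (coset x) = coset (lift \<sigma> x)" if "\<sigma> \<in> carrier G_k" "x \<in> F - {0}" for \<sigma> x
    using action_coset[OF that] by (simp add: quotient_module_def with_action_def)
  have mult: "coset x \<otimes>\<^bsub>?C\<^esub> coset y = coset (x * y)" if "x \<in> F - {0}" "y \<in> F - {0}" for x y
    using rcos_sum[of x y] that by (simp add: quotient_module_def with_action_def)
  show ?thesis
    unfolding discrete_module_def
  proof (intro conjI ballI)
    show "comm_group ?C"
      unfolding quotient_module_def
      by (rule comm_group_with_action[OF comm_group.abelian_FactGroup[OF comm_group_units[OF F] is_subgroup]])
    fix \<sigma> assume \<sigma>: "\<sigma> \<in> carrier G_k"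
    show "act ?C \<sigma> \<in> hom ?C ?C"
    proof (rule homI)
      fix S assume "S \<in> carrier ?C"
      then obtain x where x: "S = coset x" "x \<in> F - {0}" by (auto simp: car)
      then show "act ?C \<sigma> S \<in> carrier ?C"
        using act[OF \<sigma> x(2)] lift_units[OF \<sigma> x(2)] car by blast
      fix S' assume "S' \<in> carrier ?C"
      then obtain y where y: "S' = coset y" "y \<in> F - {0}" by (auto simp: car)
      have xy: "x * y \<in> F - {0}" using x y subfld_mult[OF F] by auto
      show "act ?C \<sigma> (S \<otimes>\<^bsub>?C\<^esub> S') = act ?C \<sigma> S \<otimes>\<^bsub>?C\<^esub> act ?C \<sigma> S'"
        using mult[OF x(2) y(2)] act[OF \<sigma> xy] act[OF \<sigma> x(2)] act[OF \<sigma> y(2)]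
          mult[OF lift_units[OF \<sigma> x(2)] lift_units[OF \<sigma> y(2)]]
        by (simp add: x(1) y(1) Aut_simps(4)[OF lift(1)[OF \<sigma>]])
    qed
    fix \<tau> S assume \<tau>: "\<tau> \<in> carrier G_k" and "S \<in> carrier ?C"
    then obtain x where x: "S = coset x" "x \<in> F - {0}" by (auto simp: car)
    then have xF: "x \<in> F" by simp
    show "act ?C (\<sigma> \<otimes>\<^bsub>G_k\<^esub> \<tau>) S = act ?C \<sigma> (act ?C \<tau> S)"
      using act[OF lift_mult(1)[OF \<sigma> \<tau> xF] x(2)] act[OF \<tau> x(2)] act[OF \<sigma> lift_units[OF \<tau> x(2)]]
        lift_mult(2)[OF \<sigma> \<tau> xF] by (simp add: x(1))
  next
    fix S assume "S \<in> carrier ?C"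
    then obtain x where x: "S = coset x" "x \<in> F - {0}" by (auto simp: car)
    then have xF: "x \<in> F" by simp
    have 1: "\<one>\<^bsub>G_k\<^esub> \<in> carrier G_k" using restrict_kb[OF Aut_id] by (simp add: Gal_one)
    show "act ?C \<one>\<^bsub>G_k\<^esub> S = S" using act[OF 1 x(2)] lift_one[OF xF] by (simp add: x(1))
    show "openin (krull kb k) {g \<in> carrier G_k. act ?C g S = S}"
    proof (rule openin_krull)
      obtain J where J: "finite J" "J \<subseteq> kb"
        "\<And>\<sigma> \<tau>. \<sigma> \<in> carrier G_k \<Longrightarrow> \<tau> \<in> carrier G_k \<Longrightarrow> \<forall>y\<in>J. \<tau> y = \<sigma> y \<Longrightarrow> lift \<tau> x = lift \<sigma> x"
        using lift_locally_constant[OF xF] by metis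
      fix \<sigma> assume \<sigma>: "\<sigma> \<in> {g \<in> carrier G_k. act ?C g S = S}"
      have "act ?C \<tau> S = S" if \<tau>: "\<tau> \<in> carrier G_k" "\<forall>y\<in>J. \<tau> y = \<sigma> y" for \<tau>
      proof -
        have \<sigma>G: "\<sigma> \<in> carrier G_k" using \<sigma> by blast
        have "act ?C \<tau> S = act ?C \<sigma> S"
          unfolding x(1) act[OF \<tau>(1) x(2)] act[OF \<sigma>G x(2)] J(3)[OF \<sigma>G \<tau>] ..
        then show ?thesis using \<sigma> by simp
      qed
      then show "\<exists>J. finite J \<and> J \<subseteq> kb \<and> (\<forall>\<tau>\<in>carrier G_k. (\<forall>x\<in>J. \<tau> x = \<sigma> x) \<longrightarrow> \<tau> \<in> {g \<in> carrier G_k. act ?C g S = S})"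
        using J(1,2) by (intro exI[of _ J]) simp
    qed simp
  qed
qed

text \<open>An equality of extension classes is informative only if these are not empty: the split
  extension belongs to its own class because it is an extension of discrete modules.\<close>

lemma split_is_extension:
  assumes A: "discrete_module G T A" and C: "discrete_module G T C"
    and T: "topspace T = carrier G"
  shows "is_extension G T C A (split_extension C A)"
proof -
  interpret A: comm_group A using A by (simp add: discrete_module_def)
  interpret C: comm_group C using C by (simp add: discrete_module_def)
  let ?B = "with_action (A \<times>\<times> C) (\<lambda>g (a, c). (act A g a, act C g c))"
  have homA: "act A g \<in> hom A A" and homC: "act C g \<in> hom C C" if "g \<in> carrier G" for g
    using that A C by (auto simp: discrete_module_def)
  have "discrete_module G T ?B"
    unfolding discrete_module_def
  proof (intro conjI ballI)
    show "comm_group ?B"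
      by (intro comm_group_with_action comm_group_DirProd A.comm_group_axioms C.comm_group_axioms)
    fix g assume g: "g \<in> carrier G"
    show "act ?B g \<in> hom ?B ?B"
      using homA[OF g] homC[OF g] by (auto simp: with_action_def hom_def Pi_def)
    fix h m assume "h \<in> carrier G" "m \<in> carrier ?B"
    then show "act ?B (g \<otimes>\<^bsub>G\<^esub> h) m = act ?B g (act ?B h m)"
      using A C g by (auto simp: with_action_def discrete_module_def)
  next
    fix m assume m: "m \<in> carrier ?B"
    then show "act ?B \<one>\<^bsub>G\<^esub> m = m" using A C by (auto simp: with_action_def discrete_module_def)
    have eq: "{g \<in> carrier G. act ?B g m = m} = {g \<in> carrier G. act A g (fst m) = fst m} \<inter> {g \<in> carrier G. act C g (snd m) = snd m}"
      by (cases m) (auto simp: with_action_def)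
    have "openin T {g \<in> carrier G. act A g (fst m) = fst m}" "openin T {g \<in> carrier G. act C g (snd m) = snd m}"
      using A C m by (auto simp: with_action_def discrete_module_def)
    then show "openin T {g \<in> carrier G. act ?B g m = m}" unfolding eq by (rule openin_Int)
  qed
  moreover have act1: "act C g \<one>\<^bsub>C\<^esub> = \<one>\<^bsub>C\<^esub>" if "g \<in> carrier G" for g
    using hom_one[OF homC[OF that] C.is_group C.is_group] .
  have "(\<lambda>a. (a, \<one>\<^bsub>C\<^esub>)) \<in> module_hom G A ?B"
    by (simp add: module_hom_def hom_def with_action_def act1)
  moreover have "snd \<in> module_hom G ?B C"
    by (simp add: module_hom_def hom_def with_action_def case_prod_beta mem_Times_iff Pi_def mult_DirProd')
  moreover have "snd ` carrier ?B = carrier C"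
    using A.one_closed by (simp add: with_action_def) blast
  moreover have "(\<lambda>a. (a, \<one>\<^bsub>C\<^esub>)) ` carrier A = {b \<in> carrier ?B. snd b = \<one>\<^bsub>C\<^esub>}"
    by (auto simp: with_action_def)
  ultimately show ?thesis
    using A C unfolding is_extension_def split_extension_def by (auto simp: inj_on_def)
qed

text \<open>The split extension belongs to the class of the extension \<open>F\<^sup>\<star>\<close>. The first component of an
  equivalence between the two is the retraction.\<close>

theorem retraction_of_vanishing_obstruction:
  assumes ob: "elementary_obstruction k kb K F = \<one>\<^bsub>Ext1_units k kb K F\<^esub>"
  obtains r where "kummer_retraction k kb K F r"
proof -
  let ?A = "constants_module kb" and ?B = "functions_module kb K F" and ?C = "quotient_module kb K F"
  let ?S = "split_extension ?C ?A"
  let ?P = "with_action (?A \<times>\<times> ?C) (\<lambda>g (a, c). (act ?A g a, act ?C g c))"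
  have "ext_equivalent G_k ?A ?S ?S"
  proof -
    have "(\<lambda>x. x) \<in> module_hom G_k ?P ?P" by (simp add: module_hom_def hom_def)
    moreover have "bij_betw (\<lambda>x. x) (carrier ?P) (carrier ?P)" by (simp add: bij_betw_def inj_on_def)
    ultimately show ?thesis
      unfolding ext_equivalent_def split_extension_def prod.case by (intro bexI[of _ "\<lambda>x. x"]) simp_all
  qed
  then have "?S \<in> ext_class G_k (krull kb k) ?C ?A ?S"
    using split_is_extension[OF discrete_constants discrete_quotient topspace_krull] by (simp add: ext_class_def)
  also have "ext_class G_k (krull kb k) ?C ?A ?S = elementary_obstruction k kb K F"
    using ob by (simp add: Ext1_units_def Ext1_def)
  finally obtain \<phi> where \<phi>: "\<phi> \<in> module_hom G_k ?B ?P" "\<And>a. a \<in> carrier ?A \<Longrightarrow> \<phi> a = (a, \<one>\<^bsub>?C\<^esub>)"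
    unfolding elementary_obstruction_def ext_class_def ext_equivalent_def split_extension_def by auto
  have carB: "carrier ?B = F - {0}" and multB: "x \<otimes>\<^bsub>?B\<^esub> y = x * y" for x y
    by (simp_all add: functions_module_def with_action_def)
  have carA: "carrier ?A = kb - {0}" and multA: "x \<otimes>\<^bsub>?A\<^esub> y = x * y" for x y
    by (simp_all add: constants_module_def with_action_def)
  have hom: "\<phi> x \<in> carrier ?A \<times> carrier ?C" "\<phi> (x * y) = \<phi> x \<otimes>\<^bsub>?A \<times>\<times> ?C\<^esub> \<phi> y"
    if "x \<in> F - {0}" "y \<in> F - {0}" for x y
  proof -
    have "\<phi> \<in> hom ?B ?P" using \<phi>(1) by (simp add: module_hom_def)
    from hom_in_carrier[OF this, of x] hom_mult[OF this, of x y] that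
    show "\<phi> x \<in> carrier ?A \<times> carrier ?C" "\<phi> (x * y) = \<phi> x \<otimes>\<^bsub>?A \<times>\<times> ?C\<^esub> \<phi> y"
      unfolding carB multB by (simp_all add: with_action_def)
  qed
  define r where "r x = fst (\<phi> x)" for x
  have "kummer_retraction k kb K F r"
  proof unfold_locales
    fix x y assume xy: "x \<in> F - {0}" "y \<in> F - {0}"
    show "r (x * y) = r x * r y" using hom(2)[OF xy] by (simp add: r_def mult_DirProd' multA)
  next
    fix x assume "x \<in> kb - {0}"
    then show "r x = x" using \<phi>(2)[of x] by (simp add: r_def carA)
  next
    fix x assume "x \<in> F - {0}"
    then show "r x \<in> kb - {0}" using hom(1)[of x x] by (auto simp: r_def carA)
  next
    fix g x assume g: "g \<in> Aut K" and x: "x \<in> F - {0}"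
    define \<sigma> where "\<sigma> = restrict g kb"
    have \<sigma>: "\<sigma> \<in> carrier G_k" unfolding \<sigma>_def by (rule restrict_kb[OF g])
    have "lift \<sigma> x = g x"
      by (rule Aut_agree_F[OF lift(1)[OF \<sigma>] g]) (use lift(2)[OF \<sigma>] x in \<open>auto simp: \<sigma>_def\<close>)
    then have "act ?B \<sigma> x = g x"
      using x by (simp add: functions_module_def with_action_def second_factor_action[OF \<sigma>])
    moreover have "\<phi> (act ?B \<sigma> x) = act ?P \<sigma> (\<phi> x)"
      using \<phi>(1) \<sigma> x carB unfolding module_hom_def by blast
    ultimately have "r (g x) = \<sigma> (r x)"
      by (simp add: r_def with_action_def constants_module_def case_prod_beta)
    moreover have "r x \<in> kb" using hom(1)[OF x x] by (auto simp: r_def carA)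
    ultimately show "r (g x) = g (r x)" by (simp add: \<sigma>_def)
  qed
  then show thesis by (rule that)
qed

end

section \<open>The maximal abelian extension and the splitting\<close>

context sep_tower
begin

lemma Aut_normalizes_F:
  assumes g: "g \<in> Aut K" and h: "h \<in> Aut F"
  obtains h' where "h' \<in> Aut F" "\<And>x. h (g x) = g (h' x)"
proof -
  obtain g' where g': "g' \<in> Aut K" "\<And>x. g' (g x) = x" "\<And>x. g (g' x) = x" using Aut_inverse[OF g] by metis
  have hK: "h \<in> Aut K" using h Aut_mono[OF K_F] by blast
  define h' where "h' = (\<lambda>x. g' (h (g x)))"
  have "(\<lambda>x. h (g x)) \<in> Aut K" by (rule Aut_comp[OF hK g])
  from Aut_comp[OF g'(1) this] have h'K: "h' \<in> Aut K" by (simp add: h'_def)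
  have "h' x = x" if "x \<in> F" for x
  proof -
    have "g x \<in> F" using Aut_F[OF g] that by blast
    then show ?thesis using Aut_fixes[OF h] g'(2) by (simp add: h'_def)
  qed
  then have "h' \<in> Aut F" using h'K by (simp add: Aut_def)
  then show thesis using g'(3) by (intro that[of h']) (simp_all add: h'_def)
qed

lemma Aut_K_abelian_part:
  assumes "g \<in> Aut K"
  shows "g ` abelian_part = abelian_part"
proof (rule Aut_image_eq[OF assms])
  fix g x assume g: "g \<in> Aut K" and x: "x \<in> abelian_part"
  show "g x \<in> abelian_part"
    unfolding abelian_part_def
  proof (intro CollectI ballI)
    fix a b assume ab: "a \<in> Aut F" "b \<in> Aut F"
    obtain a' where a': "a' \<in> Aut F" "\<And>x. a (g x) = g (a' x)" using Aut_normalizes_F[OF g ab(1)] by metis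
    obtain b' where b': "b' \<in> Aut F" "\<And>x. b (g x) = g (b' x)" using Aut_normalizes_F[OF g ab(2)] by metis
    have "a' (b' x) = b' (a' x)" using x a'(1) b'(1) by (simp add: abelian_part_def)
    then show "a (b (g x)) = b (a (g x))" by (simp add: a'(2) b'(2))
  qed
qed

lemma Gal_abelian_part_lift:
  assumes "\<sigma> \<in> carrier (Gal abelian_part F)"
  obtains g where "g \<in> Aut F" "\<And>x. x \<in> abelian_part \<Longrightarrow> \<sigma> x = g x"
proof -
  have fF: "\<sigma> x = x" if "x \<in> F" for x using assms that by (simp add: Gal_iff)
  have KC: "K \<subseteq> abelian_part" using K_F F_abelian_part by blast
  obtain g where g: "g \<in> Aut K" "\<And>x. x \<in> abelian_part \<Longrightarrow> g x = \<sigma> x"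
    using extend_to_Aut[OF abelian_part_subfld KC Gal_hom[OF assms]] fF K_F by (metis subsetD)
  have "g \<in> Aut F" using g fF F_abelian_part by (auto simp: Aut_def)
  then show thesis using g(2) by (intro that[of g]) auto
qed

lemma Aut_F_image: "g \<in> Aut F \<Longrightarrow> g ` abelian_part = abelian_part"
  using Aut_K_abelian_part Aut_mono[OF K_F] by blast

lemma restrict_abelian_part: "g \<in> Aut F \<Longrightarrow> restrict g abelian_part \<in> carrier (Gal abelian_part F)"
  by (rule restrict_Gal[OF _ Aut_F_image abelian_part_subfld F_abelian_part])

lemma abelian_part_galois: "galois_extension F abelian_part"
  unfolding galois_extension_def
proof (intro conjI ballI)
  show "subfield F ring_of_type_algebra" using F by (simp add: subfld_iff_subfield)
  show "subfield abelian_part ring_of_type_algebra" using abelian_part_subfld by (simp add: subfld_iff_subfield)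
  show "F \<subseteq> abelian_part" by (rule F_abelian_part)
  show "\<exists>p. p \<noteq> 0 \<and> set (coeffs p) \<subseteq> F \<and> poly p x = 0" for x
    using sep_imp_algebraic[OF F_sep[of x]] poly_in_iff_coeffs[OF F] by (auto simp: algebraic_over_def)
  show "{x \<in> abelian_part. \<forall>\<sigma>\<in>carrier (Gal abelian_part F). \<sigma> x = x} = F"
  proof (intro equalityI subsetI)
    fix x assume x: "x \<in> {x \<in> abelian_part. \<forall>\<sigma>\<in>carrier (Gal abelian_part F). \<sigma> x = x}"
    show "x \<in> F"
    proof (rule Aut_F_fixed)
      fix g assume "g \<in> Aut F"
      from bspec[OF _ restrict_abelian_part[OF this], of "\<lambda>\<sigma>. \<sigma> x = x"] x show "g x = x" by simp
    qed
  next
    fix x assume "x \<in> F"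
    then show "x \<in> {x \<in> abelian_part. \<forall>\<sigma>\<in>carrier (Gal abelian_part F). \<sigma> x = x}"
      using F_abelian_part by (auto simp: Gal_iff)
  qed
qed

lemma abelian_part_comm: "comm_group (Gal abelian_part F)"
proof (rule comm_groupI)
  let ?G = "Gal abelian_part F"
  have mult: "\<sigma> \<otimes>\<^bsub>?G\<^esub> \<tau> = restrict (\<lambda>x. g (h x)) abelian_part \<and> \<sigma> \<otimes>\<^bsub>?G\<^esub> \<tau> \<in> carrier ?G"
    if "\<sigma> \<in> carrier ?G" "\<tau> \<in> carrier ?G" "g \<in> Aut F" "h \<in> Aut F"
      "\<And>x. x \<in> abelian_part \<Longrightarrow> \<sigma> x = g x" "\<And>x. x \<in> abelian_part \<Longrightarrow> \<tau> x = h x" for \<sigma> \<tau> g h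
  proof -
    have "\<sigma> \<otimes>\<^bsub>?G\<^esub> \<tau> = restrict (\<lambda>x. g (h x)) abelian_part"
      using Gal_closed[OF that(2)] that(5,6) by (auto simp: Gal_mult[OF that(1,2)] compose_def intro!: restrict_ext)
    then show ?thesis using restrict_abelian_part[OF Aut_comp[OF that(3,4)]] by simp
  qed
  fix \<sigma> \<tau> assume \<sigma>: "\<sigma> \<in> carrier ?G" and \<tau>: "\<tau> \<in> carrier ?G"
  obtain g where g: "g \<in> Aut F" "\<And>x. x \<in> abelian_part \<Longrightarrow> \<sigma> x = g x" using Gal_abelian_part_lift[OF \<sigma>] by metis
  obtain h where h: "h \<in> Aut F" "\<And>x. x \<in> abelian_part \<Longrightarrow> \<tau> x = h x" using Gal_abelian_part_lift[OF \<tau>] by metis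
  show "\<sigma> \<otimes>\<^bsub>?G\<^esub> \<tau> \<in> carrier ?G" using mult[OF \<sigma> \<tau> g(1) h(1) g(2) h(2)] by blast
  have "restrict (\<lambda>x. g (h x)) abelian_part = restrict (\<lambda>x. h (g x)) abelian_part"
    using g(1) h(1) by (intro restrict_ext) (simp add: abelian_part_def)
  then show "\<sigma> \<otimes>\<^bsub>?G\<^esub> \<tau> = \<tau> \<otimes>\<^bsub>?G\<^esub> \<sigma>"
    using mult[OF \<sigma> \<tau> g(1) h(1) g(2) h(2)] mult[OF \<tau> \<sigma> h(1) g(1) h(2) g(2)] by simp
next
  let ?G = "Gal abelian_part F"
  show one: "\<one>\<^bsub>?G\<^esub> \<in> carrier ?G" using restrict_abelian_part[OF Aut_id] by (simp add: Gal_one)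
  fix \<sigma> assume \<sigma>: "\<sigma> \<in> carrier ?G"
  show "\<one>\<^bsub>?G\<^esub> \<otimes>\<^bsub>?G\<^esub> \<sigma> = \<sigma>"
    using Gal_closed[OF \<sigma>] Gal_extensional[OF \<sigma>] one \<sigma>
    by (intro extensionalityI[of _ abelian_part]) (auto simp: Gal_mult Gal_one compose_def)
  obtain g where g: "g \<in> Aut F" "\<And>x. x \<in> abelian_part \<Longrightarrow> \<sigma> x = g x" using Gal_abelian_part_lift[OF \<sigma>] by metis
  obtain g' where g': "g' \<in> Aut F" "\<And>x. g' (g x) = x" using Aut_inverse[OF g(1)] by metis
  have r: "restrict g' abelian_part \<in> carrier ?G" by (rule restrict_abelian_part[OF g'(1)])
  have "restrict g' abelian_part \<otimes>\<^bsub>?G\<^esub> \<sigma> = \<one>\<^bsub>?G\<^esub>"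
    unfolding Gal_mult[OF r \<sigma>] Gal_one compose_def
    by (rule restrict_ext) (use Gal_closed[OF \<sigma>] g(2) g'(2) in auto)
  then show "\<exists>\<tau>\<in>carrier ?G. \<tau> \<otimes>\<^bsub>?G\<^esub> \<sigma> = \<one>\<^bsub>?G\<^esub>" using r by blast
next
  let ?G = "Gal abelian_part F"
  fix \<rho> \<sigma> \<tau> assume "\<rho> \<in> carrier ?G" "\<sigma> \<in> carrier ?G" "\<tau> \<in> carrier ?G"
  then have "\<rho> \<in> carrier (BijGroup abelian_part)" "\<sigma> \<in> carrier (BijGroup abelian_part)" "\<tau> \<in> carrier (BijGroup abelian_part)"
    by (simp_all add: Gal_iff BijGroup_def)
  from monoid.m_assoc[OF group.is_monoid[OF group_BijGroup] this]
  show "\<rho> \<otimes>\<^bsub>?G\<^esub> \<sigma> \<otimes>\<^bsub>?G\<^esub> \<tau> = \<rho> \<otimes>\<^bsub>?G\<^esub> (\<sigma> \<otimes>\<^bsub>?G\<^esub> \<tau>)" by (simp add: Gal_def)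
qed

text \<open>The orbit of \<open>x\<close> under \<open>Gal(L/F)\<close> is the set of roots of a polynomial over \<open>F\<close>.\<close>

lemma galois_extension_stable:
  assumes gal: "galois_extension F L" and g: "g \<in> Aut F" and x: "x \<in> L"
  shows "g x \<in> L"
proof -
  have L: "subfld L" and FL: "F \<subseteq> L"
    and fixF: "\<And>y. y \<in> L \<Longrightarrow> (\<And>\<sigma>. \<sigma> \<in> carrier (Gal L F) \<Longrightarrow> \<sigma> y = y) \<Longrightarrow> y \<in> F"
    using gal by (auto simp: galois_extension_def subfld_iff_subfield)
  obtain p where p: "p \<noteq> 0" "poly_in F p" "poly p x = 0"
    using sep_imp_algebraic[OF F_sep[of x]] by (auto simp: algebraic_over_def)
  define S where "S = {\<sigma> x |\<sigma>. \<sigma> \<in> carrier (Gal L F)}"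
  have SL: "S \<subseteq> L" using Gal_closed x by (auto simp: S_def)
  have pS: "poly p s = 0" if "s \<in> S" for s
  proof -
    obtain \<sigma> where \<sigma>: "\<sigma> \<in> carrier (Gal L F)" "s = \<sigma> x" using \<open>s \<in> S\<close> by (auto simp: S_def)
    have h: "hom_on L \<sigma>" by (rule Gal_hom[OF \<sigma>(1)])
    have "map_poly \<sigma> p = p"
      using p(2) \<sigma>(1) by (intro poly_eqI) (simp add: coeff_map[OF L h] poly_in_def Gal_iff)
    then show ?thesis
      using map_poly_eval[OF L h poly_in_mono[OF p(2) FL] x] p(3) \<sigma>(2) hom_on_0[OF L h] by simp
  qed
  have fin: "finite S" by (rule finite_subset[OF _ poly_roots_finite[OF p(1)]]) (use pS in auto)
  define q where "q = (\<Prod>s\<in>S. [:- s, 1:])"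
  have qL: "poly_in L q"
    unfolding q_def using SL
    by (intro poly_in_prod[OF L] poly_in_pCons[OF L] poly_in_0[OF L] subfld_uminus[OF L] subfld_1[OF L]) auto
  have "poly.coeff q i \<in> F" for i
  proof (rule fixF)
    show "poly.coeff q i \<in> L" using qL by (simp add: poly_in_def)
    fix \<sigma> assume \<sigma>: "\<sigma> \<in> carrier (Gal L F)"
    have h: "hom_on L \<sigma>" by (rule Gal_hom[OF \<sigma>])
    have inj: "inj_on \<sigma> S" using \<sigma> SL inj_on_subset by (fastforce simp: Gal_iff Bij_def bij_betw_def)
    have "\<sigma> ` S \<subseteq> S"
    proof
      fix s assume "s \<in> \<sigma> ` S"
      then obtain \<tau> where \<tau>: "\<tau> \<in> carrier (Gal L F)" "s = \<sigma> (\<tau> x)" by (auto simp: S_def)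
      have mem: "compose L \<sigma> \<tau> \<in> carrier (Gal L F)"
        using \<sigma> \<tau>(1) compose_Bij[of \<sigma> L \<tau>] Gal_closed[OF \<tau>(1)] FL
        by (auto simp: Gal_iff compose_def subfld_1[OF L] subfld_add[OF L] subfld_mult[OF L])
      have "s = compose L \<sigma> \<tau> x" using \<tau>(2) x by (simp add: compose_def)
      then show "s \<in> S" using mem unfolding S_def by blast
    qed
    then have \<sigma>S: "\<sigma> ` S = S" using fin inj by (intro endo_inj_surj)
    have "map_poly \<sigma> q = (\<Prod>s\<in>S. [:- \<sigma> s, 1:])"
      unfolding q_def by (rule map_prod_linear[OF L h fin SL])
    also have "\<dots> = (\<Prod>s\<in>\<sigma> ` S. [:- s, 1:])" using inj by (simp add: prod.reindex)
    finally have "map_poly \<sigma> q = q" by (simp add: \<sigma>S q_def)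
    then show "\<sigma> (poly.coeff q i) = poly.coeff q i" using coeff_map[OF L h] by metis
  qed
  then have qF: "poly_in F q" by (simp add: poly_in_def)
  have "x \<in> S"
  proof -
    have "(\<lambda>y\<in>L. y) \<in> carrier (Gal L F)" by (rule restrict_Gal[OF Aut_id _ L FL]) simp
    moreover have "x = (\<lambda>y\<in>L. y) x" using x by simp
    ultimately show ?thesis unfolding S_def by blast
  qed
  then have "poly q x = 0" using fin by (auto simp: q_def poly_prod)
  then have "poly q (g x) = 0" by (rule Aut_root[OF g qF])
  then have "g x \<in> S" using fin by (auto simp: q_def poly_prod)
  then show ?thesis using SL by blast
qed

lemma max_abelian_eq: "max_abelian F = abelian_part"
proof
  show "abelian_part \<subseteq> max_abelian F"
    unfolding max_abelian_def using abelian_part_galois abelian_part_comm by blast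
  show "max_abelian F \<subseteq> abelian_part"
  proof
    fix x assume "x \<in> max_abelian F"
    then obtain L where gal: "galois_extension F L" and comm: "comm_group (Gal L F)" and x: "x \<in> L"
      unfolding max_abelian_def by blast
    have L: "subfld L" and FL: "F \<subseteq> L" using gal by (auto simp: galois_extension_def subfld_iff_subfield)
    have im: "g ` L = L" if "g \<in> Aut F" for g
      using that galois_extension_stable[OF gal] by (intro Aut_image_eq)
    have "g (h x) = h (g x)" if gh: "g \<in> Aut F" "h \<in> Aut F" for g h
    proof -
      have r: "restrict g L \<in> carrier (Gal L F)" "restrict h L \<in> carrier (Gal L F)"
        using gh im by (auto intro: restrict_Gal[OF _ _ L FL])
      have "compose L (restrict g L) (restrict h L) x = compose L (restrict h L) (restrict g L) x"
        using comm_monoid.m_comm[OF comm_group.axioms(1)[OF comm] r] r by (simp add: Gal_mult)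
      then show ?thesis
        using x galois_extension_stable[OF gal gh(1) x] galois_extension_stable[OF gal gh(2) x]
        by (simp add: compose_def)
    qed
    then show "x \<in> abelian_part" by (simp add: abelian_part_def)
  qed
qed

text \<open>The section sends \<open>\<sigma>\<close> to the restriction of any automorphism over \<open>M\<close> that extends \<open>\<sigma>\<close>. On \<open>M kb\<close> this
  does not depend on the choice, whence multiplicativity; and its value at \<open>x = \<Sum> f(y) y\<close> with
  \<open>y \<in> M\<close> only depends on the values of \<open>\<sigma>\<close> at the constants \<open>f(y)\<close>, whence continuity.\<close>

lemma splitting_of_complement:
  assumes M: "subfld M" "K \<subseteq> M" "M \<inter> kb \<subseteq> k" and ab: "abelian_part \<subseteq> lspan kb M"
  shows "restriction_splits (max_abelian F) K kb k"
proof -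
  let ?C = abelian_part
  define l where "l \<sigma> = (SOME g. g \<in> Aut M \<and> (\<forall>x\<in>kb. g x = \<sigma> x))" for \<sigma>
  have l: "l \<sigma> \<in> Aut M" "\<And>x. x \<in> kb \<Longrightarrow> l \<sigma> x = \<sigma> x" if "\<sigma> \<in> carrier (Gal kb k)" for \<sigma>
  proof -
    have "\<exists>g. g \<in> Aut M \<and> (\<forall>x\<in>kb. g x = \<sigma> x)"
      using extend_constants[OF M Gal_hom[OF that]] that by (metis Gal_iff)
    from someI_ex[OF this] show "l \<sigma> \<in> Aut M" "\<And>x. x \<in> kb \<Longrightarrow> l \<sigma> x = \<sigma> x"
      unfolding l_def by blast+
  qed
  have AMK: "g \<in> Aut K" if "g \<in> Aut M" for g using that Aut_mono[OF M(2)] by blast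
  have agree: "g x = h x" if "g \<in> Aut M" "h \<in> Aut M" "\<And>x. x \<in> kb \<Longrightarrow> g x = h x" "x \<in> ?C" for g h x
    using Aut_agree[OF that(1-3)] ab that(4) by blast
  have KC: "K \<subseteq> ?C" and kbC: "kb \<subseteq> ?C" using K_F kb_F F_abelian_part by auto
  define s where "s \<sigma> = restrict (l \<sigma>) ?C" for \<sigma>
  have s_mem: "s \<sigma> \<in> carrier (Gal ?C K)" if "\<sigma> \<in> carrier (Gal kb k)" for \<sigma>
    unfolding s_def
    by (rule restrict_Gal[OF AMK[OF l(1)[OF that]] Aut_K_abelian_part[OF AMK[OF l(1)[OF that]]] abelian_part_subfld KC])
  have "s \<in> hom (Gal kb k) (Gal ?C K)"
  proof (rule homI)
    fix \<sigma> \<tau> assume \<sigma>: "\<sigma> \<in> carrier (Gal kb k)" and \<tau>: "\<tau> \<in> carrier (Gal kb k)"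
    have \<sigma>\<tau>: "\<sigma> \<otimes>\<^bsub>Gal kb k\<^esub> \<tau> \<in> carrier (Gal kb k)" using lift_mult(1)[OF \<sigma> \<tau> subfld_0[OF F]] .
    have "l (\<sigma> \<otimes>\<^bsub>Gal kb k\<^esub> \<tau>) x = l \<sigma> (l \<tau> x)" if "x \<in> ?C" for x
    proof (rule agree[OF l(1)[OF \<sigma>\<tau>] Aut_comp[OF l(1)[OF \<sigma>] l(1)[OF \<tau>]] _ that])
      fix x assume "x \<in> kb"
      then show "l (\<sigma> \<otimes>\<^bsub>Gal kb k\<^esub> \<tau>) x = l \<sigma> (l \<tau> x)"
        using l(2)[OF \<sigma>\<tau>] l(2)[OF \<tau>] l(2)[OF \<sigma>] Gal_closed[OF \<tau>] by (simp add: Gal_mult[OF \<sigma> \<tau>] compose_def)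
    qed
    moreover have "l \<tau> x \<in> ?C" if "x \<in> ?C" for x
      using Aut_K_abelian_part[OF AMK[OF l(1)[OF \<tau>]]] that by blast
    ultimately have "s (\<sigma> \<otimes>\<^bsub>Gal kb k\<^esub> \<tau>) = compose ?C (s \<sigma>) (s \<tau>)"
      unfolding s_def compose_def by (intro restrict_ext) simp
    then show "s (\<sigma> \<otimes>\<^bsub>Gal kb k\<^esub> \<tau>) = s \<sigma> \<otimes>\<^bsub>Gal ?C K\<^esub> s \<tau>"
      by (simp only: Gal_mult[OF s_mem[OF \<sigma>] s_mem[OF \<tau>]])
  qed (rule s_mem)
  moreover have "restrict (s \<sigma>) kb = \<sigma>" if "\<sigma> \<in> carrier (Gal kb k)" for \<sigma>
    using Gal_extensional[OF that] l(2)[OF that] kbC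
    by (intro extensionalityI[of _ kb]) (auto simp: s_def)
  moreover have "continuous_map (krull kb k) (krull ?C K) s"
    unfolding krull_def[of ?C K] continuous_map_in_subtopology continuous_map_componentwise
  proof (intro conjI ballI)
    show "s ` topspace (krull kb k) \<subseteq> extensional ?C" by (auto simp: s_def)
    show "s \<in> topspace (krull kb k) \<rightarrow> carrier (Gal ?C K)" using s_mem by (auto simp: topspace_krull)
    fix x assume x: "x \<in> ?C"
    then have "x \<in> lspan kb M" using ab by blast
    then obtain I f where If: "finite I" "I \<subseteq> M" "\<forall>y\<in>I. f y \<in> kb" "x = (\<Sum>y\<in>I. f y * y)"
      unfolding lspan_def by blast
    have eq: "s \<sigma> x = (\<Sum>y\<in>I. \<sigma> (f y) * y)" if \<sigma>: "\<sigma> \<in> carrier (Gal kb k)" for \<sigma>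
    proof -
      have "l \<sigma> x = (\<Sum>y\<in>I. \<sigma> (f y) * y)"
        unfolding If(4) Aut_simps(10)[OF l(1)[OF \<sigma>]]
        by (rule sum.cong) (use If(2,3) l[OF \<sigma>] in \<open>auto simp: Aut_simps(4)[OF l(1)[OF \<sigma>]] Aut_def\<close>)
      then show ?thesis using x by (simp add: s_def)
    qed
    show "continuous_map (krull kb k) (discrete_topology ?C) (\<lambda>\<sigma>. s \<sigma> x)"
      unfolding continuous_map_def
    proof (intro conjI allI impI)
      show "(\<lambda>\<sigma>. s \<sigma> x) \<in> topspace (krull kb k) \<rightarrow> topspace (discrete_topology ?C)"
        using Gal_closed[OF s_mem x] by (auto simp: topspace_krull)
      fix U show "openin (krull kb k) {\<sigma> \<in> topspace (krull kb k). s \<sigma> x \<in> U}"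
        unfolding topspace_krull
      proof (rule openin_krull)
        fix \<sigma> assume \<sigma>: "\<sigma> \<in> {\<sigma> \<in> carrier (Gal kb k). s \<sigma> x \<in> U}"
        have "s \<tau> x \<in> U" if "\<tau> \<in> carrier (Gal kb k)" "\<forall>y\<in>f ` I. \<tau> y = \<sigma> y" for \<tau>
        proof -
          have "(\<Sum>y\<in>I. \<tau> (f y) * y) = (\<Sum>y\<in>I. \<sigma> (f y) * y)" using that(2) by simp
          then show ?thesis using \<sigma> eq[OF that(1)] eq[of \<sigma>] by simp
        qed
        then show "\<exists>S. finite S \<and> S \<subseteq> kb \<and> (\<forall>\<tau>\<in>carrier (Gal kb k). (\<forall>y\<in>S. \<tau> y = \<sigma> y) \<longrightarrow>
            \<tau> \<in> {\<sigma> \<in> carrier (Gal kb k). s \<sigma> x \<in> U})"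
          using If(1,3) \<sigma> by (intro exI[of _ "f ` I"]) (simp add: image_subset_iff)
      qed simp
    qed
  qed
  ultimately show ?thesis
    unfolding restriction_splits_def max_abelian_eq by (intro bexI[of _ s] conjI ballI) auto
qed

end

theorem (in kummer_retraction) abelian_splitting: "restriction_splits (max_abelian F) K kb k"
proof -
  obtain M0 where M0: "subfld M0" "K \<subseteq> M0" "M0 \<inter> kb \<subseteq> k" "radicals \<subseteq> lspan kb M0"
    using kummer_complement by metis
  obtain M where M: "subfld M" "M0 \<subseteq> M" "M \<inter> kb \<subseteq> k"
    and AS: "\<And>p y. Factorial_Ring.prime (p :: nat) \<Longrightarrow> of_nat p = (0 :: 'a) \<Longrightarrow> y ^ p - y \<in> lspan kb M \<Longrightarrow> y \<in> lspan kb M"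
    using artin_schreier_complement[OF M0(1-3)] by metis
  have KM: "K \<subseteq> M" using M0(2) M(2) by blast
  note E = lspan_kb_subfld[OF M(1) KM]
  have "lspan kb M0 \<subseteq> lspan kb M" unfolding lspan_def using M(2) by blast
  then have rad: "y \<in> lspan kb M" if "of_nat n \<noteq> (0 :: 'a)" "y ^ n \<in> F" for n y
    using that M0(4) subfld_0[OF E(1)] by (cases "y = 0") (auto simp: radicals_def)
  show ?thesis
    by (rule splitting_of_complement[OF M(1) KM M(3) abelian_part_subset[OF E(1,4) rad AS]])
qed

section \<open>The function field of a variety\<close>

text \<open>As \<open>generic_point\<close> is defined by a description operator, the stalk at it could a priori be
  empty. But a tensor product that is a field is not zero, so both of its factors have elements, and
  an element of the stalk shows that \<open>generic_point\<close> is a point.\<close>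

lemma tensor_product_nonempty:
  fixes A :: "('b, 'm) ring_scheme" and B :: "('d, 'n) ring_scheme"
  assumes "tensor_product cA A cB B (fld F) u v" and F: "subfld F"
  shows "carrier A \<noteq> {}"
proof
  assume empty: "carrier A = {}"
  interpret field "fld F" by (rule fld_field[OF F])
  define \<phi> where "\<phi> = (\<lambda>z :: 'b \<times> 'd \<Rightarrow>\<^sub>0 int. \<Oplus>\<^bsub>fld F\<^esub>ab\<in>Poly_Mapping.keys z.
    add_pow (fld F) (Poly_Mapping.lookup z ab) (u (fst ab) \<otimes>\<^bsub>fld F\<^esub> v (snd ab)))"
  have "\<phi> ` carrier (free_Abelian_group (carrier A \<times> carrier B)) = F"
    using assms(1) unfolding tensor_product_def Let_def \<phi>_def[symmetric] by simp
  then have "1 \<in> \<phi> ` carrier (free_Abelian_group (carrier A \<times> carrier B))" using subfld_1[OF F] by simp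
  then obtain z where z: "1 = \<phi> z" "z \<in> carrier (free_Abelian_group (carrier A \<times> carrier B))" by (rule imageE)
  then have "Poly_Mapping.keys z = {}" using empty by auto
  then show False using z(1) by (simp add: \<phi>_def)
qed

lemma function_field_cring:
  assumes "locally_ringed_space Z" "carrier (function_field Z) \<noteq> {}"
  shows "cring (function_field Z)" "generic_point Z \<in> points Z"
proof -
  obtain U where "openin (space Z) U" "generic_point Z \<in> U"
    using assms(2) by (auto simp: function_field_def stalk_def)
  then show x: "generic_point Z \<in> points Z" using openin_subset by blast
  then show "cring (function_field Z)"
    using assms(1) by (simp add: locally_ringed_space_def local_ring_def function_field_def)
qed

theorem corollary3p8:
  fixes Z :: "('x, 's) ringed_space" and c :: "'k::field \<Rightarrow> 's"
    and Zb :: "('y, 't) ringed_space" and cb :: "'o::field \<Rightarrow> 't"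
    and f :: "'y \<Rightarrow> 'x" and fs :: "'x set \<Rightarrow> 's \<Rightarrow> 't"
    and \<iota> :: "'k \<Rightarrow> 'o" and \<alpha> :: "('x set \<times> 's) set \<Rightarrow> 'o"
    and k kb K kbZ :: "'o set"
  assumes "variety c Z" and "smooth c Z"
    and "\<iota> \<in> ring_hom ring_of_type_algebra ring_of_type_algebra" and "k = range \<iota>"
    and "separable_closure k kb"
    and "base_change c Z \<iota> kb cb Zb f fs" and "irreducible_topology (space Zb)"
    and "K = \<alpha> ` carrier (function_field Z)"
    and "tensor_product (const_function c Z) (function_field Z) \<iota> (fld kb) (fld kbZ) \<alpha> (\<lambda>x. x)"
    and "separable_closure kbZ UNIV"
    and "elementary_obstruction k kb K kbZ = \<one>\<^bsub>Ext1_units k kb K kbZ\<^esub>"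
  shows "restriction_splits (max_abelian kbZ) K kb k"
proof -
  have \<iota>: "\<iota> 1 = 1" "\<And>x y. \<iota> (x + y) = \<iota> x + \<iota> y" "\<And>x y. \<iota> (x * y) = \<iota> x * \<iota> y"
    using assms(3) by (auto simp: ring_hom_def ring_of_type_algebra_def)
  have sub: "subfld k" "subfld kb" "subfld kbZ" "k \<subseteq> kb"
    using assms(5,10) by (auto simp: separable_closure_def subfld_iff_subfield)
  have lrs: "locally_ringed_space Z" and cZ: "c \<in> ring_hom (fld UNIV) (sections Z (points Z))"
    using assms(1) by (auto simp: variety_def scheme_over_def scheme_def)
  have ne: "carrier (function_field Z) \<noteq> {}"
    by (rule tensor_product_nonempty[OF assms(9) sub(3)])
  note ff = function_field_cring[OF lrs ne]
  have const: "const_function c Z l \<in> carrier (function_field Z)" for l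
    using ring_hom_closed[OF cZ, of l] ff(2) openin_topspace[of "space Z"]
    unfolding const_function_def function_field_def stalk_def by auto
  note tower = tensor_product_tower[OF assms(9) ff(1) \<iota> const sub(2) _ sub(3), folded assms(4) assms(8), OF sub(4)]
  have coeffs: "set (coeffs p) \<subseteq> A \<longleftrightarrow> poly_in A p" if "subfld A" for A and p :: "'o poly"
    using poly_in_iff_coeffs[OF that] by blast
  interpret sep_tower k kb K kbZ
  proof
    show "sep_over k x" if "x \<in> kb" for x
      using assms(5) that coeffs[OF sub(1)] unfolding separable_closure_def sep_over_def by blast
    show "sep_closed kb"
      using assms(5) coeffs[OF sub(2)] unfolding separable_closure_def sep_closed_def by blast
    show "sep_over kbZ x" for x
      using assms(10) coeffs[OF sub(3)] unfolding separable_closure_def sep_over_def by blast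
    show "sep_closed (UNIV :: 'o set)"
      using assms(10) coeffs[OF subfld_UNIV] unfolding separable_closure_def sep_closed_def by blast
  qed (use sub tower in auto)
  obtain r where "kummer_retraction k kb K kbZ r"
    using retraction_of_vanishing_obstruction[OF assms(11)] .
  then show ?thesis by (rule kummer_retraction.abelian_splitting)
qed

end
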